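(* Consider the noisy distributed integral controlled system on $\mathbb{Z}_L^d$ ($N=L^d$) $$\begin{bmatrix}\dot z\\ \dot x\\ \dot v\end{bmatrix}=\begin{bmatrix}A&0&-c_oI\\ 0&0&I\\ I&F&G\end{bmatrix}\begin{bmatrix}z\\ x\\ v\end{bmatrix}+\begin{bmatrix}0&-c_o\varepsilon I\\ 0&0\\ I&0\end{bmatrix}\bar w,$$ where $\bar w$ is a vector of uncorrelated white noise, $\varepsilon>0$ is fixed and the operators $F,G$ are fixed. Suppose that the integral controller may be redesigned with the network size: the gain $c_o>0$ and the operator $A$ may depend on $L$, with the requirements that the gains be fixed and finite and that $A$ be local being relaxed. Then the best-achievable asymptotic scaling of the per-site variance $V_N$ over such designs is that of distributed static feedback (the system $\dot x=v$, $\dot v=Fx+Gv+w$), namely, with $\beta=\max\{\|f\|_\infty,\|g\|_\infty\}$, $$V_N\sim\frac1\beta\ \text{ for every } d\quad\text{(local error)},\qquad V_N\sim\frac1\beta\begin{cases}N&d=1\\ \log N&d=2\\ 1&d\ge3\end{cases}\quad\text{(global error)}.$$ That is, these scalings can be achieved by some such design, and no such design gives a $V_N$ with a better asymptotic scaling in $N$.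
   Context: Network: $\mathbb{Z}_L^d$ is the $d$-dimensional discrete torus with $N=L^d$ nodes. At each node $k$ there are states $x_k$ (position), $v_k$ (velocity) and a controller integral state $z_k$. They arise from $\dot x=v$, $\dot v=Fx+Gv+u+w$, with control $u=z$, $\dot z=-c_ov^m+Az$, and noisy measurement $v^m=v+\eta$, where $w$ and $\eta$ are uncorrelated white noises and $\varepsilon$ is the intensity of $\eta$ relative to $w$, entering through the input matrix in the claim. Feedback operators are convolutions: $(Fx)_k=\sum_{l\in\mathbb{Z}_L^d}f_{k-l}x_l$ with function array $f=\{f_k\}$, and similarly $G$ with $g$ and $A$ with $a$. Assumptions. Relative position measurements: $\sum_kf_k=0$, and $A$ is likewise relative, $\sum_ka_k=0$. $G$ may contain absolute feedback, with gain $g_o>0$. Locality (for $F,G$): $f_k=g_k=0$ for $|k|>q$, with $q$ independent of $L$. Reflection symmetry: $f_k=f_{-k}$, $g_k=g_{-k}$, $a_k=a_{-k}$. Coordinate decoupling: the feedback in each of the $d$ coordinate directions is decoupled from the components in the other coordinates, and the array elements of all feedback operators are isotropic. Fourier symbols: $\hat f(\theta)=\sum_kf_ke^{-i\theta\cdot k}$, similarly $\hat g,\hat a$, evaluated at $\theta=2\pi n/L$. Admissible $F,G$ satisfy, for $\theta\in[-\pi,\pi]^d$, $\hat f(\theta)\sim-\|f\|_\infty|\theta|^2$ and $\hat g(\theta)\sim-g_o$ (equal in sign and order up to positive constant factors independent of $\theta$). The operator $A$ is such that $\hat a(\theta)<0$ for $\theta\neq0$, so that the diagonalized system matrices are Hurwitz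 for $\theta\ne0$. Outputs. Global error: $y_k=x_k-\frac1N\sum_{l}x_l$. Local error: $y_k=x_k-x_{k-1}$ (deviation from nearest neighbour), whose Fourier symbol enters via $\hat l(\theta)$, $\hat l(\theta)=2(1-\cos\theta)$ for $d=1$ and $\hat l(\theta)\sim|\theta|^2$ in general. Per-site variance: $V_N=\lim_{t\to\infty}\mathbb{E}\{y_k^T(t)y_k(t)\}$, independent of $k$. It equals $\frac1N\sum_{\theta=2\pi n/L,\ n\in\mathbb{Z}_L^d\setminus\{0\}}\mathrm{tr}(\hat{\mathcal B}^*(\theta)\hat P(\theta)\hat{\mathcal B}(\theta))$, where $\hat{\mathcal A},\hat{\mathcal B},\hat{\mathcal C}$ are the Fourier symbols of the state-space matrices and $\hat P$ solves $\hat{\mathcal A}^*\hat P+\hat P\hat{\mathcal A}=-\hat{\mathcal C}^*\hat{\mathcal C}$. Scaling notation: $u(N)\sim v(N)$ means $\underline c\,v(N)\le u(N)\le\bar c\,v(N)$ with constants $\underline c,\bar c>0$ independent of $N$; asymptotic scalings hold for all $N\ge\bar N$ for some $\bar N$. *)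

theory Defs
  imports "HOL-Probability.Probability"
begin

(* The discrete torus, with representatives 0, ..., L - 1 in every direction. *)

definition torus :: "nat \<Rightarrow> (int ^ 'd) set" where
  "torus L = {k. \<forall>i. 0 \<le> k $ i \<and> k $ i < int L}"

definition tmod :: "nat \<Rightarrow> int ^ 'd \<Rightarrow> int ^ 'd" where
  "tmod L k = (\<chi> i. k $ i mod int L)"

(* Function arrays on Z^d that do not depend on L act on the torus through their periodisation.
   For an array supported in a box of radius q and L > 2 q, this is just the array itself,
   every index being replaced by its residue. *)

definition wrap :: "nat \<Rightarrow> (int ^ 'd \<Rightarrow> real) \<Rightarrow> int ^ 'd \<Rightarrow> real" where
  "wrap L f k = (\<Sum>m | f m \<noteq> 0 \<and> tmod L m = k. f m)"

(* The array elements are scalars acting on vectors: this encodes that the coordinate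
   directions are decoupled and that the array elements are isotropic (multiples of the
   identity matrix). *)

definition conv :: "nat \<Rightarrow> (int ^ 'd \<Rightarrow> real) \<Rightarrow> (int ^ 'd \<Rightarrow> real ^ 'd) \<Rightarrow> int ^ 'd \<Rightarrow> real ^ 'd" where
  "conv L a x k = (\<Sum>l\<in>torus L. a (tmod L (k - l)) *\<^sub>R x l)"

(* Symbol of an array that lives on the finite index set S. It is real for the
   reflection symmetric arrays below, so that sign conditions are put on its real part. *)

definition symbol :: "(int ^ 'd) set \<Rightarrow> (int ^ 'd \<Rightarrow> real) \<Rightarrow> real ^ 'd \<Rightarrow> complex" where
  "symbol S a \<theta> = (\<Sum>k\<in>S. complex_of_real (a k) * cis (- (\<theta> \<bullet> (\<chi> i. real_of_int (k $ i)))))"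

definition frequency :: "nat \<Rightarrow> int ^ 'd \<Rightarrow> real ^ 'd" where
  "frequency L n = (\<chi> i. 2 * pi * real_of_int (n $ i) / real L)"

definition sup_norm :: "(int ^ 'd \<Rightarrow> real) \<Rightarrow> real" where
  "sup_norm f = (SUP k. \<bar>f k\<bar>)"

definition gain_bound :: "(int ^ 'd \<Rightarrow> real) \<Rightarrow> (int ^ 'd \<Rightarrow> real) \<Rightarrow> real" where
  "gain_bound f g = max (sup_norm f) (sup_norm g)"

definition local_array :: "(int ^ 'd \<Rightarrow> real) \<Rightarrow> bool" where
  "local_array f \<longleftrightarrow> (\<exists>q::nat. \<forall>k. (\<exists>i. \<bar>k $ i\<bar> > int q) \<longrightarrow> f k = 0)"

(* f = 0 is excluded: its symbol has order sup_norm f * |theta|^2 only in a degenerate sense,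
   and the closed loop would not be stable. *)

definition admissible_feedback ::
    "(int ^ 'd \<Rightarrow> real) \<Rightarrow> (int ^ 'd \<Rightarrow> real) \<Rightarrow> real \<Rightarrow> bool" where
  "admissible_feedback f g g\<^sub>o \<longleftrightarrow>
     local_array f \<and> local_array g \<and>
     (\<forall>k. f (- k) = f k) \<and> (\<forall>k. g (- k) = g k) \<and>
     (\<Sum>k | f k \<noteq> 0. f k) = 0 \<and> (\<exists>k. f k \<noteq> 0) \<and> g\<^sub>o > 0 \<and>
     (\<exists>lo>0. \<exists>hi>0. \<forall>\<theta>. (\<forall>i. - pi \<le> \<theta> $ i \<and> \<theta> $ i \<le> pi) \<longrightarrow>
        lo * (sup_norm f * (norm \<theta>)\<^sup>2) \<le> - Re (symbol {k. f k \<noteq> 0} f \<theta>) \<and>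
        - Re (symbol {k. f k \<noteq> 0} f \<theta>) \<le> hi * (sup_norm f * (norm \<theta>)\<^sup>2)) \<and>
     (\<exists>lo>0. \<exists>hi>0. \<forall>\<theta>. (\<forall>i. - pi \<le> \<theta> $ i \<and> \<theta> $ i \<le> pi) \<longrightarrow>
        lo * g\<^sub>o \<le> - Re (symbol {k. g k \<noteq> 0} g \<theta>) \<and>
        - Re (symbol {k. g k \<noteq> 0} g \<theta>) \<le> hi * g\<^sub>o)"

(* A design: for every L an array a L on the torus and a gain c L, without any locality or
   any bound that is uniform in L. *)

definition integral_design :: "(nat \<Rightarrow> int ^ 'd \<Rightarrow> real) \<Rightarrow> (nat \<Rightarrow> real) \<Rightarrow> bool" where
  "integral_design a c \<longleftrightarrow>
     (\<forall>L>0. c L > 0 \<and>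
        (\<Sum>k\<in>torus L. a L k) = 0 \<and>
        (\<forall>k\<in>torus L. a L (tmod L (- k)) = a L k) \<and>
        (\<forall>n\<in>torus L - {0}. Re (symbol (torus L) (a L) (frequency L n)) < 0))"

(* White noise is represented by its time integral W: for unit intensity noises with
   covariance delta_ij * delta(s - t), W has mean zero and covariance delta_ij * min s t
   (e.g. independent Brownian motions). *)

definition uncorrelated_white_noise ::
    "'w measure \<Rightarrow> 'j set \<Rightarrow> ('j \<Rightarrow> real \<Rightarrow> 'w \<Rightarrow> real) \<Rightarrow> bool" where
  "uncorrelated_white_noise M J W \<longleftrightarrow>
     prob_space M \<and>
     (\<forall>j\<in>J. \<forall>t\<ge>0. W j t \<in> borel_measurable M \<and>
        integrable M (\<lambda>\<omega>. (W j t \<omega>)\<^sup>2) \<and> (\<integral>\<omega>. W j t \<omega> \<partial>M) = 0) \<and>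
     (\<forall>i\<in>J. \<forall>j\<in>J. \<forall>s\<ge>0. \<forall>t\<ge>0.
        (\<integral>\<omega>. W i s \<omega> * W j t \<omega> \<partial>M) = (if i = j then min s t else 0)) \<and>
     (\<forall>j\<in>J. AE \<omega> in M. continuous_on {0..} (\<lambda>t. W j t \<omega>))"

(* One noise component per node and coordinate. *)

definition noise_at ::
    "((int ^ 'd) \<times> 'd \<Rightarrow> real \<Rightarrow> 'w \<Rightarrow> real) \<Rightarrow> real \<Rightarrow> 'w \<Rightarrow> int ^ 'd \<Rightarrow> real ^ 'd" where
  "noise_at w t \<omega> k = (\<chi> i. w (k, i) t \<omega>)"

definition state_process ::
    "'w measure \<Rightarrow> nat \<Rightarrow> (real \<Rightarrow> 'w \<Rightarrow> int ^ 'd \<Rightarrow> real ^ 'd) \<Rightarrow> bool" where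
  "state_process M L x \<longleftrightarrow>
     (\<forall>k\<in>torus L.
        (\<forall>t\<ge>0. (\<lambda>\<omega>. x t \<omega> k) \<in> borel_measurable M) \<and>
        integrable M (\<lambda>\<omega>. (norm (x 0 \<omega> k))\<^sup>2) \<and>
        (AE \<omega> in M. continuous_on {0..} (\<lambda>t. x t \<omega> k)))"

(* As the noise is additive, the stochastic differential equations are understood pathwise,
   in integrated form. *)

definition integral_network ::
    "'w measure \<Rightarrow> nat \<Rightarrow> (int ^ 'd \<Rightarrow> real) \<Rightarrow> (int ^ 'd \<Rightarrow> real) \<Rightarrow>
     (int ^ 'd \<Rightarrow> real) \<Rightarrow> real \<Rightarrow> real \<Rightarrow>
     ((int ^ 'd) \<times> 'd \<Rightarrow> real \<Rightarrow> 'w \<Rightarrow> real) \<Rightarrow> ((int ^ 'd) \<times> 'd \<Rightarrow> real \<Rightarrow> 'w \<Rightarrow> real) \<Rightarrow>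
     (real \<Rightarrow> 'w \<Rightarrow> int ^ 'd \<Rightarrow> real ^ 'd) \<Rightarrow> (real \<Rightarrow> 'w \<Rightarrow> int ^ 'd \<Rightarrow> real ^ 'd) \<Rightarrow>
     (real \<Rightarrow> 'w \<Rightarrow> int ^ 'd \<Rightarrow> real ^ 'd) \<Rightarrow> bool" where
  "integral_network M L f g a c \<epsilon> w \<eta> z x v \<longleftrightarrow>
     uncorrelated_white_noise M ((torus L \<times> UNIV) <+> (torus L \<times> UNIV)) (case_sum w \<eta>) \<and>
     state_process M L z \<and> state_process M L x \<and> state_process M L v \<and>
     (AE \<omega> in M. \<forall>k\<in>torus L. \<forall>t\<ge>0.
        z t \<omega> k = z 0 \<omega> k
          + integral {0..t} (\<lambda>s. conv L a (z s \<omega>) k - c *\<^sub>R v s \<omega> k)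
          - (c * \<epsilon>) *\<^sub>R noise_at \<eta> t \<omega> k \<and>
        x t \<omega> k = x 0 \<omega> k + integral {0..t} (\<lambda>s. v s \<omega> k) \<and>
        v t \<omega> k = v 0 \<omega> k
          + integral {0..t} (\<lambda>s. z s \<omega> k + conv L (wrap L f) (x s \<omega>) k
                                  + conv L (wrap L g) (v s \<omega>) k)
          + noise_at w t \<omega> k)"

definition static_network ::
    "'w measure \<Rightarrow> nat \<Rightarrow> (int ^ 'd \<Rightarrow> real) \<Rightarrow> (int ^ 'd \<Rightarrow> real) \<Rightarrow>
     ((int ^ 'd) \<times> 'd \<Rightarrow> real \<Rightarrow> 'w \<Rightarrow> real) \<Rightarrow>
     (real \<Rightarrow> 'w \<Rightarrow> int ^ 'd \<Rightarrow> real ^ 'd) \<Rightarrow> (real \<Rightarrow> 'w \<Rightarrow> int ^ 'd \<Rightarrow> real ^ 'd) \<Rightarrow> bool" where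
  "static_network M L f g w x v \<longleftrightarrow>
     uncorrelated_white_noise M (torus L \<times> UNIV) w \<and>
     state_process M L x \<and> state_process M L v \<and>
     (AE \<omega> in M. \<forall>k\<in>torus L. \<forall>t\<ge>0.
        x t \<omega> k = x 0 \<omega> k + integral {0..t} (\<lambda>s. v s \<omega> k) \<and>
        v t \<omega> k = v 0 \<omega> k
          + integral {0..t} (\<lambda>s. conv L (wrap L f) (x s \<omega>) k + conv L (wrap L g) (v s \<omega>) k)
          + noise_at w t \<omega> k)"

definition global_error :: "nat \<Rightarrow> (int ^ 'd \<Rightarrow> real ^ 'd) \<Rightarrow> int ^ 'd \<Rightarrow> real ^ 'd" where
  "global_error L x k = x k - (1 / real (L ^ CARD('d))) *\<^sub>R (\<Sum>l\<in>torus L. x l)"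

(* The deviations from the preceding nearest neighbours in all d lattice directions are
   stacked, so that the symbol is the sum of 2 (1 - cos theta_j) over j, of order |theta|^2. *)

definition local_error :: "nat \<Rightarrow> (int ^ 'd \<Rightarrow> real ^ 'd) \<Rightarrow> int ^ 'd \<Rightarrow> real ^ 'd ^ 'd" where
  "local_error L x k = (\<chi> j. x k - x (tmod L (k - axis j 1)))"

definition per_site_variance ::
    "'w measure \<Rightarrow> nat \<Rightarrow> ((int ^ 'd \<Rightarrow> real ^ 'd) \<Rightarrow> int ^ 'd \<Rightarrow> 'y::real_inner) \<Rightarrow>
     (real \<Rightarrow> 'w \<Rightarrow> int ^ 'd \<Rightarrow> real ^ 'd) \<Rightarrow> real \<Rightarrow> bool" where
  "per_site_variance M L y x V \<longleftrightarrow>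
     (\<forall>k\<in>torus L.
        (\<forall>t\<ge>0. integrable M (\<lambda>\<omega>. y (x t \<omega>) k \<bullet> y (x t \<omega>) k)) \<and>
        ((\<lambda>t. \<integral>\<omega>. y (x t \<omega>) k \<bullet> y (x t \<omega>) k \<partial>M) \<longlongrightarrow> V) at_top)"

(* V is the per-site variance of the system, whatever the probability space (on the sample
   type 'w), the white noise driving the network and the initial state. *)

definition integral_variance ::
    "'w itself \<Rightarrow> ((int ^ 'd \<Rightarrow> real ^ 'd) \<Rightarrow> int ^ 'd \<Rightarrow> 'y::real_inner) \<Rightarrow> nat \<Rightarrow>
     (int ^ 'd \<Rightarrow> real) \<Rightarrow> (int ^ 'd \<Rightarrow> real) \<Rightarrow> (int ^ 'd \<Rightarrow> real) \<Rightarrow> real \<Rightarrow> real \<Rightarrow> real \<Rightarrow> bool" where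
  "integral_variance T y L f g a c \<epsilon> V \<longleftrightarrow>
     (\<forall>(M :: 'w measure) w \<eta> z x v.
        integral_network M L f g a c \<epsilon> w \<eta> z x v \<longrightarrow> per_site_variance M L y x V)"

definition static_variance ::
    "'w itself \<Rightarrow> ((int ^ 'd \<Rightarrow> real ^ 'd) \<Rightarrow> int ^ 'd \<Rightarrow> 'y::real_inner) \<Rightarrow> nat \<Rightarrow>
     (int ^ 'd \<Rightarrow> real) \<Rightarrow> (int ^ 'd \<Rightarrow> real) \<Rightarrow> real \<Rightarrow> bool" where
  "static_variance T y L f g V \<longleftrightarrow>
     (\<forall>(M :: 'w measure) w x v.
        static_network M L f g w x v \<longrightarrow> per_site_variance M L y x V)"

definition local_rate :: "real \<Rightarrow> nat \<Rightarrow> nat \<Rightarrow> real" where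
  "local_rate \<beta> d N = 1 / \<beta>"

definition global_rate :: "real \<Rightarrow> nat \<Rightarrow> nat \<Rightarrow> real" where
  "global_rate \<beta> d N = 1 / \<beta> * (if d = 1 then real N else if d = 2 then ln (real N) else 1)"

(* The sequences u are indexed by L, the rates r by the network size N = L ^ d. *)

definition scales_at_least :: "nat \<Rightarrow> (nat \<Rightarrow> real) \<Rightarrow> (nat \<Rightarrow> real) \<Rightarrow> bool" where
  "scales_at_least d u r \<longleftrightarrow>
     (\<exists>lo>0. \<exists>N\<^sub>0. \<forall>L>0. N\<^sub>0 \<le> L ^ d \<longrightarrow> lo * r (L ^ d) \<le> u L)"

definition scales_as :: "nat \<Rightarrow> (nat \<Rightarrow> real) \<Rightarrow> (nat \<Rightarrow> real) \<Rightarrow> bool" where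
  "scales_as d u r \<longleftrightarrow>
     (\<exists>lo>0. \<exists>hi>0. \<exists>N\<^sub>0. \<forall>L>0. N\<^sub>0 \<le> L ^ d \<longrightarrow>
        lo * r (L ^ d) \<le> u L \<and> u L \<le> hi * r (L ^ d))"

end

theory Submission
  imports Defs "HOL-Complex_Analysis.Cauchy_Integral_Theorem"
    "HOL-Computational_Algebra.Fundamental_Theorem_Algebra" "HOL-Real_Asymp.Real_Asymp"
begin

text \<open>Everything is diagonal in the Fourier modes of the torus. The mode \<open>n\<close> obeys a linear system with
  three states, in which \<open>\<alpha>\<close>, \<open>\<phi>\<close> and \<open>\<gamma>\<close>, the negated symbols of \<open>A\<close>, \<open>F\<close> and \<open>G\<close> at
  the frequency \<open>\<theta> = 2 \<pi> n / L\<close>, are positive, so that its characteristic polynomial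
  \<open>s\<^sup>3 + (\<alpha> + \<gamma>) s\<^sup>2 + (\<alpha> \<gamma> + \<phi> + c) s + \<alpha> \<phi>\<close> is Hurwitz. The stationary variance of its position is
  \<open>V = (\<alpha> \<phi> + (\<alpha>\<^sup>2 + c\<^sup>2 \<epsilon>\<^sup>2) (\<alpha> + \<gamma>)) / (2 \<alpha> \<phi> ((\<alpha> + \<gamma>) (\<alpha> \<gamma> + c) + \<gamma> \<phi>))\<close>.
  Two inequalities about this formula decide the question. Apart from the factor \<open>\<phi>\<close>, the terms of the
  denominator are bounded by multiples of those of the numerator, the mixed term \<open>\<alpha> c\<close> because
  \<open>2 \<alpha> c \<epsilon> \<le> \<alpha>\<^sup>2 + c\<^sup>2 \<epsilon>\<^sup>2\<close>; as \<open>\<gamma>\<close> is bounded, \<open>V \<ge> const / \<phi>\<close> for all \<open>\<alpha>\<close> and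
  \<open>c\<close> whatsoever (\<open>mode_variance_lower\<close>). Conversely \<open>V \<le> const / \<phi>\<close> for \<open>\<alpha> = c = 1\<close>
  (\<open>mode_variance_upper\<close>), and \<open>\<alpha> = 1\<close> in all modes is realised by the all-to-all array with entries
  \<open>1 / N\<close> off the origin. Static feedback is the case \<open>c = 0\<close>, \<open>z = 0\<close>, where \<open>V = 1 / (2 \<phi> \<gamma>)\<close>.

  Since \<open>\<phi>\<close> is of order \<open>|\<theta>|\<^sup>2\<close>, the per-site variance is, up to constants, the average over the
  nonzero modes of \<open>1 / |\<theta>|\<^sup>2\<close> for the global error, and of a constant for the local error, whose output
  contributes a factor of order \<open>|\<theta>|\<^sup>2\<close>. The first average is an inverse-square lattice sum, which
  grows like \<open>N\<close>, \<open>log N\<close> and \<open>1\<close> (\<open>lattice_sum_lower\<close>, \<open>lattice_sum_upper\<close>).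

  The passage from the pathwise stochastic equations to \<open>V\<close> goes through the adjoint system: summation by
  parts writes the position of a mode at time \<open>T\<close> as a decaying function of the initial state plus the limit
  of Riemann sums of the adjoint solution against the noise increments (\<open>mode_path_representation\<close>). Only
  the covariance of the noise is known, so the second moment of this limit is computed through the isometry for
  step functions and Fatou's lemma (\<open>wiener_isometry\<close>). As the initial part tends to zero in mean square, an
  initial state correlated with the noise does no harm (\<open>second_moment_limit\<close>). All modes are kept
  real by using the Hartley basis \<open>cos + sin\<close> in place of complex exponentials.\<close>

section \<open>The impulse response of one mode\<close>

text \<open>Variation of constants. Asking for an entire solution makes the result a legitimate forcing term
  for the next equation of a cascade, and entire functions have primitives on the whole plane.\<close>

lemma entire_linear_ode:
  fixes r y0 :: complex
  assumes "u holomorphic_on UNIV"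
  obtains y where "y 0 = y0" "\<And>z. (y has_field_derivative (r * y z + u z)) (at z)"
proof -
  have "(\<lambda>z. exp (- r * z) * u z) holomorphic_on UNIV"
    using assms by (intro holomorphic_intros)
  then have "\<And>z. (\<lambda>z. exp (- r * z) * u z) field_differentiable at z"
    by (simp add: holomorphic_on_def)
  moreover from this have "continuous_on UNIV (\<lambda>z. exp (- r * z) * u z)"
    using field_differentiable_imp_continuous_at continuous_at_imp_continuous_on by blast
  ultimately obtain U where U: "\<And>z. (U has_field_derivative exp (- r * z) * u z) (at z)"
    using holomorphic_convex_primitive[of UNIV "{}" "\<lambda>z. exp (- r * z) * u z"] by auto
  define y where "y = (\<lambda>z. exp (r * z) * (U z - U 0 + y0))"
  have "(y has_field_derivative (r * y z + u z)) (at z)" for z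
  proof -
    have e: "exp (r * z) * exp (- r * z) = 1"
      by (simp flip: exp_add)
    have "(y has_field_derivative (exp (r * z) * r) * (U z - U 0 + y0)
        + exp (r * z) * (exp (- r * z) * u z)) (at z)"
      unfolding y_def by (auto intro!: derivative_eq_intros U)
    also have "exp (r * z) * (exp (- r * z) * u z) = u z"
      using e by (simp flip: mult.assoc)
    finally show ?thesis by (simp add: y_def mult_ac)
  qed
  moreover have "y 0 = y0" by (simp add: y_def)
  ultimately show ?thesis using that by blast
qed

text \<open>A first-order filter that decays faster than its input passes on the rate of the input: the
  derivative of \<open>exp (- r t) * y t\<close> is \<open>exp (- r t) * u t\<close>, whose norm is at most a growing exponential
  that can be integrated.\<close>

lemma decay_through_linear_ode:
  fixes r :: complex and y u :: "real \<Rightarrow> complex"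
  assumes y: "\<And>t. t \<ge> 0 \<Longrightarrow> (y has_vector_derivative (r * y t + u t)) (at t)"
    and u: "\<And>t. t \<ge> 0 \<Longrightarrow> norm (u t) \<le> C * exp (- \<delta> * t)"
    and r: "Re r < - \<delta>"
  obtains C' where "C' \<ge> 0" "\<And>t. t \<ge> 0 \<Longrightarrow> norm (y t) \<le> C' * exp (- \<delta> * t)"
proof -
  define \<rho> where "\<rho> = - Re r - \<delta>"
  have \<rho>: "\<rho> > 0" using r by (simp add: \<rho>_def)
  have C: "C \<ge> 0" using order_trans[OF norm_ge_zero u[of 0]] by simp
  define Y where "Y = (\<lambda>t. exp (- r * of_real t) * y t)"
  have nexp: "norm (exp (- r * of_real t)) = exp (- Re r * t)" for t
    by simp
  have growth: "norm (Y t - Y 0) \<le> C / \<rho> * exp (\<rho> * t) - C / \<rho> * exp (\<rho> * 0)" if "t > 0" for t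
  proof (rule differentiable_bound_general[OF that])
    have D: "(Y has_vector_derivative exp (- r * of_real s) * u s) (at s)" if "s \<ge> 0" for s
    proof -
      have "((\<lambda>t. exp (- r * of_real t)) has_vector_derivative - r * exp (- r * of_real s)) (at s)"
        by (rule has_vector_derivative_real_field[of "\<lambda>z. exp (- r * z)"])
           (auto intro!: derivative_eq_intros)
      from has_vector_derivative_mult[OF this y[OF that]]
      show ?thesis unfolding Y_def by (simp add: algebra_simps)
    qed
    show "continuous_on {0..t} Y"
      using D by (meson atLeastAtMost_iff continuous_at_imp_continuous_on has_vector_derivative_continuous)
    show "continuous_on {0..t} (\<lambda>t. C / \<rho> * exp (\<rho> * t))"
      by (intro continuous_intros)
    show "(Y has_vector_derivative exp (- r * of_real s) * u s) (at s)" if "0 < s" for s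
      using D[of s] that by simp
    show "((\<lambda>t. C / \<rho> * exp (\<rho> * t)) has_vector_derivative C * exp (\<rho> * s)) (at s)" for s
      using \<rho> by (auto intro!: derivative_eq_intros simp flip: has_real_derivative_iff_has_vector_derivative)
    show "norm (exp (- r * of_real s) * u s) \<le> C * exp (\<rho> * s)" if "0 < s" for s
    proof -
      have "norm (exp (- r * of_real s) * u s) \<le> exp (- Re r * s) * (C * exp (- \<delta> * s))"
        unfolding norm_mult nexp using u[of s] that by (intro mult_left_mono) auto
      also have "\<dots> = C * exp (\<rho> * s)"
        by (simp add: \<rho>_def algebra_simps flip: exp_add)
      finally show ?thesis .
    qed
  qed
  then have Yb: "norm (Y t) \<le> (norm (y 0) + C / \<rho>) * exp (\<rho> * t)" if "t \<ge> 0" for t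
  proof (cases "t = 0")
    case True
    then show ?thesis using C \<rho> by (simp add: Y_def)
  next
    case False
    with that have t: "t > 0" by simp
    have "norm (Y t) \<le> norm (Y t - Y 0) + norm (Y 0)"
      by norm
    also have "\<dots> \<le> C / \<rho> * exp (\<rho> * t) + norm (y 0) * 1"
    proof -
      have "norm (Y 0) = norm (y 0)" "C / \<rho> * exp (\<rho> * 0) \<ge> 0"
        using C \<rho> by (simp_all add: Y_def)
      with growth[OF t] show ?thesis by linarith
    qed
    also have "\<dots> \<le> C / \<rho> * exp (\<rho> * t) + norm (y 0) * exp (\<rho> * t)"
      using t \<rho> by (intro add_left_mono mult_left_mono) auto
    finally show ?thesis by (simp add: algebra_simps)
  qed
  show ?thesis
  proof (rule that[of "norm (y 0) + C / \<rho>"])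
    show "0 \<le> norm (y 0) + C / \<rho>" using C \<rho> by simp
    fix t :: real assume "t \<ge> 0"
    have "y t = exp (r * of_real t) * Y t"
      by (simp add: Y_def flip: mult.assoc exp_add)
    then have "norm (y t) = exp (Re r * t) * norm (Y t)"
      by (simp add: norm_mult)
    also have "\<dots> \<le> exp (Re r * t) * ((norm (y 0) + C / \<rho>) * exp (\<rho> * t))"
      by (intro mult_left_mono Yb \<open>t \<ge> 0\<close>) auto
    also have "\<dots> = (norm (y 0) + C / \<rho>) * exp (- \<delta> * t)"
      by (simp add: \<rho>_def algebra_simps flip: exp_add)
    finally show "norm (y t) \<le> (norm (y 0) + C / \<rho>) * exp (- \<delta> * t)" .
  qed
qed

text \<open>Suppose a root has real part \<open>x \<ge> 0\<close>. It cannot be real, all coefficients being nonnegative and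
  the last one positive. Otherwise the imaginary part of the equation gives the square of the imaginary part of
  the root, and inserting it into the real part makes a sum of nonnegative terms and \<open>a1 * a2 - a0 > 0\<close>
  vanish.\<close>

lemma routh_hurwitz_cubic:
  fixes a0 a1 a2 :: real and r :: complex
  assumes "a0 > 0" "a1 \<ge> 0" "a2 \<ge> 0" "a0 < a1 * a2"
    and root: "r ^ 3 + of_real a2 * r ^ 2 + of_real a1 * r + of_real a0 = 0"
  shows "Re r < 0"
proof (rule ccontr)
  assume "\<not> Re r < 0"
  define x y where "x = Re r" and "y = Im r"
  have x: "x \<ge> 0" using \<open>\<not> Re r < 0\<close> by (simp add: x_def)
  have r: "r = Complex x y" by (simp add: x_def y_def)
  from root have "Re (r ^ 3 + of_real a2 * r ^ 2 + of_real a1 * r + of_real a0) = 0"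
    and "Im (r ^ 3 + of_real a2 * r ^ 2 + of_real a1 * r + of_real a0) = 0" by simp_all
  then have re: "x^3 - 3 * x * y^2 + a2 * (x^2 - y^2) + a1 * x + a0 = 0"
    and im: "y * (3 * x^2 - y^2 + 2 * a2 * x + a1) = 0"
    unfolding r by (simp_all add: power2_eq_square power3_eq_cube algebra_simps)
  show False
  proof (cases "y = 0")
    case True
    with re have "x^3 + a2 * x^2 + a1 * x + a0 = 0" by simp
    moreover have "x^3 \<ge> 0" "a2 * x^2 \<ge> 0" "a1 * x \<ge> 0" using x assms by auto
    ultimately show False using assms by linarith
  next
    case False
    with im have y2: "y^2 = 3 * x^2 + 2 * a2 * x + a1" by simp
    have "8 * x^3 + 8 * a2 * x^2 + 2 * a1 * x + 2 * a2^2 * x + (a1 * a2 - a0) = 0"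
      using re unfolding y2 by (simp add: power2_eq_square power3_eq_cube algebra_simps)
    moreover have "x^3 \<ge> 0" "a2 * x^2 \<ge> 0" "a1 * x \<ge> 0" "a2^2 * x \<ge> 0" using x assms by auto
    ultimately show False using assms by linarith
  qed
qed

lemma complex_cubic_factors:
  fixes a0 a1 a2 :: complex
  obtains r1 r2 r3 where "a2 = - (r1 + r2 + r3)" "a1 = r1 * r2 + r1 * r3 + r2 * r3"
    "a0 = - (r1 * r2 * r3)"
proof -
  have "\<exists>r. r ^ 3 + a2 * r ^ 2 + a1 * r + a0 = 0"
  proof -
    have "\<exists>r. poly [:a0, a1, a2, 1:] r = 0"
      by (intro alg_closed_imp_poly_has_root) simp
    then show ?thesis
      by (auto simp: algebra_simps power2_eq_square power3_eq_cube)
  qed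
  then obtain r1 where r1: "r1 ^ 3 + a2 * r1 ^ 2 + a1 * r1 + a0 = 0" ..
  define b where "b = a2 + r1"
  define d where "d = a1 + r1 * b"
  define s where "s = csqrt (b^2 - 4 * d)"
  have s: "s^2 = b^2 - 4 * d" by (simp add: s_def)
  define r2 r3 where "r2 = (- b + s) / 2" and "r3 = (- b - s) / 2"
  have sum: "r2 + r3 = - b" by (simp add: r2_def r3_def field_simps)
  have prod: "r2 * r3 = d"
  proof -
    have "r2 * r3 = (b^2 - s^2) / 4" by (simp add: r2_def r3_def power2_eq_square field_simps)
    then show ?thesis by (simp add: s)
  qed
  show ?thesis
  proof (rule that[of r1 r2 r3])
    show "a2 = - (r1 + r2 + r3)" using sum by (simp add: b_def algebra_simps)
    have "r1 * r2 + r1 * r3 = - r1 * b" using sum by (metis distrib_left minus_mult_commute)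
    then show "a1 = r1 * r2 + r1 * r3 + r2 * r3" using prod by (simp add: d_def)
    have "r1 * r2 * r3 = r1 * d" using prod by (simp add: mult.assoc)
    then show "a0 = - (r1 * r2 * r3)" using r1
      by (simp add: d_def b_def algebra_simps power2_eq_square power3_eq_cube eq_neg_iff_add_eq_0)
  qed
qed

text \<open>\<open>h\<close> is the impulse response of the filter with characteristic polynomial
  \<open>s\<^sup>3 + a2 s\<^sup>2 + a1 s + a0\<close>. It is obtained as a cascade of three first-order filters, one for
  each complex root; unlike a sum of exponentials, this form covers multiple roots as well. The coefficients
  being real, the real part of the cascade solves the same equation.\<close>

lemma stable_cubic_impulse_response:
  fixes a0 a1 a2 :: real
  assumes "a0 > 0" "a1 \<ge> 0" "a2 \<ge> 0" "a0 < a1 * a2"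
  obtains h h1 h2 :: "real \<Rightarrow> real"
  where "h 0 = 0" "h1 0 = 0" "h2 0 = 1"
    "\<And>t. (h has_real_derivative h1 t) (at t)"
    "\<And>t. (h1 has_real_derivative h2 t) (at t)"
    "\<And>t. (h2 has_real_derivative - (a2 * h2 t + a1 * h1 t + a0 * h t)) (at t)"
    "(h \<longlongrightarrow> 0) at_top" "(h1 \<longlongrightarrow> 0) at_top" "(h2 \<longlongrightarrow> 0) at_top"
proof -
  obtain r1 r2 r3 :: complex where
    c2: "of_real a2 = - (r1 + r2 + r3)" and
    c1: "of_real a1 = r1 * r2 + r1 * r3 + r2 * r3" and
    c0: "of_real a0 = - (r1 * r2 * r3)"
    by (rule complex_cubic_factors)
  have root: "Re r < 0" if "r \<in> {r1, r2, r3}" for r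
  proof (rule routh_hurwitz_cubic[OF assms])
    have "r ^ 3 + of_real a2 * r ^ 2 + of_real a1 * r + of_real a0 = (r - r1) * (r - r2) * (r - r3)"
      unfolding c2 c1 c0 by (simp add: algebra_simps power2_eq_square power3_eq_cube)
    then show "r ^ 3 + of_real a2 * r ^ 2 + of_real a1 * r + of_real a0 = 0"
      using that by auto
  qed
  define \<delta> where "\<delta> = Min {- Re r1, - Re r2, - Re r3} / 2"
  have \<delta>: "\<delta> > 0" "Re r1 < - \<delta>" "Re r2 < - \<delta>" "Re r3 < - \<delta>"
    using root[of r1] root[of r2] root[of r3] by (auto simp: \<delta>_def min_def)
  obtain y1 where y1: "y1 0 = 1" "\<And>z. (y1 has_field_derivative (r1 * y1 z + 0)) (at z)"
    by (rule entire_linear_ode[of "\<lambda>_. 0" 1 r1]) auto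
  then have "y1 holomorphic_on UNIV"
    by (auto simp: holomorphic_on_def field_differentiable_def)
  then obtain y2 where y2: "y2 0 = 0" "\<And>z. (y2 has_field_derivative (r2 * y2 z + y1 z)) (at z)"
    by (rule entire_linear_ode[of y1 0 r2]) auto
  then have "y2 holomorphic_on UNIV"
    by (auto simp: holomorphic_on_def field_differentiable_def)
  then obtain y3 where y3: "y3 0 = 0" "\<And>z. (y3 has_field_derivative (r3 * y3 z + y2 z)) (at z)"
    by (rule entire_linear_ode[of y2 0 r3]) auto
  note V = has_vector_derivative_real_field
  obtain C1 where C1: "C1 \<ge> 0" "\<And>t. t \<ge> 0 \<Longrightarrow> norm (y1 (of_real t)) \<le> C1 * exp (- \<delta> * t)"
    using decay_through_linear_ode[where y = "\<lambda>t. y1 (of_real t)" and u = "\<lambda>_. 0" and C = 0,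
        OF V[OF y1(2)] _ \<delta>(2)] by auto
  obtain C2 where C2: "C2 \<ge> 0" "\<And>t. t \<ge> 0 \<Longrightarrow> norm (y2 (of_real t)) \<le> C2 * exp (- \<delta> * t)"
    using decay_through_linear_ode[where y = "\<lambda>t. y2 (of_real t)",
        OF V[OF y2(2)] C1(2) \<delta>(3)] by auto
  obtain C3 where C3: "C3 \<ge> 0" "\<And>t. t \<ge> 0 \<Longrightarrow> norm (y3 (of_real t)) \<le> C3 * exp (- \<delta> * t)"
    using decay_through_linear_ode[where y = "\<lambda>t. y3 (of_real t)",
        OF V[OF y3(2)] C2(2) \<delta>(4)] by auto
  have E0: "((\<lambda>t. C * exp (- \<delta> * t)) \<longlongrightarrow> 0) at_top" for C
    using \<delta>(1) by real_asymp
  have lim: "((\<lambda>t. y (of_real t)) \<longlongrightarrow> 0) at_top"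
    if "\<And>t. t \<ge> 0 \<Longrightarrow> norm (y (complex_of_real t)) \<le> C * exp (- \<delta> * t)" for y C
    by (rule Lim_null_comparison[OF _ E0[of C]])
       (use that in \<open>auto intro: eventually_mono[OF eventually_ge_at_top[of 0]]\<close>)
  note lims = lim[OF C1(2)] lim[OF C2(2)] lim[OF C3(2)]
  define z1 where "z1 = (\<lambda>t. r3 * y3 t + y2 t)"
  define z2 where "z2 = (\<lambda>t. r3 * z1 t + r2 * y2 t + y1 t)"
  have d1: "(y3 has_field_derivative z1 t) (at t)" for t
    using y3(2)[of t] by (simp add: z1_def)
  have d2: "(z1 has_field_derivative z2 t) (at t)" for t
    unfolding z2_def using d1 y2(2) 
    by (subst z1_def) (auto intro!: derivative_eq_intros d1 y2(2))
  have d3: "(z2 has_field_derivative - (of_real a2 * z2 t + of_real a1 * z1 t + of_real a0 * y3 t)) (at t)" for t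
  proof -
    have "(z2 has_field_derivative (r3 * z2 t + r2 * (r2 * y2 t + y1 t) + r1 * y1 t)) (at t)"
      using y1(2) by (subst z2_def) (auto intro!: derivative_eq_intros d2 y2(2))
    moreover have "r3 * z2 t + r2 * (r2 * y2 t + y1 t) + r1 * y1 t
        = - (of_real a2 * z2 t + of_real a1 * z1 t + of_real a0 * y3 t)"
      unfolding c2 c1 c0 z2_def z1_def by (simp add: algebra_simps)
    ultimately show ?thesis by simp
  qed
  have Re_deriv: "((\<lambda>t. Re (y (of_real t))) has_real_derivative Re (y' (complex_of_real t))) (at t)"
    if "\<And>z. (y has_field_derivative y' z) (at z)" for y y' t
    using bounded_linear.has_vector_derivative[OF bounded_linear_Re V[OF that]]
    by (simp add: has_real_derivative_iff_has_vector_derivative)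
  show ?thesis
  proof (rule that[of "\<lambda>t. Re (y3 (of_real t))" "\<lambda>t. Re (z1 (of_real t))" "\<lambda>t. Re (z2 (of_real t))"])
    show "Re (y3 (of_real 0)) = 0" "Re (z1 (of_real 0)) = 0" "Re (z2 (of_real 0)) = 1"
      by (simp_all add: z1_def z2_def y1 y2 y3)
    show "((\<lambda>t. Re (y3 (of_real t))) has_real_derivative Re (z1 (of_real t))) (at t)" for t
      by (rule Re_deriv[OF d1])
    show "((\<lambda>t. Re (z1 (of_real t))) has_real_derivative Re (z2 (of_real t))) (at t)" for t
      by (rule Re_deriv[OF d2])
    show "((\<lambda>t. Re (z2 (of_real t))) has_real_derivative
        - (a2 * Re (z2 (of_real t)) + a1 * Re (z1 (of_real t)) + a0 * Re (y3 (of_real t)))) (at t)" for t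
      using Re_deriv[OF d3, of t] by simp
    have l1: "((\<lambda>t. z1 (of_real t)) \<longlongrightarrow> 0) at_top"
      unfolding z1_def using lims by (auto intro!: tendsto_eq_intros)
    moreover have "((\<lambda>t. z2 (of_real t)) \<longlongrightarrow> 0) at_top"
      unfolding z2_def using lims l1 by (auto intro!: tendsto_eq_intros)
    ultimately show "((\<lambda>t. Re (y3 (of_real t))) \<longlongrightarrow> 0) at_top"
      "((\<lambda>t. Re (z1 (of_real t))) \<longlongrightarrow> 0) at_top" "((\<lambda>t. Re (z2 (of_real t))) \<longlongrightarrow> 0) at_top"
      using lims tendsto_Re by force+
  qed
qed

text \<open>The squared \<open>H\<^sub>2\<close> norm of one mode: \<open>\<alpha>\<close>, \<open>\<phi>\<close> and \<open>\<gamma>\<close> stand for the negated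
  symbols of \<open>A\<close>, \<open>F\<close> and \<open>G\<close>, and \<open>\<kappa> = c * \<epsilon>\<close> is the intensity of the noise that enters
  the integral state.\<close>

definition mode_variance :: "real \<Rightarrow> real \<Rightarrow> real \<Rightarrow> real \<Rightarrow> real \<Rightarrow> real" where
  "mode_variance \<alpha> c \<kappa> \<phi> \<gamma> =
     (\<alpha> * \<phi> + (\<alpha>\<^sup>2 + \<kappa>\<^sup>2) * (\<alpha> + \<gamma>)) / (2 * \<alpha> * \<phi> * ((\<alpha> + \<gamma>) * (\<alpha> * \<gamma> + c) + \<gamma> * \<phi>))"

text \<open>\<open>(\<xi>z, \<xi>x, \<xi>v)\<close> is the solution of the adjoint system that starts at the functional reading off the
  position; at time \<open>t\<close> it is the response of the position to unit impulses in the three states a time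
  \<open>t\<close> earlier. \<open>G\<close> accumulates the energy of the response to the two noises, with limit \<open>V\<close>.\<close>

definition mode_kernel :: "real \<Rightarrow> real \<Rightarrow> real \<Rightarrow> real \<Rightarrow> real \<Rightarrow> real \<Rightarrow>
    (real \<Rightarrow> real) \<Rightarrow> (real \<Rightarrow> real) \<Rightarrow> (real \<Rightarrow> real) \<Rightarrow> (real \<Rightarrow> real) \<Rightarrow> bool" where
  "mode_kernel \<alpha> c \<kappa> \<phi> \<gamma> V \<xi>z \<xi>x \<xi>v G \<longleftrightarrow>
     \<xi>z 0 = 0 \<and> \<xi>x 0 = 1 \<and> \<xi>v 0 = 0 \<and> G 0 = 0 \<and>
     (\<forall>t. (\<xi>z has_real_derivative (- \<alpha> * \<xi>z t + \<xi>v t)) (at t)) \<and>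
     (\<forall>t. (\<xi>x has_real_derivative (- \<phi> * \<xi>v t)) (at t)) \<and>
     (\<forall>t. (\<xi>v has_real_derivative (- c * \<xi>z t + \<xi>x t - \<gamma> * \<xi>v t)) (at t)) \<and>
     (\<forall>t. (G has_real_derivative ((\<xi>v t)\<^sup>2 + (\<kappa> * \<xi>z t)\<^sup>2)) (at t)) \<and>
     (\<xi>z \<longlongrightarrow> 0) at_top \<and> (\<xi>x \<longlongrightarrow> 0) at_top \<and> (\<xi>v \<longlongrightarrow> 0) at_top \<and> (G \<longlongrightarrow> V) at_top"

text \<open>Here \<open>\<xi>z = h\<close> is the impulse response, and the other components follow from the adjoint
  equations. The energy has a closed form: multiplying the equation of \<open>h\<close> by \<open>h\<close>, \<open>h'\<close> and
  \<open>h''\<close> shows that three quadratic forms in \<open>(h, h', h'')\<close> have derivatives that are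
  combinations of \<open>h\<^sup>2\<close>, \<open>h'\<^sup>2\<close> and \<open>h''\<^sup>2\<close>. Eliminating \<open>h''\<^sup>2\<close> between the last
  two gives \<open>Q1\<close>, and the first then gives \<open>Q0\<close>.\<close>

lemma mode_kernel_exists:
  assumes "\<alpha> > 0" "c \<ge> 0" "\<phi> > 0" "\<gamma> > 0"
  shows "\<exists>\<xi>z \<xi>x \<xi>v G. mode_kernel \<alpha> c \<kappa> \<phi> \<gamma> (mode_variance \<alpha> c \<kappa> \<phi> \<gamma>) \<xi>z \<xi>x \<xi>v G"
proof -
  define a0 a1 a2 where "a0 = \<alpha> * \<phi>" and "a1 = \<alpha> * \<gamma> + \<phi> + c" and "a2 = \<alpha> + \<gamma>"
  have pos: "a0 > 0" "a1 \<ge> 0" "a2 \<ge> 0" using assms by (auto simp: a0_def a1_def a2_def)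
  define \<Delta> where "\<Delta> = a1 * a2 - a0"
  have \<Delta>: "\<Delta> = (\<alpha> + \<gamma>) * (\<alpha> * \<gamma> + c) + \<gamma> * \<phi>"
    by (simp add: \<Delta>_def a0_def a1_def a2_def algebra_simps)
  then have \<Delta>0: "\<Delta> > 0" using assms by (simp add: add_nonneg_pos)
  then have "a0 < a1 * a2" by (simp add: \<Delta>_def)
  obtain h h1 h2 where init: "h 0 = 0" "h1 0 = 0" "h2 0 = 1"
    and D: "\<And>t. (h has_real_derivative h1 t) (at t)"
      "\<And>t. (h1 has_real_derivative h2 t) (at t)"
      "\<And>t. (h2 has_real_derivative - (a2 * h2 t + a1 * h1 t + a0 * h t)) (at t)"
    and lim: "(h \<longlongrightarrow> 0) at_top" "(h1 \<longlongrightarrow> 0) at_top" "(h2 \<longlongrightarrow> 0) at_top"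
    by (rule stable_cubic_impulse_response[OF pos \<open>a0 < a1 * a2\<close>]) blast
  define Q1 where "Q1 = (\<lambda>t. (a2 * (h1 t * h2 t + a2 * (h1 t)\<^sup>2 / 2 + a0 * (h t)\<^sup>2 / 2)
      + ((h2 t)\<^sup>2 / 2 + a1 * (h1 t)\<^sup>2 / 2 + a0 * h t * h1 t)) / \<Delta>)"
  define Q0 where "Q0 = (\<lambda>t. (a2 * Q1 t
      + (h t * h2 t - (h1 t)\<^sup>2 / 2 + a2 * h t * h1 t + a1 * (h t)\<^sup>2 / 2)) / a0)"
  have Q1: "(Q1 has_real_derivative - (h1 t)\<^sup>2) (at t)" for t
  proof -
    have "((\<lambda>t. \<Delta> * Q1 t) has_real_derivative - (\<Delta> * (h1 t)\<^sup>2)) (at t)"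
      using \<Delta>0 unfolding Q1_def
      by (auto intro!: derivative_eq_intros D)
         (simp add: \<Delta>_def power2_eq_square algebra_simps)
    from DERIV_cmult[OF this, of "1 / \<Delta>"] show ?thesis using \<Delta>0 by simp
  qed
  have Q0: "(Q0 has_real_derivative - (h t)\<^sup>2) (at t)" for t
  proof -
    have "((\<lambda>t. a0 * Q0 t) has_real_derivative - (a0 * (h t)\<^sup>2)) (at t)"
      using pos unfolding Q0_def
      by (auto intro!: derivative_eq_intros D Q1)
         (simp add: power2_eq_square algebra_simps)
    from DERIV_cmult[OF this, of "1 / a0"] show ?thesis using pos by simp
  qed
  define G where "G = (\<lambda>t. (Q1 0 + (\<alpha>\<^sup>2 + \<kappa>\<^sup>2) * Q0 0)
      - Q1 t - (\<alpha>\<^sup>2 + \<kappa>\<^sup>2) * Q0 t + \<alpha> * (h t)\<^sup>2)"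
  have V: "mode_variance \<alpha> c \<kappa> \<phi> \<gamma> = Q1 0 + (\<alpha>\<^sup>2 + \<kappa>\<^sup>2) * Q0 0"
  proof -
    have "Q1 0 = 1 / (2 * \<Delta>)" "Q0 0 = a2 / (2 * \<Delta> * a0)"
      by (simp_all add: Q0_def Q1_def init)
    moreover have "mode_variance \<alpha> c \<kappa> \<phi> \<gamma> = (a0 + (\<alpha>\<^sup>2 + \<kappa>\<^sup>2) * a2) / (2 * a0 * \<Delta>)"
      by (simp add: mode_variance_def \<Delta> a0_def a2_def mult.assoc)
    moreover have "(a0 + (\<alpha>\<^sup>2 + \<kappa>\<^sup>2) * a2) / (2 * a0 * \<Delta>)
        = 1 / (2 * \<Delta>) + (\<alpha>\<^sup>2 + \<kappa>\<^sup>2) * (a2 / (2 * \<Delta> * a0))"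
      using pos \<Delta>0 by (simp add: add_divide_distrib)
    ultimately show ?thesis by simp
  qed
  have Ql: "(Q1 \<longlongrightarrow> 0) at_top" 
    unfolding Q1_def by (rule tendsto_eq_intros lim | (use \<Delta>0 in simp; fail))+
  have Q0l: "(Q0 \<longlongrightarrow> 0) at_top" 
    unfolding Q0_def by (rule tendsto_eq_intros lim Ql | (use pos in simp; fail))+
  have "mode_kernel \<alpha> c \<kappa> \<phi> \<gamma> (mode_variance \<alpha> c \<kappa> \<phi> \<gamma>) h
      (\<lambda>t. h2 t + (\<alpha> + \<gamma>) * h1 t + (\<alpha> * \<gamma> + c) * h t) (\<lambda>t. h1 t + \<alpha> * h t) G"
    unfolding mode_kernel_def
  proof (intro conjI allI)
    fix t
    show "(h has_real_derivative - \<alpha> * h t + (h1 t + \<alpha> * h t)) (at t)"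
      using D(1)[of t] by simp
    show "((\<lambda>t. h2 t + (\<alpha> + \<gamma>) * h1 t + (\<alpha> * \<gamma> + c) * h t) has_real_derivative
        - \<phi> * (h1 t + \<alpha> * h t)) (at t)"
      by (auto intro!: derivative_eq_intros D simp: a0_def a1_def a2_def algebra_simps)
    show "((\<lambda>t. h1 t + \<alpha> * h t) has_real_derivative
        - c * h t + (h2 t + (\<alpha> + \<gamma>) * h1 t + (\<alpha> * \<gamma> + c) * h t) - \<gamma> * (h1 t + \<alpha> * h t)) (at t)"
      by (auto intro!: derivative_eq_intros D simp: algebra_simps)
    show "(G has_real_derivative (h1 t + \<alpha> * h t)\<^sup>2 + (\<kappa> * h t)\<^sup>2) (at t)"
      unfolding G_def
      by (auto intro!: derivative_eq_intros D Q1 Q0 simp: power2_eq_square algebra_simps)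
    show "(G \<longlongrightarrow> mode_variance \<alpha> c \<kappa> \<phi> \<gamma>) at_top"
      unfolding G_def V by (rule tendsto_eq_intros lim Ql Q0l | simp)+
    show "((\<lambda>t. h2 t + (\<alpha> + \<gamma>) * h1 t + (\<alpha> * \<gamma> + c) * h t) \<longlongrightarrow> 0) at_top"
      "((\<lambda>t. h1 t + \<alpha> * h t) \<longlongrightarrow> 0) at_top"
      by (rule tendsto_eq_intros lim | simp)+
  qed (simp_all add: init lim G_def)
  then show ?thesis by blast
qed

section \<open>Riemann sums and mean-square convergence\<close>

text \<open>Riemann-Stieltjes sums against a continuously differentiable integrator differ from Riemann sums by
  a null sequence: on each cell the mean value theorem replaces the increment of \<open>F\<close> by a value of
  \<open>F'\<close>, and \<open>g a * F' b\<close> is uniformly continuous in both arguments. The tags are arbitrary because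
  summation by parts produces right and left end points at the same time.\<close>

lemma rectangle_sum_tendsto:
  fixes F F' g :: "real \<Rightarrow> real"
  assumes T: "T \<ge> 0"
    and F: "\<And>t. t \<in> {0..T} \<Longrightarrow> (F has_real_derivative F' t) (at t within {0..T})"
    and F': "continuous_on {0..T} F'" and g: "continuous_on {0..T} g"
    and \<tau>: "\<And>n k. \<tau> n k \<in> {real k * T / real n .. real (Suc k) * T / real n}"
  shows "(\<lambda>n. \<Sum>k<n. g (\<tau> n k) * (F (real (Suc k) * T / real n) - F (real k * T / real n))
             - g (real k * T / real n) * F' (real k * T / real n) * (T / real n)) \<longlonglongrightarrow> 0"
proof (rule LIMSEQ_I)
  fix r :: real assume r: "r > 0"
  define e where "e = r / (2 * (T + 1))"
  have e: "e > 0" using r T by (simp add: e_def)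
  have "continuous_on ({0..T} \<times> {0..T}) (\<lambda>p. g (fst p) * F' (snd p))"
    by (intro continuous_on_mult continuous_on_compose2[OF g] continuous_on_compose2[OF F']
        continuous_on_fst continuous_on_snd continuous_on_id) auto
  then have "uniformly_continuous_on ({0..T} \<times> {0..T}) (\<lambda>p. g (fst p) * F' (snd p))"
    by (intro compact_uniformly_continuous compact_Times compact_Icc)
  then obtain \<delta> where \<delta>: "\<delta> > 0" and uc': "\<forall>p\<in>{0..T} \<times> {0..T}. \<forall>q\<in>{0..T} \<times> {0..T}.
      dist q p < \<delta> \<longrightarrow> dist (g (fst q) * F' (snd q)) (g (fst p) * F' (snd p)) < e"
    unfolding uniformly_continuous_on_def using e by metis
  have uc: "dist (g a' * F' b') (g a * F' b) < e"
    if "a \<in> {0..T}" "b \<in> {0..T}" "a' \<in> {0..T}" "b' \<in> {0..T}" "dist (a', b') (a, b) < \<delta>"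
    for a b a' b'
    using uc'[rule_format, of "(a, b)" "(a', b')"] that by simp
  obtain n0 :: nat where n0: "2 * T / \<delta> < real n0" using reals_Archimedean2 by blast
  show "\<exists>n0. \<forall>n\<ge>n0. norm ((\<Sum>k<n. g (\<tau> n k) * (F (real (Suc k) * T / real n) - F (real k * T / real n))
             - g (real k * T / real n) * F' (real k * T / real n) * (T / real n)) - 0) < r"
  proof (intro exI[of _ "Suc n0"] allI impI)
    fix n assume n: "n \<ge> Suc n0"
    then have n_pos: "real n > 0" by simp
    have small: "2 * (T / real n) < \<delta>"
    proof -
      have "2 * T < \<delta> * real n0" using n0 \<delta> by (simp add: field_simps)
      also have "\<dots> \<le> \<delta> * real n" using n \<delta> by (intro mult_left_mono) auto
      finally show ?thesis using n_pos by (simp add: field_simps)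
    qed
    have cell_error: "\<bar>g (\<tau> n k) * (F (real (Suc k) * T / real n) - F (real k * T / real n))
             - g (real k * T / real n) * F' (real k * T / real n) * (T / real n)\<bar> \<le> e * (T / real n)"
      if k: "k < n" for k
    proof -
      let ?a = "real k * T / real n" and ?b = "real (Suc k) * T / real n"
      have len: "?b - ?a = T / real n" by (simp add: add_divide_distrib algebra_simps)
      have ab: "?a \<le> ?b" using T by (intro divide_right_mono mult_right_mono) auto
      have a0: "0 \<le> ?a" using T by simp
      have bT: "?b \<le> T"
      proof -
        have "real (Suc k) * T \<le> real n * T" using k T by (intro mult_right_mono) auto
        then show ?thesis using n_pos by (simp add: field_simps)
      qed
      have "\<exists>\<zeta>\<in>{?a..?b}. F ?b - F ?a = (?b - ?a) * F' \<zeta>"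
      proof (cases "?a = ?b")
        case True
        then show ?thesis by (intro bexI[of _ ?a]) auto
      next
        case False
        then have lt: "?a < ?b" using ab by (rule order.not_eq_order_implies_strict)
        have "\<exists>z\<in>{?a<..<?b}. F ?b - F ?a = F' z * (?b - ?a)"
        proof (rule mvt_simple[OF lt, where f' = "\<lambda>x h. F' x * h"])
          fix x assume "?a \<le> x" "x \<le> ?b"
          then have "(F has_real_derivative F' x) (at x within {?a..?b})"
            using a0 bT by (intro DERIV_subset[OF F]) auto
          then show "(F has_derivative (*) (F' x)) (at x within {?a..?b})"
            by (rule has_field_derivative_imp_has_derivative)
        qed
        then obtain z where "z \<in> {?a<..<?b}" "F ?b - F ?a = F' z * (?b - ?a)" ..
        then show ?thesis by (intro bexI[of _ z]) (auto simp only: greaterThanLessThan_iff atLeastAtMost_iff mult.commute less_imp_le)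
      qed
      then obtain \<zeta> where \<zeta>: "\<zeta> \<in> {?a..?b}" "F ?b - F ?a = T / real n * F' \<zeta>"
        unfolding len by blast
      note t = \<tau>[of n k]
      have "dist (\<tau> n k, \<zeta>) (?a, ?a) \<le> dist (\<tau> n k) ?a + dist \<zeta> ?a"
        unfolding dist_Pair_Pair by (rule sqrt_sum_squares_le_sum) auto
      also have "\<dots> \<le> 2 * (T / real n)"
        using t \<zeta>(1) len unfolding atLeastAtMost_iff dist_real_def by linarith
      also have "\<dots> < \<delta>" by (rule small)
      finally have "dist (g (\<tau> n k) * F' \<zeta>) (g ?a * F' ?a) < e"
        using t \<zeta>(1) a0 ab bT by (intro uc) auto
      then have "\<bar>g (\<tau> n k) * F' \<zeta> - g ?a * F' ?a\<bar> * (T / real n) \<le> e * (T / real n)"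
        using T n_pos by (intro mult_right_mono) (auto simp: dist_real_def)
      moreover have "\<bar>g (\<tau> n k) * (F ?b - F ?a) - g ?a * F' ?a * (T / real n)\<bar>
          = \<bar>g (\<tau> n k) * F' \<zeta> - g ?a * F' ?a\<bar> * (T / real n)"
      proof -
        have "g (\<tau> n k) * (T / real n * F' \<zeta>) - g ?a * F' ?a * (T / real n)
            = (g (\<tau> n k) * F' \<zeta> - g ?a * F' ?a) * (T / real n)"
          by (simp only: left_diff_distrib right_diff_distrib mult_ac)
        then show ?thesis unfolding \<zeta>(2) using T n_pos by (simp only: abs_mult) simp
      qed
      ultimately show ?thesis by simp
    qed
    have "norm ((\<Sum>k<n. g (\<tau> n k) * (F (real (Suc k) * T / real n) - F (real k * T / real n))
             - g (real k * T / real n) * F' (real k * T / real n) * (T / real n)) - 0)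
          \<le> (\<Sum>k<n. e * (T / real n))"
    proof -
      have "\<bar>\<Sum>k<n. f k\<bar> \<le> (\<Sum>k<n. e * (T / real n))"
        if "\<And>k. k < n \<Longrightarrow> \<bar>f k\<bar> \<le> e * (T / real n)" for f
        by (rule order_trans[OF sum_abs sum_mono]) (rule that, simp)
      from this[OF cell_error] show ?thesis unfolding diff_zero real_norm_def .
    qed
    also have "\<dots> = e * T" using n_pos by simp
    also have "\<dots> \<le> r / 2" using T r by (simp add: e_def field_simps)
    also have "\<dots> < r" using r by simp
    finally show "norm ((\<Sum>k<n. g (\<tau> n k) * (F (real (Suc k) * T / real n) - F (real k * T / real n))
             - g (real k * T / real n) * F' (real k * T / real n) * (T / real n)) - 0) < r" .
  qed
qed

definition square_integrable :: "'w measure \<Rightarrow> ('w \<Rightarrow> real) \<Rightarrow> bool" where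
  "square_integrable M X \<longleftrightarrow> X \<in> borel_measurable M \<and> integrable M (\<lambda>\<omega>. (X \<omega>)\<^sup>2)"

lemma square_integrable_mult:
  assumes "square_integrable M X" "square_integrable M Y"
  shows "integrable M (\<lambda>\<omega>. X \<omega> * Y \<omega>)"
proof (rule Bochner_Integration.integrable_bound)
  show "integrable M (\<lambda>\<omega>. (X \<omega>)\<^sup>2 + (Y \<omega>)\<^sup>2)"
    using assms by (simp add: square_integrable_def)
  have [measurable]: "X \<in> borel_measurable M" "Y \<in> borel_measurable M"
    using assms by (simp_all add: square_integrable_def)
  show "(\<lambda>\<omega>. X \<omega> * Y \<omega>) \<in> borel_measurable M" by measurable
  have "\<bar>x * y\<bar> \<le> x\<^sup>2 + y\<^sup>2" for x y :: real
    using sum_squares_bound[of "\<bar>x\<bar>" "\<bar>y\<bar>"] mult_nonneg_nonneg[of "\<bar>x\<bar>" "\<bar>y\<bar>"]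
    unfolding abs_mult power2_abs by linarith
  then show "AE \<omega> in M. norm (X \<omega> * Y \<omega>) \<le> norm ((X \<omega>)\<^sup>2 + (Y \<omega>)\<^sup>2)"
    by (simp add: abs_of_nonneg)
qed

lemma square_integrable_add:
  assumes "square_integrable M X" "square_integrable M Y"
  shows "square_integrable M (\<lambda>\<omega>. X \<omega> + Y \<omega>)"
  using assms square_integrable_mult[OF assms]
  by (auto simp: square_integrable_def power2_sum mult.assoc)

lemma square_integrable_cmult:
  assumes "square_integrable M X"
  shows "square_integrable M (\<lambda>\<omega>. c * X \<omega>)"
  using assms by (auto simp: square_integrable_def power_mult_distrib)

lemma square_integrable_diff:
  assumes "square_integrable M X" "square_integrable M Y"
  shows "square_integrable M (\<lambda>\<omega>. X \<omega> - Y \<omega>)"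
  using square_integrable_add[OF assms(1) square_integrable_cmult[OF assms(2), of "- 1"]] by simp

lemma square_integrable_sum:
  assumes "\<And>i. i \<in> I \<Longrightarrow> square_integrable M (X i)"
  shows "square_integrable M (\<lambda>\<omega>. \<Sum>i\<in>I. X i \<omega>)"
  using assms
proof (induction I rule: infinite_finite_induct)
  case (insert i I)
  then show ?case by (simp add: square_integrable_add)
qed (simp_all add: square_integrable_def)

lemma square_expansion_integral:
  assumes "finite I" "\<And>i. i \<in> I \<Longrightarrow> square_integrable M (X i)"
  shows "(\<integral>\<omega>. (\<Sum>i\<in>I. c i * X i \<omega>)\<^sup>2 \<partial>M) = (\<Sum>i\<in>I. \<Sum>j\<in>I. c i * c j * (\<integral>\<omega>. X i \<omega> * X j \<omega> \<partial>M))"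
proof -
  have "(\<integral>\<omega>. (\<Sum>i\<in>I. c i * X i \<omega>)\<^sup>2 \<partial>M) = (\<integral>\<omega>. (\<Sum>i\<in>I. \<Sum>j\<in>I. (c i * c j) * (X i \<omega> * X j \<omega>)) \<partial>M)"
    by (simp add: power2_eq_square sum_product mult_ac)
  also have "\<dots> = (\<Sum>i\<in>I. \<Sum>j\<in>I. c i * c j * (\<integral>\<omega>. X i \<omega> * X j \<omega> \<partial>M))"
    using assms by (subst Bochner_Integration.integral_sum; (intro Bochner_Integration.integrable_sum integrable_mult_right square_integrable_mult)?)
      (auto intro!: sum.cong simp: Bochner_Integration.integral_sum square_integrable_mult)
  finally show ?thesis .
qed

text \<open>Second moments are continuous for mean-square convergence. The mixed term is bounded by
  the Cauchy-Schwarz inequality, which follows from the nonnegativity of the second moment of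
  \<open>c * (X - Y) + Y\<close> as a quadratic polynomial in \<open>c\<close>.\<close>

lemma second_moment_tendsto:
  fixes X Y :: "'i \<Rightarrow> 'w \<Rightarrow> real"
  assumes X: "\<And>i. square_integrable M (X i)" and Y: "\<And>i. square_integrable M (Y i)"
    and diff: "((\<lambda>i. \<integral>\<omega>. (X i \<omega> - Y i \<omega>)\<^sup>2 \<partial>M) \<longlongrightarrow> 0) F"
    and q: "((\<lambda>i. \<integral>\<omega>. (Y i \<omega>)\<^sup>2 \<partial>M) \<longlongrightarrow> q) F"
  shows "((\<lambda>i. \<integral>\<omega>. (X i \<omega>)\<^sup>2 \<partial>M) \<longlongrightarrow> q) F"
proof -
  define e where "e = (\<lambda>i. \<integral>\<omega>. (X i \<omega> - Y i \<omega>)\<^sup>2 \<partial>M)"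
  define b where "b = (\<lambda>i. \<integral>\<omega>. (Y i \<omega>)\<^sup>2 \<partial>M)"
  have e0: "e i \<ge> 0" for i by (simp add: e_def)
  have b0: "b i \<ge> 0" for i by (simp add: b_def)
  have bound: "\<bar>(\<integral>\<omega>. (X i \<omega>)\<^sup>2 \<partial>M) - b i\<bar> \<le> e i + 2 * sqrt (e i) * sqrt (b i)" for i
  proof -
    let ?D = "\<lambda>\<omega>. X i \<omega> - Y i \<omega>"
    have D: "square_integrable M ?D" by (rule square_integrable_diff[OF X Y])
    note DY = square_integrable_mult[OF D Y[of i]]
    define p where "p = (\<integral>\<omega>. ?D \<omega> * Y i \<omega> \<partial>M)"
    have exp: "(\<integral>\<omega>. (c * ?D \<omega> + Y i \<omega>)\<^sup>2 \<partial>M) = c\<^sup>2 * e i + 2 * c * p + b i" for c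
    proof -
      have "(\<integral>\<omega>. (c * ?D \<omega> + Y i \<omega>)\<^sup>2 \<partial>M)
          = (\<integral>\<omega>. c\<^sup>2 * (?D \<omega>)\<^sup>2 + 2 * c * (?D \<omega> * Y i \<omega>) + (Y i \<omega>)\<^sup>2 \<partial>M)"
        by (rule Bochner_Integration.integral_cong) (auto simp: power2_sum power_mult_distrib)
      also have "\<dots> = c\<^sup>2 * e i + 2 * c * p + b i"
        unfolding e_def p_def b_def using D Y[of i] DY
        by (simp add: square_integrable_def)
      finally show ?thesis .
    qed
    have nn: "0 \<le> c\<^sup>2 * e i + 2 * c * p + b i" for c
      unfolding exp[symmetric] by simp
    have CS: "p\<^sup>2 \<le> e i * b i"
    proof (cases "e i = 0")
      case True
      have "p = 0"
      proof (rule ccontr)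
        assume "p \<noteq> 0"
        with nn[of "- (b i + 1) / (2 * p)"] True show False by (simp add: field_simps)
      qed
      then show ?thesis using True by simp
    next
      case False
      with e0[of i] have e: "e i > 0" by simp
      have "0 \<le> e i * ((- p / e i)\<^sup>2 * e i + 2 * (- p / e i) * p + b i)"
        using nn[of "- p / e i"] e by (rule mult_nonneg_nonneg[OF less_imp_le, rotated])
      also have "\<dots> = e i * b i - p\<^sup>2" using e by (simp add: field_simps power2_eq_square)
      finally show ?thesis by simp
    qed
    then have "\<bar>p\<bar> \<le> sqrt (e i) * sqrt (b i)"
      by (metis real_sqrt_abs real_sqrt_le_iff real_sqrt_mult)
    moreover have "(\<integral>\<omega>. (X i \<omega>)\<^sup>2 \<partial>M) = e i + 2 * p + b i" using exp[of 1] by simp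
    ultimately show ?thesis using e0[of i] by (auto simp: abs_le_iff)
  qed
  have "((\<lambda>i. e i + 2 * sqrt (e i) * sqrt (b i)) \<longlongrightarrow> 0 + 2 * sqrt 0 * sqrt q) F"
    using diff q unfolding e_def b_def by (intro tendsto_intros)
  then have lim: "((\<lambda>i. e i + 2 * sqrt (e i) * sqrt (b i)) \<longlongrightarrow> 0) F" by simp
  have "((\<lambda>i. (\<integral>\<omega>. (X i \<omega>)\<^sup>2 \<partial>M) - b i) \<longlongrightarrow> 0) F"
    by (rule Lim_null_comparison[OF _ lim]) (use bound in simp)
  from tendsto_add[OF this q[folded b_def]] show ?thesis by simp
qed

lemma fatou_square_integrable:
  fixes X :: "nat \<Rightarrow> 'w \<Rightarrow> real"
  assumes X: "\<And>n. square_integrable M (X n)" and R: "R \<in> borel_measurable M"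
    and lim: "AE \<omega> in M. (\<lambda>n. X n \<omega>) \<longlonglongrightarrow> R \<omega>"
    and B: "\<And>n. (\<integral>\<omega>. (X n \<omega>)\<^sup>2 \<partial>M) \<le> B"
  shows "square_integrable M R \<and> (\<integral>\<omega>. (R \<omega>)\<^sup>2 \<partial>M) \<le> B"
proof -
  have B0: "B \<ge> 0" using B[of 0] by (rule order_trans[rotated]) simp
  have "(\<integral>\<^sup>+\<omega>. ennreal ((R \<omega>)\<^sup>2) \<partial>M) = (\<integral>\<^sup>+\<omega>. liminf (\<lambda>n. ennreal ((X n \<omega>)\<^sup>2)) \<partial>M)"
  proof (rule nn_integral_cong_AE)
    show "AE \<omega> in M. ennreal ((R \<omega>)\<^sup>2) = liminf (\<lambda>n. ennreal ((X n \<omega>)\<^sup>2))"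
      using lim
    proof eventually_elim
      case (elim \<omega>)
      then have "(\<lambda>n. ennreal ((X n \<omega>)\<^sup>2)) \<longlonglongrightarrow> ennreal ((R \<omega>)\<^sup>2)"
        by (intro tendsto_ennrealI tendsto_intros)
      then show ?case using lim_imp_Liminf by (metis sequentially_bot)
    qed
  qed
  also have "\<dots> \<le> liminf (\<lambda>n. \<integral>\<^sup>+\<omega>. ennreal ((X n \<omega>)\<^sup>2) \<partial>M)"
    using X by (intro nn_integral_liminf) (simp add: square_integrable_def borel_measurable_integrable)
  also have "\<dots> \<le> liminf (\<lambda>n::nat. ennreal B)"
  proof (rule Liminf_mono)
    show "\<forall>\<^sub>F n in sequentially. (\<integral>\<^sup>+\<omega>. ennreal ((X n \<omega>)\<^sup>2) \<partial>M) \<le> ennreal B"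
      using X B by (auto simp: nn_integral_eq_integral square_integrable_def intro!: always_eventually ennreal_leI)
  qed
  finally have le: "(\<integral>\<^sup>+\<omega>. ennreal ((R \<omega>)\<^sup>2) \<partial>M) \<le> ennreal B" by (simp add: Liminf_const)
  then have int: "integrable M (\<lambda>\<omega>. (R \<omega>)\<^sup>2)"
    using R by (intro integrableI_bounded) (auto simp: le_less_trans[OF _ ennreal_less_top])
  moreover from this le have "(\<integral>\<omega>. (R \<omega>)\<^sup>2 \<partial>M) \<le> B"
    using B0 by (simp add: nn_integral_eq_integral)
  ultimately show ?thesis using R by (simp add: square_integrable_def)
qed

section \<open>Integration of deterministic kernels against white noise\<close>

lemma white_noise_square_integrable:
  assumes "uncorrelated_white_noise M J W" "j \<in> J" "t \<ge> 0"
  shows "square_integrable M (W j t)"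
  using assms by (auto simp: uncorrelated_white_noise_def square_integrable_def)

lemma white_noise_increment_covariance:
  assumes W: "uncorrelated_white_noise M J W" and J: "i \<in> J" "j \<in> J"
    and t: "0 \<le> a" "0 \<le> b" "0 \<le> c" "0 \<le> d"
  shows "(\<integral>\<omega>. (W i b \<omega> - W i a \<omega>) * (W j d \<omega> - W j c \<omega>) \<partial>M) =
    (if i = j then min b d - min b c - min a d + min a c else 0)"
proof -
  note sq = white_noise_square_integrable[OF W]
  have cov: "(\<integral>\<omega>. W i s \<omega> * W j t \<omega> \<partial>M) = (if i = j then min s t else 0)" if "s \<ge> 0" "t \<ge> 0" for s t
    using W J that by (auto simp: uncorrelated_white_noise_def)
  have int: "integrable M (\<lambda>\<omega>. W i s \<omega> * W j t \<omega>)" if "s \<ge> 0" "t \<ge> 0" for s t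
    using that J by (intro square_integrable_mult sq)
  have "(\<integral>\<omega>. (W i b \<omega> - W i a \<omega>) * (W j d \<omega> - W j c \<omega>) \<partial>M)
      = (\<integral>\<omega>. W i b \<omega> * W j d \<omega> - W i b \<omega> * W j c \<omega> - W i a \<omega> * W j d \<omega> + W i a \<omega> * W j c \<omega> \<partial>M)"
    by (rule Bochner_Integration.integral_cong) (auto simp: algebra_simps)
  also have "\<dots> = (if i = j then min b d - min b c - min a d + min a c else 0)"
    using t by (simp add: int cov)
  finally show ?thesis .
qed

definition increment :: "(real \<Rightarrow> real) \<Rightarrow> real \<Rightarrow> nat \<Rightarrow> nat \<Rightarrow> real" where
  "increment w T n k = w (real (Suc k) * T / real n) - w (real k * T / real n)"

lemma grid_increment_covariance:
  assumes W: "uncorrelated_white_noise M J W" and J: "i \<in> J" "j \<in> J" and T: "T \<ge> 0"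
  shows "(\<integral>\<omega>. increment (\<lambda>t. W i t \<omega>) T n k * increment (\<lambda>t. W j t \<omega>) T n l \<partial>M) =
    (if i = j \<and> k = l then T / real n else 0)"
proof -
  define p where "p = (\<lambda>k. real k * T / real n)"
  have mono: "p a \<le> p b" if "a \<le> b" for a b
    using that T unfolding p_def by (intro divide_right_mono mult_right_mono) auto
  have diag: "p (Suc k) - p k = T / real n"
    by (simp add: p_def diff_divide_distrib[symmetric] algebra_simps)
  consider "Suc k \<le> l" | "k = l" | "Suc l \<le> k" by linarith
  then have overlap: "min (p (Suc k)) (p (Suc l)) - min (p (Suc k)) (p l)
      - min (p k) (p (Suc l)) + min (p k) (p l) = (if k = l then T / real n else 0)"
  proof cases
    case 1
    then show ?thesis
      using mono[OF 1] mono[of k "Suc k"] mono[of l "Suc l"] by (simp add: min_def)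
  next
    case 2
    then show ?thesis unfolding diag[symmetric] using mono[of k "Suc k"] by (simp add: min_def)
  next
    case 3
    then show ?thesis
      using mono[OF 3] mono[of k "Suc k"] mono[of l "Suc l"] by (simp add: min_def)
  qed
  have p0: "p m \<ge> 0" for m using T by (simp add: p_def)
  show ?thesis
    unfolding increment_def p_def[THEN fun_cong, symmetric]
      white_noise_increment_covariance[OF W J p0 p0 p0 p0] overlap
    by simp
qed

lemma step_sum_second_moment:
  assumes W: "uncorrelated_white_noise M J W" and J: "finite J" and T: "T \<ge> 0"
  shows "square_integrable M (\<lambda>\<omega>. \<Sum>j\<in>J. \<Sum>k<n. c j k * increment (\<lambda>t. W j t \<omega>) T n k)" (is ?A)
    and "(\<integral>\<omega>. (\<Sum>j\<in>J. \<Sum>k<n. c j k * increment (\<lambda>t. W j t \<omega>) T n k)\<^sup>2 \<partial>M)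
      = (\<Sum>j\<in>J. \<Sum>k<n. (c j k)\<^sup>2 * (T / real n))" (is ?B)
proof -
  have sq: "square_integrable M (\<lambda>\<omega>. increment (\<lambda>t. W j t \<omega>) T n k)" if "j \<in> J" for j k
    unfolding increment_def
    using that T by (intro square_integrable_diff white_noise_square_integrable[OF W]) auto
  show ?A
    by (intro square_integrable_sum square_integrable_cmult sq)
  have "(\<integral>\<omega>. (\<Sum>j\<in>J. \<Sum>k<n. c j k * increment (\<lambda>t. W j t \<omega>) T n k)\<^sup>2 \<partial>M)
      = (\<integral>\<omega>. (\<Sum>p\<in>J \<times> {..<n}. c (fst p) (snd p) * increment (\<lambda>t. W (fst p) t \<omega>) T n (snd p))\<^sup>2 \<partial>M)"
    by (simp add: sum.cartesian_product case_prod_unfold)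
  also have "\<dots> = (\<Sum>p\<in>J \<times> {..<n}. \<Sum>q\<in>J \<times> {..<n}. c (fst p) (snd p) * c (fst q) (snd q) *
      (\<integral>\<omega>. increment (\<lambda>t. W (fst p) t \<omega>) T n (snd p) * increment (\<lambda>t. W (fst q) t \<omega>) T n (snd q) \<partial>M))"
    by (rule square_expansion_integral) (auto intro!: sq J)
  also have "\<dots> = (\<Sum>p\<in>J \<times> {..<n}. \<Sum>q\<in>J \<times> {..<n}.
      if q = p then (c (fst p) (snd p))\<^sup>2 * (T / real n) else 0)"
    by (intro sum.cong refl)
       (auto simp: grid_increment_covariance[OF W _ _ T] prod_eq_iff power2_eq_square)
  also have "\<dots> = (\<Sum>p\<in>J \<times> {..<n}. (c (fst p) (snd p))\<^sup>2 * (T / real n))"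
    using J by (intro sum.cong refl) (simp add: sum.delta)
  also have "\<dots> = (\<Sum>j\<in>J. \<Sum>k<n. (c j k)\<^sup>2 * (T / real n))"
    by (simp add: sum.cartesian_product case_prod_unfold)
  finally show ?B .
qed

text \<open>A step function on the coarse grid is also one on every refinement of it, so that sums over
  different grids can be compared by the isometry on the finer grid.\<close>

lemma increment_refine:
  assumes r: "r > 0"
  shows "(\<Sum>k<n * r. c (k div r) * increment w T (n * r) k) = (\<Sum>m<n. c m * increment w T n m)"
proof -
  have "(\<Sum>k<n * r. c (k div r) * increment w T (n * r) k)
      = (\<Sum>m<n. \<Sum>k\<in>{m * r..<m * r + r}. c (k div r) * increment w T (n * r) k)"
    by (rule sum.nat_group[symmetric])
  also have "\<dots> = (\<Sum>m<n. c m * increment w T n m)"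
  proof (rule sum.cong[OF refl])
    fix m
    let ?f = "\<lambda>k. w (real k * T / real (n * r))"
    have "(\<Sum>k\<in>{m * r..<m * r + r}. c (k div r) * increment w T (n * r) k)
        = (\<Sum>k\<in>{m * r..<m * r + r}. c m * (?f (Suc k) - ?f k))"
    proof (rule sum.cong[OF refl])
      fix k assume "k \<in> {m * r..<m * r + r}"
      then have "k div r = m" by (intro div_nat_eqI) (auto simp: algebra_simps)
      then show "c (k div r) * increment w T (n * r) k = c m * (?f (Suc k) - ?f k)"
        by (simp add: increment_def)
    qed
    also have "\<dots> = c m * (?f (m * r + r) - ?f (m * r))"
      by (simp only: sum_distrib_left[symmetric]) (subst sum_Suc_diff', auto)
    also have "\<dots> = c m * (w (real (Suc m) * T / real n) - w (real m * T / real n))"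
    proof -
      have "real (m * r) * T / real (n * r) = real m * T / real n" for m
        using r by simp
      from this[of m] this[of "Suc m"]
      show ?thesis by (simp add: add.commute)
    qed
    finally show "(\<Sum>k\<in>{m * r..<m * r + r}. c (k div r) * increment w T (n * r) k) = c m * increment w T n m"
      by (simp add: increment_def)
  qed
  finally show ?thesis .
qed

text \<open>The Wiener integral of the kernels, given as an almost sure limit \<open>R\<close> of step sums, has
  second moment \<open>G T - G 0\<close>, the integrated squares of the kernels. Almost sure convergence has to be
  upgraded to mean-square convergence: by the isometry for step functions, the sums on a grid and on its
  refinements are uniformly close in mean square, since the kernels are uniformly continuous, and Fatou's lemma
  along the refinements carries this over to the limit \<open>R\<close>.\<close>

theorem wiener_isometry:
  fixes \<kappa> :: "'j \<Rightarrow> real \<Rightarrow> real"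
  assumes W: "uncorrelated_white_noise M J W" and J: "finite J" and T: "T \<ge> 0"
    and \<kappa>: "\<And>j. j \<in> J \<Longrightarrow> continuous_on {0..T} (\<kappa> j)"
    and G: "\<And>t. t \<in> {0..T} \<Longrightarrow> (G has_real_derivative (\<Sum>j\<in>J. (\<kappa> j t)\<^sup>2)) (at t within {0..T})"
    and R: "R \<in> borel_measurable M"
    and lim: "AE \<omega> in M. (\<lambda>n. \<Sum>j\<in>J. \<Sum>k<n. \<kappa> j (real k * T / real n) * increment (\<lambda>t. W j t \<omega>) T n k) \<longlonglongrightarrow> R \<omega>"
  shows "square_integrable M R" "(\<integral>\<omega>. (R \<omega>)\<^sup>2 \<partial>M) = G T - G 0"
proof -
  define S where "S = (\<lambda>n \<omega>. \<Sum>j\<in>J. \<Sum>k<n. \<kappa> j (real k * T / real n) * increment (\<lambda>t. W j t \<omega>) T n k)"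
  have S: "square_integrable M (S n)" for n
    unfolding S_def by (rule step_sum_second_moment(1)[OF W J T])
  have moment: "(\<lambda>n. \<integral>\<omega>. (S n \<omega>)\<^sup>2 \<partial>M) \<longlonglongrightarrow> G T - G 0"
  proof -
    have "(\<lambda>n. \<Sum>k<n. 1 * (G (real (Suc k) * T / real n) - G (real k * T / real n))
        - 1 * (\<Sum>j\<in>J. (\<kappa> j (real k * T / real n))\<^sup>2) * (T / real n)) \<longlonglongrightarrow> 0"
    proof (rule rectangle_sum_tendsto[where \<tau> = "\<lambda>n k. real k * T / real n", OF T])
      show "real k * T / real n \<in> {real k * T / real n .. real (Suc k) * T / real n}" for n k
        using T by (auto intro!: divide_right_mono mult_right_mono)
    qed (use G \<kappa> in \<open>auto intro!: continuous_intros\<close>)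
    then have "(\<lambda>n. (G T - G 0) - (\<Sum>k<n. 1 * (G (real (Suc k) * T / real n) - G (real k * T / real n))
        - 1 * (\<Sum>j\<in>J. (\<kappa> j (real k * T / real n))\<^sup>2) * (T / real n))) \<longlonglongrightarrow> (G T - G 0) - 0"
      by (intro tendsto_intros)
    then have "(\<lambda>n. (G T - G 0) - (\<Sum>k<n. 1 * (G (real (Suc k) * T / real n) - G (real k * T / real n))
        - 1 * (\<Sum>j\<in>J. (\<kappa> j (real k * T / real n))\<^sup>2) * (T / real n))) \<longlonglongrightarrow> G T - G 0"
      by simp
    moreover have "\<forall>\<^sub>F n in sequentially. (G T - G 0) - (\<Sum>k<n. 1 * (G (real (Suc k) * T / real n) - G (real k * T / real n))
        - 1 * (\<Sum>j\<in>J. (\<kappa> j (real k * T / real n))\<^sup>2) * (T / real n)) = (\<integral>\<omega>. (S n \<omega>)\<^sup>2 \<partial>M)"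
      using eventually_gt_at_top[of 0]
    proof eventually_elim
      case (elim n)
      have tele: "(\<Sum>k<n. G (real (Suc k) * T / real n) - G (real k * T / real n)) = G T - G 0"
        using elim by (subst sum_lessThan_telescope) simp
      have "(G T - G 0) - (\<Sum>k<n. 1 * (G (real (Suc k) * T / real n) - G (real k * T / real n))
        - 1 * (\<Sum>j\<in>J. (\<kappa> j (real k * T / real n))\<^sup>2) * (T / real n))
        = (\<Sum>k<n. \<Sum>j\<in>J. (\<kappa> j (real k * T / real n))\<^sup>2 * (T / real n))"
        using tele unfolding sum_subtractf mult_1 sum_distrib_right by linarith
      also have "\<dots> = (\<integral>\<omega>. (S n \<omega>)\<^sup>2 \<partial>M)"
        unfolding S_def step_sum_second_moment(2)[OF W J T] by (rule sum.swap)
      finally show ?case .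
    qed
    ultimately show ?thesis by (rule Lim_transform_eventually)
  qed
  have close: "\<forall>\<^sub>F n in sequentially. square_integrable M (\<lambda>\<omega>. S n \<omega> - R \<omega>) \<and>
      (\<integral>\<omega>. (S n \<omega> - R \<omega>)\<^sup>2 \<partial>M) \<le> real (card J) * e\<^sup>2 * T" if e: "e > 0" for e
  proof -
    have "\<exists>\<delta>>0. \<forall>j\<in>J. \<forall>a\<in>{0..T}. \<forall>b\<in>{0..T}. dist b a < \<delta> \<longrightarrow> dist (\<kappa> j b) (\<kappa> j a) < e"
      using J \<kappa>
    proof (induction J rule: finite_induct)
      case empty
      then show ?case by (auto intro: exI[of _ 1])
    next
      case (insert j J)
      then obtain \<delta>1 where \<delta>1: "\<delta>1 > 0" "\<forall>j\<in>J. \<forall>a\<in>{0..T}. \<forall>b\<in>{0..T}. dist b a < \<delta>1 \<longrightarrow> dist (\<kappa> j b) (\<kappa> j a) < e"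
        by auto
      have "uniformly_continuous_on {0..T} (\<kappa> j)"
        using insert.prems by (intro compact_uniformly_continuous) auto
      then obtain \<delta>2 where \<delta>2: "\<delta>2 > 0" "\<forall>a\<in>{0..T}. \<forall>b\<in>{0..T}. dist b a < \<delta>2 \<longrightarrow> dist (\<kappa> j b) (\<kappa> j a) < e"
        unfolding uniformly_continuous_on_def using e by metis
      show ?case using \<delta>1 \<delta>2 by (intro exI[of _ "min \<delta>1 \<delta>2"]) auto
    qed
    then obtain \<delta> where \<delta>: "\<delta> > 0" and uc: "\<And>j a b. j \<in> J \<Longrightarrow> a \<in> {0..T} \<Longrightarrow> b \<in> {0..T} \<Longrightarrow>
        dist b a < \<delta> \<Longrightarrow> dist (\<kappa> j b) (\<kappa> j a) < e" by blast
    have "(\<lambda>n. T / real n) \<longlonglongrightarrow> 0" by real_asymp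
    then have "\<forall>\<^sub>F n in sequentially. T / real n < \<delta>"
      using \<delta> by (rule order_tendstoD)
    then show ?thesis using eventually_gt_at_top[of 0]
    proof eventually_elim
      case (elim n)
      define D where "D = (\<lambda>r \<omega>. S n \<omega> - S (n * Suc r) \<omega>)"
      have D_eq: "D r = (\<lambda>\<omega>. \<Sum>j\<in>J. \<Sum>k<n * Suc r. (\<kappa> j (real (k div Suc r) * T / real n)
          - \<kappa> j (real k * T / real (n * Suc r))) * increment (\<lambda>t. W j t \<omega>) T (n * Suc r) k)" for r
      proof
        fix \<omega>
        have "S n \<omega> = (\<Sum>j\<in>J. \<Sum>k<n * Suc r. \<kappa> j (real (k div Suc r) * T / real n)
            * increment (\<lambda>t. W j t \<omega>) T (n * Suc r) k)"
          unfolding S_def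
          by (intro sum.cong refl increment_refine[symmetric, where c = "\<lambda>m. \<kappa> _ (real m * T / real n)"]) simp
        then show "D r \<omega> = (\<Sum>j\<in>J. \<Sum>k<n * Suc r. (\<kappa> j (real (k div Suc r) * T / real n)
            - \<kappa> j (real k * T / real (n * Suc r))) * increment (\<lambda>t. W j t \<omega>) T (n * Suc r) k)"
          by (simp only: D_def S_def left_diff_distrib sum_subtractf)
      qed
      have D_sq: "square_integrable M (D r)" for r
        unfolding D_eq by (rule step_sum_second_moment(1)[OF W J T])
      have D_le: "(\<integral>\<omega>. (D r \<omega>)\<^sup>2 \<partial>M) \<le> real (card J) * e\<^sup>2 * T" for r
      proof -
        have pt: "\<bar>\<kappa> j (real (k div Suc r) * T / real n) - \<kappa> j (real k * T / real (n * Suc r))\<bar> \<le> e"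
          if j: "j \<in> J" and k: "k < n * Suc r" for j k
        proof -
          let ?a = "real (k div Suc r) * T / real n" and ?b = "real k * T / real (n * Suc r)"
          have scale: "real a * T / real n = real (a * s) * T / real (n * s)" if "s > 0" for a s
            using that by simp
          have a_eq: "?a = real (k div Suc r * Suc r) * T / real (n * Suc r)"
            by (rule scale) simp
          have pos: "real (n * Suc r) > 0" using elim by (simp only: of_nat_0_less_iff) simp
          have "k div Suc r * Suc r \<le> k" by (rule div_times_less_eq_dividend)
          then have "real (k div Suc r * Suc r) * T \<le> real k * T"
            using T by (intro mult_right_mono) (auto simp only: of_nat_le_iff)
          then have ab: "?a \<le> ?b" unfolding a_eq using pos by (intro divide_right_mono) auto
          have a0: "?a \<ge> 0" using T by simp
          have "real k * T \<le> real (n * Suc r) * T"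
            using T k by (intro mult_right_mono) (auto simp only: of_nat_le_iff)
          then have bT: "?b \<le> T" using pos by (simp only: pos_divide_le_eq mult.commute)
          have "k \<le> k div Suc r * Suc r + Suc r"
            using mod_less_divisor[of "Suc r" k] div_mult_mod_eq[of k "Suc r"] by linarith
          then have "real k * T \<le> real (k div Suc r * Suc r + Suc r) * T"
            using T by (intro mult_right_mono) (auto simp only: of_nat_le_iff)
          then have "?b \<le> real (k div Suc r * Suc r + Suc r) * T / real (n * Suc r)"
            using pos by (intro divide_right_mono) auto
          also have "\<dots> = ?a + T / real n"
            using scale[of "Suc r" 1] unfolding a_eq
            by (simp only: of_nat_add distrib_right add_divide_distrib mult_1 zero_less_Suc of_nat_1)
          finally have "dist ?a ?b < \<delta>" using ab elim by (simp add: dist_real_def)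
          from uc[OF j _ _ this] a0 ab bT show ?thesis by (simp add: dist_real_def)
        qed
        have "(\<integral>\<omega>. (D r \<omega>)\<^sup>2 \<partial>M) \<le> (\<Sum>j\<in>J. \<Sum>k<n * Suc r. e\<^sup>2 * (T / real (n * Suc r)))"
          unfolding D_eq step_sum_second_moment(2)[OF W J T]
        proof (intro sum_mono mult_right_mono)
          fix j k assume "j \<in> J" "k \<in> {..<n * Suc r}"
          then show "(\<kappa> j (real (k div Suc r) * T / real n) - \<kappa> j (real k * T / real (n * Suc r)))\<^sup>2 \<le> e\<^sup>2"
            using pt[of j k] e by (intro abs_le_square_iff[THEN iffD1]) auto
        qed (use T in simp)
        also have "\<dots> = real (card J) * e\<^sup>2 * T"
          using elim by (simp del: of_nat_mult of_nat_Suc mult_Suc_right)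
        finally show ?thesis .
      qed
      have "AE \<omega> in M. (\<lambda>r. D r \<omega>) \<longlonglongrightarrow> S n \<omega> - R \<omega>"
        using lim
      proof eventually_elim
        case (elim \<omega>)
        have "filterlim (\<lambda>r. n * Suc r) sequentially sequentially"
          using \<open>0 < n\<close> by (intro filterlim_subseq) (simp add: strict_mono_def)
        from filterlim_compose[OF elim this] show ?case
          unfolding D_def S_def by (intro tendsto_intros)
      qed
      moreover have "(\<lambda>\<omega>. S n \<omega> - R \<omega>) \<in> borel_measurable M"
        using S[of n] R by (auto simp: square_integrable_def intro!: borel_measurable_diff)
      ultimately show ?case
        using fatou_square_integrable[of M D, OF D_sq _ _ D_le] by simp
    qed
  qed
  obtain n where "square_integrable M (\<lambda>\<omega>. S n \<omega> - R \<omega>)"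
    using eventually_happens'[OF sequentially_bot close[of 1]] by auto
  from square_integrable_diff[OF S[of n] this] show Rsq: "square_integrable M R" by simp
  have "(\<lambda>n. \<integral>\<omega>. (R \<omega> - S n \<omega>)\<^sup>2 \<partial>M) \<longlonglongrightarrow> 0"
  proof (rule order_tendstoI)
    fix a :: real assume "a < 0"
    then show "\<forall>\<^sub>F n in sequentially. a < (\<integral>\<omega>. (R \<omega> - S n \<omega>)\<^sup>2 \<partial>M)"
      by (auto intro!: always_eventually less_le_trans[of a 0])
  next
    fix a :: real assume a: "a > 0"
    define K where "K = real (card J) * T + 1"
    have K: "K > 0" using T by (simp add: K_def add_nonneg_pos)
    define e where "e = sqrt (a / (2 * K))"
    have "e > 0" and e2: "e\<^sup>2 = a / (2 * K)" using a K by (simp_all add: e_def)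
    have "real (card J) * e\<^sup>2 * T \<le> K * e\<^sup>2" by (simp add: K_def algebra_simps)
    also have "\<dots> < a" unfolding e2 using K a by simp
    finally have small: "real (card J) * e\<^sup>2 * T < a" .
    show "\<forall>\<^sub>F n in sequentially. (\<integral>\<omega>. (R \<omega> - S n \<omega>)\<^sup>2 \<partial>M) < a"
      using close[OF \<open>e > 0\<close>] by eventually_elim (use small in \<open>auto simp: power2_commute\<close>)
  qed
  from second_moment_tendsto[of M "\<lambda>_. R" S, OF Rsq S this moment]
  show "(\<integral>\<omega>. (R \<omega>)\<^sup>2 \<partial>M) = G T - G 0"
    by (simp add: LIMSEQ_const_iff)
qed

text \<open>The notion of white noise used here involves second moments only, hence is
  invariant under matrices with orthonormal rows. This is what makes the noises of different modes
  uncorrelated.\<close>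

lemma white_noise_orthogonal_transform:
  fixes U :: "'i \<Rightarrow> 'j \<Rightarrow> real"
  assumes W: "uncorrelated_white_noise M J W" and J: "finite J"
    and U: "\<And>i i'. i \<in> I \<Longrightarrow> i' \<in> I \<Longrightarrow> (\<Sum>j\<in>J. U i j * U i' j) = (if i = i' then 1 else 0)"
  shows "uncorrelated_white_noise M I (\<lambda>i t \<omega>. \<Sum>j\<in>J. U i j * W j t \<omega>)"
proof -
  note sq = white_noise_square_integrable[OF W]
  have sq': "square_integrable M (\<lambda>\<omega>. \<Sum>j\<in>J. U i j * W j t \<omega>)" if "t \<ge> 0" for i t
    using that by (intro square_integrable_sum square_integrable_cmult sq)
  interpret prob_space M using W by (simp add: uncorrelated_white_noise_def)
  have int: "integrable M (W j t)" if "j \<in> J" "t \<ge> 0" for j t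
    using sq[OF that] square_integrable_imp_integrable by (auto simp: square_integrable_def)
  show ?thesis
    unfolding uncorrelated_white_noise_def
  proof (intro conjI ballI allI impI)
    show "prob_space M" by (rule prob_space_axioms)
    fix i t assume "(t::real) \<ge> 0"
    show "(\<lambda>\<omega>. \<Sum>j\<in>J. U i j * W j t \<omega>) \<in> borel_measurable M"
      "integrable M (\<lambda>\<omega>. (\<Sum>j\<in>J. U i j * W j t \<omega>)\<^sup>2)"
      using sq'[OF \<open>t \<ge> 0\<close>, of i] by (auto simp: square_integrable_def)
    show "(\<integral>\<omega>. (\<Sum>j\<in>J. U i j * W j t \<omega>) \<partial>M) = 0"
      using W \<open>t \<ge> 0\<close> int
      by (subst Bochner_Integration.integral_sum) (auto simp: uncorrelated_white_noise_def)
  next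
    fix i i' s t assume I: "i \<in> I" "i' \<in> I" and st: "(s::real) \<ge> 0" "(t::real) \<ge> 0"
    have "(\<integral>\<omega>. (\<Sum>j\<in>J. U i j * W j s \<omega>) * (\<Sum>j\<in>J. U i' j * W j t \<omega>) \<partial>M)
        = (\<integral>\<omega>. (\<Sum>j\<in>J. \<Sum>k\<in>J. (U i j * U i' k) * (W j s \<omega> * W k t \<omega>)) \<partial>M)"
      unfolding sum_product
      by (intro Bochner_Integration.integral_cong sum.cong refl) (simp add: mult_ac)
    also have "\<dots> = (\<Sum>j\<in>J. \<Sum>k\<in>J. (U i j * U i' k) * (\<integral>\<omega>. W j s \<omega> * W k t \<omega> \<partial>M))"
      using st by (subst Bochner_Integration.integral_sum; (intro Bochner_Integration.integrable_sum integrable_mult_right square_integrable_mult sq)?)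
        (auto intro!: sum.cong simp: Bochner_Integration.integral_sum square_integrable_mult sq)
    also have "\<dots> = (\<Sum>j\<in>J. \<Sum>k\<in>J. if k = j then (U i j * U i' j) * min s t else 0)"
      using W st by (intro sum.cong refl) (auto simp: uncorrelated_white_noise_def)
    also have "\<dots> = (\<Sum>j\<in>J. U i j * U i' j) * min s t"
      using J by (simp add: sum_distrib_right)
    also have "\<dots> = (if i = i' then min s t else 0)" using U[OF I] by simp
    finally show "(\<integral>\<omega>. (\<Sum>j\<in>J. U i j * W j s \<omega>) * (\<Sum>j\<in>J. U i' j * W j t \<omega>) \<partial>M)
        = (if i = i' then min s t else 0)" .
  next
    fix i
    have "AE \<omega> in M. \<forall>j\<in>J. continuous_on {0..} (\<lambda>t. W j t \<omega>)"
      using W J by (intro AE_finite_allI) (auto simp: uncorrelated_white_noise_def)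
    then show "AE \<omega> in M. continuous_on {0..} (\<lambda>t. \<Sum>j\<in>J. U i j * W j t \<omega>)"
      by eventually_elim (auto intro!: continuous_intros)
  qed
qed

section \<open>Pathwise response of one mode\<close>

text \<open>The paths have no derivative, but each state minus its noise has one. Let \<open>P\<close> be the
  adjoint kernel run backwards from time \<open>T\<close>, and \<open>H\<close> its pairing with the state, which equals the
  position at time \<open>T\<close>. Summation by parts splits the increments of \<open>H\<close> on a grid into the
  increments of \<open>P\<close> against the state, those of the smooth part of the state against \<open>P\<close>, and the
  noise increments against \<open>P\<close>. The first two cancel in the limit because \<open>P\<close> solves the adjoint
  equation.\<close>

lemma mode_path_representation:
  fixes z x v w \<eta> :: "real \<Rightarrow> real"
  assumes K: "mode_kernel \<alpha> c \<kappa> \<phi> \<gamma> V \<xi>z \<xi>x \<xi>v G" and T: "T \<ge> 0"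
    and cont: "continuous_on {0..} z" "continuous_on {0..} x" "continuous_on {0..} v"
    and z: "\<And>t. t \<ge> 0 \<Longrightarrow> z t = z 0 + integral {0..t} (\<lambda>s. - \<alpha> * z s - c * v s) - \<kappa> * \<eta> t"
    and x: "\<And>t. t \<ge> 0 \<Longrightarrow> x t = x 0 + integral {0..t} v"
    and v: "\<And>t. t \<ge> 0 \<Longrightarrow> v t = v 0 + integral {0..t} (\<lambda>s. z s - \<phi> * x s - \<gamma> * v s) + w t"
  shows "(\<lambda>n. \<Sum>k<n. \<xi>v (T - real k * T / real n) * increment w T n k
        - \<kappa> * \<xi>z (T - real k * T / real n) * increment \<eta> T n k)
     \<longlonglongrightarrow> x T - (\<xi>z T * z 0 + \<xi>x T * x 0 + \<xi>v T * v 0)"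
proof -
  define t where "t = (\<lambda>n k. real k * T / real n)"
  have t0: "t n k \<ge> 0" for n k using T by (simp add: t_def)
  have tmono: "t n k \<le> t n (Suc k)" for n k
    using T unfolding t_def by (intro divide_right_mono mult_right_mono) auto
  have C: "continuous_on {0..T} z" "continuous_on {0..T} x" "continuous_on {0..T} v"
    by (rule continuous_on_subset[OF cont(1)], force) (rule continuous_on_subset[OF cont(2)], force,
        rule continuous_on_subset[OF cont(3)], force)
  define dz dv where "dz = (\<lambda>s. - \<alpha> * z s - c * v s)" and "dv = (\<lambda>s. z s - \<phi> * x s - \<gamma> * v s)"
  have Cd: "continuous_on {0..T} dz" "continuous_on {0..T} dv"
    unfolding dz_def dv_def by (intro continuous_intros C)+
  define Uz Ux Uv where "Uz = (\<lambda>t. integral {0..t} dz)" and "Ux = (\<lambda>t. integral {0..t} v)"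
    and "Uv = (\<lambda>t. integral {0..t} dv)"
  have U: "(Uz has_real_derivative dz s) (at s within {0..T})"
    "(Ux has_real_derivative v s) (at s within {0..T})"
    "(Uv has_real_derivative dv s) (at s within {0..T})" if "s \<in> {0..T}" for s
    unfolding Uz_def Ux_def Uv_def using that C Cd by (intro integral_has_real_derivative; simp)+
  define Pz Px Pv where "Pz = (\<lambda>s. \<xi>z (T - s))" and "Px = (\<lambda>s. \<xi>x (T - s))" and "Pv = (\<lambda>s. \<xi>v (T - s))"
  define dPz dPx dPv where "dPz = (\<lambda>s. \<alpha> * Pz s - Pv s)" and "dPx = (\<lambda>s. \<phi> * Pv s)"
    and "dPv = (\<lambda>s. c * Pz s - Px s + \<gamma> * Pv s)"
  have \<xi>: "(\<xi>z has_real_derivative - \<alpha> * \<xi>z s + \<xi>v s) (at s)"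
    "(\<xi>x has_real_derivative - \<phi> * \<xi>v s) (at s)"
    "(\<xi>v has_real_derivative - c * \<xi>z s + \<xi>x s - \<gamma> * \<xi>v s) (at s)" for s
    using K by (auto simp: mode_kernel_def)
  have rev: "((\<lambda>s. \<xi> (T - s)) has_real_derivative - d) (at s within {0..T})"
    if "(\<xi> has_real_derivative d) (at (T - s))" for \<xi> d s
  proof -
    have "((\<lambda>s. T - s) has_real_derivative - 1) (at s within {0..T})"
      by (auto intro!: derivative_eq_intros)
    from DERIV_chain2[where f = \<xi> and g = "\<lambda>s. T - s", OF that this] show ?thesis by simp
  qed
  have P: "(Pz has_real_derivative dPz s) (at s within {0..T})"
    "(Px has_real_derivative dPx s) (at s within {0..T})"
    "(Pv has_real_derivative dPv s) (at s within {0..T})" for s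
    using rev[OF \<xi>(1), of s] rev[OF \<xi>(2), of s] rev[OF \<xi>(3), of s]
    by (simp_all add: Pz_def Px_def Pv_def dPz_def dPx_def dPv_def algebra_simps)
  have CP: "continuous_on {0..T} Pz" "continuous_on {0..T} Px" "continuous_on {0..T} Pv"
    using P by (meson DERIV_continuous_on)+
  have CdP: "continuous_on {0..T} dPz" "continuous_on {0..T} dPx" "continuous_on {0..T} dPv"
    unfolding dPz_def dPx_def dPv_def by (intro continuous_intros CP)+
  define Ez where "Ez = (\<lambda>n k. z (t n (Suc k)) * (Pz (t n (Suc k)) - Pz (t n k)) - z (t n k) * dPz (t n k) * (T / real n)
      + (Pz (t n k) * (Uz (t n (Suc k)) - Uz (t n k)) - Pz (t n k) * dz (t n k) * (T / real n)))"
  define Ex where "Ex = (\<lambda>n k. x (t n (Suc k)) * (Px (t n (Suc k)) - Px (t n k)) - x (t n k) * dPx (t n k) * (T / real n)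
      + (Px (t n k) * (Ux (t n (Suc k)) - Ux (t n k)) - Px (t n k) * v (t n k) * (T / real n)))"
  define Ev where "Ev = (\<lambda>n k. v (t n (Suc k)) * (Pv (t n (Suc k)) - Pv (t n k)) - v (t n k) * dPv (t n k) * (T / real n)
      + (Pv (t n k) * (Uv (t n (Suc k)) - Uv (t n k)) - Pv (t n k) * dv (t n k) * (T / real n)))"
  have cell: "t n k \<in> {real k * T / real n..real (Suc k) * T / real n}"
    "t n (Suc k) \<in> {real k * T / real n..real (Suc k) * T / real n}" for n k
    using tmono[of n k] unfolding t_def by (simp_all only: atLeastAtMost_iff order_refl simp_thms)
  have sums: "(\<lambda>n. \<Sum>k<n. g (t n (Suc k)) * (F (t n (Suc k)) - F (t n k)) - g (t n k) * F' (t n k) * (T / real n)) \<longlonglongrightarrow> 0"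
    "(\<lambda>n. \<Sum>k<n. g (t n k) * (F (t n (Suc k)) - F (t n k)) - g (t n k) * F' (t n k) * (T / real n)) \<longlonglongrightarrow> 0"
    if "\<And>s. s \<in> {0..T} \<Longrightarrow> (F has_real_derivative F' s) (at s within {0..T})"
      "continuous_on {0..T} F'" "continuous_on {0..T} g" for F F' g
  proof -
    show "(\<lambda>n. \<Sum>k<n. g (t n (Suc k)) * (F (t n (Suc k)) - F (t n k)) - g (t n k) * F' (t n k) * (T / real n)) \<longlonglongrightarrow> 0"
      using rectangle_sum_tendsto[OF T that cell(2)] unfolding t_def .
    show "(\<lambda>n. \<Sum>k<n. g (t n k) * (F (t n (Suc k)) - F (t n k)) - g (t n k) * F' (t n k) * (T / real n)) \<longlonglongrightarrow> 0"
      using rectangle_sum_tendsto[OF T that cell(1)] unfolding t_def .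
  qed
  have "(\<lambda>n. (\<Sum>k<n. Ez n k) + (\<Sum>k<n. Ex n k) + (\<Sum>k<n. Ev n k)) \<longlonglongrightarrow> 0 + 0 + 0 + 0 + (0 + 0)"
    unfolding Ez_def Ex_def Ev_def sum.distrib add.assoc[symmetric]
    unfolding add.assoc
    by (intro tendsto_add sums P U C CP CdP Cd)
  then have "(\<lambda>n. (x T - (\<xi>z T * z 0 + \<xi>x T * x 0 + \<xi>v T * v 0))
      - ((\<Sum>k<n. Ez n k) + (\<Sum>k<n. Ex n k) + (\<Sum>k<n. Ev n k)))
      \<longlonglongrightarrow> (x T - (\<xi>z T * z 0 + \<xi>x T * x 0 + \<xi>v T * v 0)) - 0"
    by (intro tendsto_diff tendsto_const) simp
  moreover have "\<forall>\<^sub>F n in sequentially. (x T - (\<xi>z T * z 0 + \<xi>x T * x 0 + \<xi>v T * v 0))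
      - ((\<Sum>k<n. Ez n k) + (\<Sum>k<n. Ex n k) + (\<Sum>k<n. Ev n k))
      = (\<Sum>k<n. \<xi>v (T - real k * T / real n) * increment w T n k
        - \<kappa> * \<xi>z (T - real k * T / real n) * increment \<eta> T n k)"
    using eventually_gt_at_top[of 0]
  proof eventually_elim
    case (elim n)
    define H where "H = (\<lambda>s. Pz s * z s + Px s * x s + Pv s * v s)"
    have "(\<Sum>k<n. H (t n (Suc k)) - H (t n k)) = H (t n n) - H (t n 0)"
      by (rule sum_lessThan_telescope)
    also have "H (t n n) = x T"
      using elim K by (simp add: H_def t_def Pz_def Px_def Pv_def mode_kernel_def)
    also have "H (t n 0) = \<xi>z T * z 0 + \<xi>x T * x 0 + \<xi>v T * v 0"
      by (simp add: H_def t_def Pz_def Px_def Pv_def)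
    finally have tele: "(\<Sum>k<n. H (t n (Suc k)) - H (t n k)) = x T - (\<xi>z T * z 0 + \<xi>x T * x 0 + \<xi>v T * v 0)" .
    have cell: "H (t n (Suc k)) - H (t n k) - (Ez n k + Ex n k + Ev n k)
        = \<xi>v (T - t n k) * (w (t n (Suc k)) - w (t n k)) - \<kappa> * \<xi>z (T - t n k) * (\<eta> (t n (Suc k)) - \<eta> (t n k))" for k
    proof -
      have "z (t n (Suc k)) - z (t n k) = Uz (t n (Suc k)) - Uz (t n k) - \<kappa> * (\<eta> (t n (Suc k)) - \<eta> (t n k))"
        using z[OF t0, of n "Suc k"] z[OF t0, of n k] by (simp add: Uz_def dz_def algebra_simps)
      moreover have "x (t n (Suc k)) - x (t n k) = Ux (t n (Suc k)) - Ux (t n k)"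
        using x[OF t0, of n "Suc k"] x[OF t0, of n k] by (simp add: Ux_def)
      moreover have "v (t n (Suc k)) - v (t n k) = Uv (t n (Suc k)) - Uv (t n k) + (w (t n (Suc k)) - w (t n k))"
        using v[OF t0, of n "Suc k"] v[OF t0, of n k] by (simp add: Uv_def dv_def)
      ultimately have eqs: "Uz (t n (Suc k)) - Uz (t n k) = z (t n (Suc k)) - z (t n k) + \<kappa> * (\<eta> (t n (Suc k)) - \<eta> (t n k))"
        "Ux (t n (Suc k)) - Ux (t n k) = x (t n (Suc k)) - x (t n k)"
        "Uv (t n (Suc k)) - Uv (t n k) = v (t n (Suc k)) - v (t n k) - (w (t n (Suc k)) - w (t n k))"
        by simp_all
      \<comment> \<open>the adjoint equation: the pairing of state and kernel is constant in the absence of noise\<close>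
      have cancel: "z s * dPz s + Pz s * dz s + (x s * dPx s + Px s * v s) + (v s * dPv s + Pv s * dv s) = 0" for s
        by (simp add: dPz_def dPx_def dPv_def dz_def dv_def algebra_simps)
      have "H (t n (Suc k)) - H (t n k) - (Ez n k + Ex n k + Ev n k)
        = (z (t n k) * dPz (t n k) + Pz (t n k) * dz (t n k) + (x (t n k) * dPx (t n k) + Px (t n k) * v (t n k))
          + (v (t n k) * dPv (t n k) + Pv (t n k) * dv (t n k))) * (T / real n)
          + Pv (t n k) * (w (t n (Suc k)) - w (t n k)) - \<kappa> * Pz (t n k) * (\<eta> (t n (Suc k)) - \<eta> (t n k))"
        unfolding Ez_def Ex_def Ev_def H_def eqs
        by (simp only: ring_distribs mult_ac)
      then show ?thesis unfolding cancel by (simp add: Pv_def Pz_def)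
    qed
    show ?case
      unfolding tele[symmetric] sum.distrib[symmetric] sum_subtractf[symmetric] cell
      by (simp add: increment_def t_def)
  qed
  ultimately show ?thesis by (auto dest: Lim_transform_eventually)
qed

section \<open>The Hartley basis of the discrete torus\<close>

lemma card_lattice_box:
  fixes S :: "'d::finite \<Rightarrow> int set"
  assumes "\<And>i. finite (S i)"
  shows "finite {k :: int ^ 'd. \<forall>i. k $ i \<in> S i}" "card {k :: int ^ 'd. \<forall>i. k $ i \<in> S i} = (\<Prod>i\<in>UNIV. card (S i))"
proof -
  have eq: "{k :: int ^ 'd. \<forall>i. k $ i \<in> S i} = vec_lambda ` (\<Pi>\<^sub>E i\<in>UNIV. S i)" (is "?L = ?R")
  proof (intro equalityI subsetI)
    fix k assume "k \<in> ?L"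
    then have "k = vec_lambda (\<lambda>i. k $ i)" "(\<lambda>i. k $ i) \<in> (\<Pi>\<^sub>E i\<in>UNIV. S i)"
      by (auto simp: vec_nth_inverse)
    then show "k \<in> ?R" by blast
  qed auto
  have inj: "inj_on vec_lambda (\<Pi>\<^sub>E i\<in>UNIV. S i)"
    by (auto intro!: inj_onI simp: vec_lambda_inject)
  show "finite ?L" unfolding eq using assms by (intro finite_imageI finite_PiE) auto
  show "card ?L = (\<Prod>i\<in>UNIV. card (S i))"
    unfolding eq card_image[OF inj] by (rule card_PiE) simp
qed

lemma finite_torus [simp]: "finite (torus L :: (int ^ 'd) set)"
  and card_torus: "card (torus L :: (int ^ 'd) set) = L ^ CARD('d)"
proof -
  have "torus L = {k :: int ^ 'd. \<forall>i. k $ i \<in> {0..<int L}}"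
    by (auto simp: torus_def)
  then show "finite (torus L :: (int ^ 'd) set)" "card (torus L :: (int ^ 'd) set) = L ^ CARD('d)"
    using card_lattice_box[of "\<lambda>_::'d. {0..<int L}"] by simp_all
qed

lemma zero_in_torus: "L > 0 \<Longrightarrow> 0 \<in> torus L"
  by (simp add: torus_def)

lemma tmod_in_torus: "L > 0 \<Longrightarrow> tmod L k \<in> torus L"
  by (simp add: torus_def tmod_def)

lemma tmod_torus: "k \<in> torus L \<Longrightarrow> tmod L k = k"
  by (simp add: torus_def tmod_def vec_eq_iff)

lemma tmod_simps:
  "tmod L (tmod L k + l) = tmod L (k + l)" "tmod L (l + tmod L k) = tmod L (l + k)"
  "tmod L (tmod L k - l) = tmod L (k - l)" "tmod L (l - tmod L k) = tmod L (l - k)"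
  "tmod L (- tmod L k) = tmod L (- k)"
  by (simp_all add: tmod_def vec_eq_iff mod_simps)

lemma sum_torus_shift:
  assumes "L > 0"
  shows "(\<Sum>k\<in>torus L. h (tmod L (k + m))) = (\<Sum>k\<in>torus L. h k)"
  by (rule sum.reindex_bij_witness[of _ "\<lambda>k. tmod L (k - m)" "\<lambda>k. tmod L (k + m)"])
     (use assms in \<open>auto simp: tmod_simps tmod_in_torus tmod_torus\<close>)

lemma sum_torus_reflect:
  assumes "L > 0"
  shows "(\<Sum>k\<in>torus L. h (tmod L (- k))) = (\<Sum>k\<in>torus L. h k)"
  by (rule sum.reindex_bij_witness[of _ "\<lambda>k. tmod L (- k)" "\<lambda>k. tmod L (- k)"])
     (use assms in \<open>auto simp: tmod_simps tmod_in_torus tmod_torus\<close>)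

definition phase :: "nat \<Rightarrow> int ^ 'd \<Rightarrow> int ^ 'd \<Rightarrow> real" where
  "phase L n k = 2 * pi * real_of_int (\<Sum>i\<in>UNIV. n $ i * k $ i) / real L"

lemma phase_commute: "phase L n k = phase L k n"
  by (simp add: phase_def mult.commute)

lemma phase_add: "phase L n (k + l) = phase L n k + phase L n l"
  by (simp add: phase_def distrib_left sum.distrib add_divide_distrib)

lemma phase_minus: "phase L n (- k) = - phase L n k"
  by (simp add: phase_def sum_negf)

lemma phase_diff: "phase L n (k - l) = phase L n k - phase L n l"
  using phase_add[of L n k "- l"] by (simp add: phase_minus)

lemma phase_zero [simp]: "phase L n 0 = 0" "phase L 0 k = 0"
  by (simp_all add: phase_def)

lemma phase_axis: "phase L n (axis i 1) = 2 * pi * real_of_int (n $ i) / real L"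
proof -
  have "(\<Sum>j\<in>UNIV. n $ j * axis i 1 $ j) = (\<Sum>j\<in>UNIV. if j = i then n $ i else 0)"
    by (rule sum.cong) (auto simp: axis_def)
  then show ?thesis by (simp add: phase_def)
qed

lemma cos_sin_phase_tmod:
  assumes "L > 0"
  shows "cos (phase L n (tmod L k)) = cos (phase L n k)" "sin (phase L n (tmod L k)) = sin (phase L n k)"
proof -
  define q where "q = (\<Sum>i\<in>UNIV. n $ i * (k $ i div int L))"
  have "(\<Sum>i\<in>UNIV. n $ i * k $ i) = (\<Sum>i\<in>UNIV. n $ i * tmod L k $ i) + int L * q"
    unfolding q_def sum_distrib_left sum.distrib[symmetric]
  proof (rule sum.cong[OF refl])
    fix i
    have "k $ i = tmod L k $ i + int L * (k $ i div int L)" by (simp add: tmod_def)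
    from arg_cong[OF this, of "\<lambda>u. n $ i * u"]
    show "n $ i * k $ i = n $ i * tmod L k $ i + int L * (n $ i * (k $ i div int L))"
      by (simp only: distrib_left mult.left_commute)
  qed
  then have "phase L n k = phase L n (tmod L k) + 2 * pi * real_of_int q"
    using assms by (simp add: phase_def field_simps)
  then show "cos (phase L n (tmod L k)) = cos (phase L n k)" "sin (phase L n (tmod L k)) = sin (phase L n k)"
    by (simp_all add: cos_add sin_add)
qed

lemma not_dvd_mode:
  fixes n :: "int ^ 'd"
  assumes "n \<in> torus L - {0}"
  obtains i where "\<not> int L dvd n $ i"
proof -
  obtain i where "n $ i \<noteq> 0" using assms by (auto simp: vec_eq_iff)
  moreover have "0 \<le> n $ i" "n $ i < int L" using assms by (auto simp: torus_def)
  ultimately have "\<not> int L dvd n $ i" using zdvd_not_zless by force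
  then show ?thesis by (rule that)
qed

text \<open>A shift by one step in direction \<open>i\<close> permutes the torus and rotates the pair of sums by the
  angle \<open>2 \<pi> n\<^sub>i / L\<close>. A vector that is fixed by a nontrivial rotation is zero.\<close>

lemma trig_sums_vanish:
  fixes n :: "int ^ 'd"
  assumes L: "L > 0" and n: "\<not> int L dvd n $ i"
  shows "(\<Sum>k\<in>torus L. cos (phase L n k)) = 0" "(\<Sum>k\<in>torus L. sin (phase L n k)) = 0"
proof -
  define C S where "C = (\<Sum>k\<in>torus L. cos (phase L n k))" and "S = (\<Sum>k\<in>torus L. sin (phase L n k))"
  define \<theta> where "\<theta> = phase L n (axis i 1)"
  have "C = (\<Sum>k\<in>torus L. cos (phase L n (k + axis i 1)))"
    unfolding C_def by (subst sum_torus_shift[OF L, of _ "axis i 1", symmetric]) (simp add: cos_sin_phase_tmod[OF L])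
  also have "\<dots> = cos \<theta> * C - sin \<theta> * S"
    unfolding C_def S_def \<theta>_def phase_add cos_add sum_subtractf sum_distrib_left by (simp only: mult.commute)
  finally have C: "C = cos \<theta> * C - sin \<theta> * S" .
  have "S = (\<Sum>k\<in>torus L. sin (phase L n (k + axis i 1)))"
    unfolding S_def by (subst sum_torus_shift[OF L, of _ "axis i 1", symmetric]) (simp add: cos_sin_phase_tmod[OF L])
  also have "\<dots> = cos \<theta> * S + sin \<theta> * C"
    unfolding C_def S_def \<theta>_def phase_add sin_add sum.distrib sum_distrib_left by (simp only: mult.commute)
  finally have S: "S = cos \<theta> * S + sin \<theta> * C" .
  have "cos \<theta> \<noteq> 1"
  proof
    assume "cos \<theta> = 1"
    then obtain m :: int where "\<theta> = real_of_int m * 2 * pi" by (auto simp: cos_one_2pi_int)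
    then have "real_of_int (n $ i) = real_of_int (m * int L)"
      using L by (simp add: \<theta>_def phase_axis field_simps)
    then have "n $ i = m * int L" by (simp only: of_int_eq_iff)
    with n show False by simp
  qed
  have "2 * (1 - cos \<theta>) * C = 0" "2 * (1 - cos \<theta>) * S = 0"
  proof -
    have sq: "(sin \<theta>)\<^sup>2 + (cos \<theta>)\<^sup>2 = 1" by simp
    have zero: "C - (cos \<theta> * C - sin \<theta> * S) = 0" "S - (cos \<theta> * S + sin \<theta> * C) = 0"
      using C S by linarith+
    have "2 * (1 - c) * X = (1 - c) * (X - (c * X - s * Y)) + (- s) * (Y - (c * Y + s * X)) + (1 - (s\<^sup>2 + c\<^sup>2)) * X"
      "2 * (1 - c) * Y = (1 - c) * (Y - (c * Y + s * X)) + s * (X - (c * X - s * Y)) + (1 - (s\<^sup>2 + c\<^sup>2)) * Y"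
      for c s X Y :: real
      by (simp_all add: power2_eq_square algebra_simps)
    note identity = this[where c = "cos \<theta>" and s = "sin \<theta>" and X = C and Y = S]
    show "2 * (1 - cos \<theta>) * C = 0" "2 * (1 - cos \<theta>) * S = 0"
      unfolding identity zero sq by simp_all
  qed
  with \<open>cos \<theta> \<noteq> 1\<close> show "(\<Sum>k\<in>torus L. cos (phase L n k)) = 0" "(\<Sum>k\<in>torus L. sin (phase L n k)) = 0"
    by (auto simp: C_def S_def)
qed

lemma sum_sin_phase:
  assumes L: "L > 0"
  shows "(\<Sum>k\<in>torus L. sin (phase L n k)) = 0"
proof (cases "\<forall>i. int L dvd n $ i")
  case True
  have "sin (phase L n k) = 0" for k
  proof -
    have "int L dvd (\<Sum>i\<in>UNIV. n $ i * k $ i)" using True by (intro dvd_sum) auto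
    then obtain m where "(\<Sum>i\<in>UNIV. n $ i * k $ i) = int L * m" ..
    then have "phase L n k = 2 * pi * real_of_int m" using L by (simp add: phase_def)
    then show ?thesis by simp
  qed
  then show ?thesis by simp
next
  case False
  then show ?thesis using trig_sums_vanish[OF L] by blast
qed

text \<open>The real counterpart of the complex exponentials: an orthonormal basis that, like them, consists of
  common eigenvectors of all symmetric convolutions. Each function mixes the exponentials at the
  frequencies \<open>n\<close> and \<open>- n\<close>.\<close>

definition hartley :: "nat \<Rightarrow> int ^ 'd \<Rightarrow> int ^ 'd \<Rightarrow> real" where
  "hartley L n k = (cos (phase L n k) + sin (phase L n k)) / sqrt (real (L ^ CARD('d)))"

lemma hartley_commute: "hartley L n k = hartley L k n"
  by (simp add: hartley_def phase_commute)

lemma hartley_tmod: "L > 0 \<Longrightarrow> hartley L n (tmod L k) = hartley L n k"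
  by (simp add: hartley_def cos_sin_phase_tmod)

lemma hartley_orthonormal:
  fixes n m :: "int ^ 'd"
  assumes L: "L > 0" and n: "n \<in> torus L" and m: "m \<in> torus L"
  shows "(\<Sum>k\<in>torus L. hartley L n k * hartley L m k) = (if n = m then 1 else 0)"
proof -
  define N where "N = real (L ^ CARD('d))"
  have N: "N > 0" using L by (simp add: N_def)
  have prod: "hartley L n k * hartley L m k = (cos (phase L (n - m) k) + sin (phase L (n + m) k)) / N" for k
  proof -
    have "phase L (n + m) k = phase L n k + phase L m k" "phase L (n - m) k = phase L n k - phase L m k"
      by (simp_all add: phase_commute[of L _ k] phase_add phase_diff)
    moreover have "hartley L n k * hartley L m k
        = ((cos (phase L n k) + sin (phase L n k)) * (cos (phase L m k) + sin (phase L m k))) / (sqrt N * sqrt N)"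
      by (simp add: hartley_def N_def)
    ultimately show ?thesis using N
      by (simp only: cos_diff sin_add) (simp add: algebra_simps)
  qed
  have "(\<Sum>k\<in>torus L. hartley L n k * hartley L m k) = (\<Sum>k\<in>torus L. cos (phase L (n - m) k)) / N"
    unfolding prod by (simp add: sum_divide_distrib[symmetric] sum.distrib sum_sin_phase[OF L])
  also have "\<dots> = (if n = m then 1 else 0)"
  proof (cases "n = m")
    case True
    then show ?thesis using N card_torus[where 'd = 'd, of L] by (simp add: N_def)
  next
    case False
    then obtain i where i: "n $ i \<noteq> m $ i" by (auto simp: vec_eq_iff)
    have "\<not> int L dvd (n - m) $ i"
    proof
      assume "int L dvd (n - m) $ i"
      then have "n $ i mod int L = m $ i mod int L" by (simp add: mod_eq_dvd_iff)
      with i n m show False by (simp add: torus_def)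
    qed
    from trig_sums_vanish(1)[OF L this] False show ?thesis by simp
  qed
  finally show ?thesis .
qed

definition eigenvalue :: "nat \<Rightarrow> (int ^ 'd \<Rightarrow> real) \<Rightarrow> int ^ 'd \<Rightarrow> real" where
  "eigenvalue L a n = (\<Sum>k\<in>torus L. a k * cos (phase L n k))"

text \<open>By the addition theorem, the shifted basis function is a combination of itself and of its
  reflection; the coefficient of the latter is odd in the shift and is killed by the symmetry of the array.\<close>

lemma hartley_eigenvector:
  assumes L: "L > 0" and sym: "\<And>k. k \<in> torus L \<Longrightarrow> a (tmod L (- k)) = a k" and l: "l \<in> torus L"
  shows "(\<Sum>k\<in>torus L. hartley L n k * a (tmod L (k - l))) = eigenvalue L a n * hartley L n l"
proof -
  let ?r = "sqrt (real (L ^ CARD('a)))"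
  have odd: "(\<Sum>m\<in>torus L. a m * sin (phase L n m)) = 0"
  proof -
    have "(\<Sum>m\<in>torus L. a m * sin (phase L n m))
        = (\<Sum>m\<in>torus L. a (tmod L (- m)) * sin (phase L n (tmod L (- m))))"
      by (rule sum_torus_reflect[OF L, symmetric])
    also have "\<dots> = - (\<Sum>m\<in>torus L. a m * sin (phase L n m))"
      by (simp add: sym cos_sin_phase_tmod[OF L] phase_minus sum_negf)
    finally show ?thesis by simp
  qed
  have "(\<Sum>k\<in>torus L. hartley L n k * a (tmod L (k - l)))
      = (\<Sum>m\<in>torus L. hartley L n (tmod L (m + l)) * a (tmod L (tmod L (m + l) - l)))"
    by (rule sum_torus_shift[OF L, symmetric])
  also have "\<dots> = (\<Sum>m\<in>torus L. (a m * cos (phase L n m)) * hartley L n l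
      + (a m * sin (phase L n m)) * ((cos (phase L n l) - sin (phase L n l)) / ?r))"
  proof (rule sum.cong[OF refl])
    fix m :: "int ^ 'a" assume m: "m \<in> torus L"
    show "hartley L n (tmod L (m + l)) * a (tmod L (tmod L (m + l) - l))
        = (a m * cos (phase L n m)) * hartley L n l
          + (a m * sin (phase L n m)) * ((cos (phase L n l) - sin (phase L n l)) / ?r)"
      using m by (simp add: tmod_simps tmod_torus hartley_tmod[OF L])
        (simp add: hartley_def phase_add cos_add sin_add add_divide_distrib diff_divide_distrib algebra_simps)
  qed
  also have "\<dots> = eigenvalue L a n * hartley L n l"
    by (simp only: sum.distrib sum_distrib_right[symmetric] odd) (simp add: eigenvalue_def)
  finally show ?thesis .
qed

lemma hartley_conv:
  assumes L: "L > 0" and sym: "\<And>k. k \<in> torus L \<Longrightarrow> a (tmod L (- k)) = a k"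
  shows "(\<Sum>k\<in>torus L. hartley L n k * conv L a x k $ i) = eigenvalue L a n * (\<Sum>k\<in>torus L. hartley L n k * x k $ i)"
proof -
  have "(\<Sum>k\<in>torus L. hartley L n k * conv L a x k $ i)
      = (\<Sum>k\<in>torus L. \<Sum>l\<in>torus L. hartley L n k * a (tmod L (k - l)) * x l $ i)"
    by (simp add: conv_def sum_distrib_left mult.assoc)
  also have "\<dots> = (\<Sum>l\<in>torus L. (\<Sum>k\<in>torus L. hartley L n k * a (tmod L (k - l))) * x l $ i)"
    by (subst sum.swap) (simp add: sum_distrib_right)
  also have "\<dots> = eigenvalue L a n * (\<Sum>k\<in>torus L. hartley L n k * x k $ i)"
    by (simp add: hartley_eigenvector[where a = a, OF L sym] sum_distrib_left mult.assoc)
  finally show ?thesis .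
qed

lemma hartley_expansion:
  assumes L: "L > 0"
  shows "(\<Sum>k\<in>torus L. b k * x k) = (\<Sum>n\<in>torus L. (\<Sum>k\<in>torus L. b k * hartley L n k) * (\<Sum>k\<in>torus L. hartley L n k * x k))"
proof -
  have "(\<Sum>n\<in>torus L. (\<Sum>k\<in>torus L. b k * hartley L n k) * (\<Sum>k\<in>torus L. hartley L n k * x k))
      = (\<Sum>n\<in>torus L. \<Sum>k\<in>torus L. \<Sum>l\<in>torus L. b k * x l * (hartley L k n * hartley L l n))"
    by (simp add: sum_product mult_ac hartley_commute[of L _ _])
  also have "\<dots> = (\<Sum>k\<in>torus L. \<Sum>l\<in>torus L. \<Sum>n\<in>torus L. b k * x l * (hartley L k n * hartley L l n))"
    by (subst sum.swap, rule sum.cong[OF refl], rule sum.swap)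
  also have "\<dots> = (\<Sum>k\<in>torus L. \<Sum>l\<in>torus L. if l = k then b k * x k else 0)"
    unfolding sum_distrib_left[symmetric]
    by (intro sum.cong refl) (auto simp: hartley_orthonormal[OF L])
  also have "\<dots> = (\<Sum>k\<in>torus L. b k * x k)" by simp
  finally show ?thesis by simp
qed

lemma Re_symbol:
  "Re (symbol S a (frequency L n)) = (\<Sum>k\<in>S. a k * cos (phase L n k))"
proof -
  have "frequency L n \<bullet> (\<chi> i. real_of_int (k $ i)) = phase L n k" for k
    by (simp add: frequency_def phase_def inner_vec_def sum_divide_distrib sum_distrib_left mult_ac)
  then show ?thesis by (simp add: symbol_def)
qed

lemma finite_support:
  fixes f :: "int ^ 'd \<Rightarrow> real"
  assumes "local_array f"
  shows "finite {k. f k \<noteq> 0}"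
proof -
  obtain q :: nat where q: "\<And>k i. \<bar>k $ i\<bar> > int q \<Longrightarrow> f k = 0"
    using assms by (auto simp: local_array_def)
  have "{k. f k \<noteq> 0} \<subseteq> {k. \<forall>i. k $ i \<in> {- int q..int q}}"
  proof safe
    fix k i assume "f k \<noteq> 0"
    with q[of k i] have "\<bar>k $ i\<bar> \<le> int q" by force
    then show "k $ i \<in> {- int q..int q}" by (auto simp: abs_le_iff)
  qed
  then show ?thesis
    using card_lattice_box(1)[of "\<lambda>_::'d. {- int q..int q}"] finite_subset by blast
qed

lemma eigenvalue_wrap:
  fixes f :: "int ^ 'd \<Rightarrow> real"
  assumes L: "L > 0" and fin: "finite {k. f k \<noteq> 0}"
  shows "eigenvalue L (wrap L f) n = Re (symbol {k. f k \<noteq> 0} f (frequency L n))"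
proof -
  have "eigenvalue L (wrap L f) n = (\<Sum>k\<in>torus L. \<Sum>m | m \<in> {m. f m \<noteq> 0} \<and> tmod L m = k. f m * cos (phase L n m))"
    unfolding eigenvalue_def wrap_def sum_distrib_right
    by (intro sum.cong) (auto simp: cos_sin_phase_tmod[OF L])
  also have "\<dots> = (\<Sum>m | f m \<noteq> 0. f m * cos (phase L n m))"
    by (rule sum.group) (use fin tmod_in_torus[OF L] in auto)
  finally show ?thesis by (simp add: Re_symbol)
qed

lemma wrap_reflect:
  assumes L: "L > 0" and sym: "\<And>k. f (- k) = f k" and k: "k \<in> torus L"
  shows "wrap L f (tmod L (- k)) = wrap L f k"
  unfolding wrap_def
proof (rule sum.reindex_bij_witness[of _ uminus uminus])
  have neg: "tmod L (- m) = k'" if "tmod L m = tmod L (- k')" "k' \<in> torus L" for m k'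
    using that tmod_simps(5)[of L m] by (metis tmod_simps(5) minus_minus tmod_torus)
  fix m
  show "- m \<in> {m. f m \<noteq> 0 \<and> tmod L m = k}" if "m \<in> {m. f m \<noteq> 0 \<and> tmod L m = tmod L (- k)}"
    using that sym neg[OF _ k] by auto
  show "- m \<in> {m. f m \<noteq> 0 \<and> tmod L m = tmod L (- k)}" if "m \<in> {m. f m \<noteq> 0 \<and> tmod L m = k}"
    using that sym tmod_simps(5)[of L m] by auto
qed (use sym in auto)

section \<open>Decomposition of the network into modes\<close>

lemma second_moment_null_scale:
  assumes "square_integrable M X" "(c \<longlongrightarrow> 0) F"
  shows "((\<lambda>t. \<integral>\<omega>. (c t * X \<omega>)\<^sup>2 \<partial>M) \<longlongrightarrow> 0) F"
  using tendsto_mult[OF tendsto_power[OF assms(2), of 2] tendsto_const[of "\<integral>\<omega>. (X \<omega>)\<^sup>2 \<partial>M"]]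
  by (simp add: power_mult_distrib)

lemma second_moment_null_add:
  assumes "\<And>t. square_integrable M (X t)" "\<And>t. square_integrable M (Y t)"
    and "((\<lambda>t. \<integral>\<omega>. (X t \<omega>)\<^sup>2 \<partial>M) \<longlongrightarrow> 0) F" "((\<lambda>t. \<integral>\<omega>. (Y t \<omega>)\<^sup>2 \<partial>M) \<longlongrightarrow> 0) F"
  shows "((\<lambda>t. \<integral>\<omega>. (X t \<omega> + Y t \<omega>)\<^sup>2 \<partial>M) \<longlongrightarrow> 0) F"
  by (rule second_moment_tendsto[where Y = Y]) (use assms in \<open>simp_all add: square_integrable_add\<close>)

lemma second_moment_null_sum:
  assumes "finite I" "\<And>i t. i \<in> I \<Longrightarrow> square_integrable M (X i t)"
    and "\<And>i. i \<in> I \<Longrightarrow> ((\<lambda>t. \<integral>\<omega>. (X i t \<omega>)\<^sup>2 \<partial>M) \<longlongrightarrow> 0) F"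
  shows "((\<lambda>t. \<integral>\<omega>. (\<Sum>i\<in>I. X i t \<omega>)\<^sup>2 \<partial>M) \<longlongrightarrow> 0) F"
  using assms
proof (induction I rule: finite_induct)
  case (insert i I)
  then show ?case
    by (simp only: sum.insert[OF insert.hyps]) 
       (intro second_moment_null_add square_integrable_sum insert.IH; simp)
qed simp

lemma sum_integral_component:
  fixes F :: "'k \<Rightarrow> real \<Rightarrow> real ^ 'd"
  assumes "finite S" "\<And>k. k \<in> S \<Longrightarrow> continuous_on {0..t} (F k)"
  shows "(\<Sum>k\<in>S. h k * integral {0..t} (F k) $ i) = integral {0..t} (\<lambda>s. \<Sum>k\<in>S. h k * F k s $ i)"
proof -
  have int: "F k integrable_on {0..t}" if "k \<in> S" for k
    by (rule integrable_continuous_interval[OF assms(2)[OF that]])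
  have comp: "integral {0..t} (\<lambda>s. F k s $ i) = integral {0..t} (F k) $ i"
    "(\<lambda>s. F k s $ i) integrable_on {0..t}" if "k \<in> S" for k
    using integral_linear[OF int[OF that] bounded_linear_vec_nth]
      integrable_linear[OF int[OF that] bounded_linear_vec_nth] by (simp_all add: o_def)
  have "integral {0..t} (\<lambda>s. \<Sum>k\<in>S. h k * F k s $ i) = (\<Sum>k\<in>S. integral {0..t} (\<lambda>s. h k * F k s $ i))"
    using assms(1) comp(2) by (intro integral_sum integrable_on_mult_right) auto
  also have "\<dots> = (\<Sum>k\<in>S. h k * integral {0..t} (F k) $ i)"
    by (intro sum.cong refl) (simp add: comp)
  finally show ?thesis by simp
qed

lemma sum_one_coordinate:
  fixes i :: "'d::finite"
  shows "(\<Sum>q\<in>A \<times> UNIV. if snd q = i then h (fst q) else 0) = (\<Sum>k\<in>A. h k :: real)"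
proof -
  have "(\<Sum>q\<in>A \<times> UNIV. if snd q = i then h (fst q) else 0) = (\<Sum>k\<in>A. \<Sum>j\<in>UNIV. if j = i then h k else 0)"
    unfolding sum.cartesian_product by (rule sum.cong) auto
  then show ?thesis by simp
qed

definition modal :: "nat \<Rightarrow> 'd \<Rightarrow> int ^ 'd \<Rightarrow> (int ^ 'd \<Rightarrow> real ^ 'd) \<Rightarrow> real" where
  "modal L i n X = (\<Sum>k\<in>torus L. hartley L n k * X k $ i)"

text \<open>One system for both networks: the static network has \<open>c = \<kappa> = 0\<close> and \<open>z = 0\<close>. There is no
  measurement noise when \<open>\<kappa> = 0\<close>, since the probability space of a static network need not carry any.\<close>

locale driven_network =
  fixes M :: "'w measure" and L :: nat and F G a :: "int ^ 'd \<Rightarrow> real" and c \<kappa> :: real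
    and w \<eta> :: "(int ^ 'd) \<times> 'd \<Rightarrow> real \<Rightarrow> 'w \<Rightarrow> real"
    and z x v :: "real \<Rightarrow> 'w \<Rightarrow> int ^ 'd \<Rightarrow> real ^ 'd"
  assumes L: "L > 0" and c: "c \<ge> 0"
    and sym_F: "\<And>k. k \<in> torus L \<Longrightarrow> F (tmod L (- k)) = F k"
    and sym_G: "\<And>k. k \<in> torus L \<Longrightarrow> G (tmod L (- k)) = G k"
    and sym_a: "\<And>k. k \<in> torus L \<Longrightarrow> a (tmod L (- k)) = a k"
    and stable: "\<And>n. n \<in> torus L - {0} \<Longrightarrow> eigenvalue L a n < 0"
      "\<And>n. n \<in> torus L - {0} \<Longrightarrow> eigenvalue L F n < 0"
      "\<And>n. n \<in> torus L - {0} \<Longrightarrow> eigenvalue L G n < 0"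
    and noise: "uncorrelated_white_noise M
      ((torus L \<times> UNIV) <+> (if \<kappa> = 0 then {} else torus L \<times> UNIV)) (case_sum w \<eta>)"
    and states: "state_process M L z" "state_process M L x" "state_process M L v"
    and dynamics: "AE \<omega> in M. \<forall>k\<in>torus L. \<forall>t\<ge>0.
        z t \<omega> k = z 0 \<omega> k
          + integral {0..t} (\<lambda>s. conv L a (z s \<omega>) k - c *\<^sub>R v s \<omega> k)
          - \<kappa> *\<^sub>R noise_at \<eta> t \<omega> k \<and>
        x t \<omega> k = x 0 \<omega> k + integral {0..t} (\<lambda>s. v s \<omega> k) \<and>
        v t \<omega> k = v 0 \<omega> k
          + integral {0..t} (\<lambda>s. z s \<omega> k + conv L F (x s \<omega>) k + conv L G (v s \<omega>) k)
          + noise_at w t \<omega> k"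
begin

abbreviation "modes \<equiv> torus L - {0 :: int ^ 'd}"

definition V :: "int ^ 'd \<Rightarrow> real" where
  "V n = mode_variance (- eigenvalue L a n) c \<kappa> (- eigenvalue L F n) (- eigenvalue L G n)"

lemma modal_initial_square_integrable:
  fixes X :: "real \<Rightarrow> 'w \<Rightarrow> int ^ 'd \<Rightarrow> real ^ 'd"
  assumes "state_process M L X"
  shows "square_integrable M (\<lambda>\<omega>. modal L i n (X 0 \<omega>))"
  unfolding modal_def
proof (intro square_integrable_sum square_integrable_cmult)
  fix k :: "int ^ 'd" assume k: "k \<in> torus L"
  then have X: "(\<lambda>\<omega>. X 0 \<omega> k) \<in> borel_measurable M" "integrable M (\<lambda>\<omega>. (norm (X 0 \<omega> k))\<^sup>2)"
    using assms by (auto simp: state_process_def)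
  have meas: "(\<lambda>\<omega>. X 0 \<omega> k $ i) \<in> borel_measurable M"
    by (rule borel_measurable_continuous_on[OF _ X(1)]) (intro continuous_intros)
  have "integrable M (\<lambda>\<omega>. (X 0 \<omega> k $ i)\<^sup>2)"
  proof (rule Bochner_Integration.integrable_bound[OF X(2)])
    show "(\<lambda>\<omega>. (X 0 \<omega> k $ i)\<^sup>2) \<in> borel_measurable M" using meas by (rule borel_measurable_power)
    show "AE \<omega> in M. norm ((X 0 \<omega> k $ i)\<^sup>2) \<le> norm ((norm (X 0 \<omega> k))\<^sup>2)"
      by (rule AE_I2) (simp add: abs_le_square_iff[symmetric] component_le_norm_cart)
  qed
  with meas show "square_integrable M (\<lambda>\<omega>. X 0 \<omega> k $ i)" by (simp add: square_integrable_def)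
qed

definition regular_path :: "'w \<Rightarrow> bool" where
  "regular_path \<omega> \<longleftrightarrow>
     (\<forall>k\<in>torus L. continuous_on {0..} (\<lambda>t. z t \<omega> k) \<and> continuous_on {0..} (\<lambda>t. x t \<omega> k)
     \<and> continuous_on {0..} (\<lambda>t. v t \<omega> k)) \<and>
     (\<forall>k\<in>torus L. \<forall>t\<ge>0.
        z t \<omega> k = z 0 \<omega> k
          + integral {0..t} (\<lambda>s. conv L a (z s \<omega>) k - c *\<^sub>R v s \<omega> k)
          - \<kappa> *\<^sub>R noise_at \<eta> t \<omega> k \<and>
        x t \<omega> k = x 0 \<omega> k + integral {0..t} (\<lambda>s. v s \<omega> k) \<and>
        v t \<omega> k = v 0 \<omega> k
          + integral {0..t} (\<lambda>s. z s \<omega> k + conv L F (x s \<omega>) k + conv L G (v s \<omega>) k)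
          + noise_at w t \<omega> k)"

lemma regular_paths: "AE \<omega> in M. regular_path \<omega>"
proof -
  have "AE \<omega> in M. \<forall>k\<in>torus L. continuous_on {0..} (\<lambda>t. X t \<omega> k)" if "state_process M L X" for X :: "real \<Rightarrow> 'w \<Rightarrow> int ^ 'd \<Rightarrow> real ^ 'd"
    using that by (intro AE_finite_allI) (auto simp: state_process_def)
  from this[OF states(1)] this[OF states(2)] this[OF states(3)] dynamics
  show ?thesis unfolding regular_path_def by eventually_elim blast
qed

lemma modal_dynamics:
  assumes path: "regular_path \<omega>" and t: "t \<ge> 0"
  shows "modal L i n (z t \<omega>) = modal L i n (z 0 \<omega>)
      + integral {0..t} (\<lambda>s. - (- eigenvalue L a n) * modal L i n (z s \<omega>) - c * modal L i n (v s \<omega>))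
      - \<kappa> * (\<Sum>k\<in>torus L. hartley L n k * \<eta> (k, i) t \<omega>)"
    and "modal L i n (x t \<omega>) = modal L i n (x 0 \<omega>) + integral {0..t} (\<lambda>s. modal L i n (v s \<omega>))"
    and "modal L i n (v t \<omega>) = modal L i n (v 0 \<omega>)
      + integral {0..t} (\<lambda>s. modal L i n (z s \<omega>) - (- eigenvalue L F n) * modal L i n (x s \<omega>)
          - (- eigenvalue L G n) * modal L i n (v s \<omega>))
      + (\<Sum>k\<in>torus L. hartley L n k * w (k, i) t \<omega>)"
proof -
  have at_t: "z t \<omega> k = z 0 \<omega> k
          + integral {0..t} (\<lambda>s. conv L a (z s \<omega>) k - c *\<^sub>R v s \<omega> k)
          - \<kappa> *\<^sub>R noise_at \<eta> t \<omega> k"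
    "x t \<omega> k = x 0 \<omega> k + integral {0..t} (\<lambda>s. v s \<omega> k)"
    "v t \<omega> k = v 0 \<omega> k
          + integral {0..t} (\<lambda>s. z s \<omega> k + conv L F (x s \<omega>) k + conv L G (v s \<omega>) k)
          + noise_at w t \<omega> k" if "k \<in> torus L" for k
    using path t that unfolding regular_path_def by blast+
  have C: "continuous_on {0..t} (\<lambda>t. z t \<omega> k)" "continuous_on {0..t} (\<lambda>t. x t \<omega> k)"
    "continuous_on {0..t} (\<lambda>t. v t \<omega> k)" if "k \<in> torus L" for k
    using path that unfolding regular_path_def by (auto intro: continuous_on_subset)
  have Cconv: "continuous_on {0..t} (\<lambda>s. conv L A (X s) k)"
    if "\<And>l. l \<in> torus L \<Longrightarrow> continuous_on {0..t} (\<lambda>s. X s l)"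
    for A :: "int ^ 'd \<Rightarrow> real" and X :: "real \<Rightarrow> int ^ 'd \<Rightarrow> real ^ 'd" and k
    unfolding conv_def using that by (intro continuous_intros)
  have "modal L i n (z t \<omega>) = (\<Sum>k\<in>torus L. hartley L n k * (z 0 \<omega> k
          + integral {0..t} (\<lambda>s. conv L a (z s \<omega>) k - c *\<^sub>R v s \<omega> k)
          - \<kappa> *\<^sub>R noise_at \<eta> t \<omega> k) $ i)"
    unfolding modal_def by (rule sum.cong[OF refl]) (simp only: at_t)
  also have "\<dots> = modal L i n (z 0 \<omega>)
      + (\<Sum>k\<in>torus L. hartley L n k * integral {0..t} (\<lambda>s. conv L a (z s \<omega>) k - c *\<^sub>R v s \<omega> k) $ i)
      - \<kappa> * (\<Sum>k\<in>torus L. hartley L n k * \<eta> (k, i) t \<omega>)"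
    by (simp add: modal_def noise_at_def distrib_left right_diff_distrib sum.distrib sum_subtractf sum_distrib_left mult.left_commute)
  also have "(\<Sum>k\<in>torus L. hartley L n k * integral {0..t} (\<lambda>s. conv L a (z s \<omega>) k - c *\<^sub>R v s \<omega> k) $ i)
      = integral {0..t} (\<lambda>s. \<Sum>k\<in>torus L. hartley L n k * (conv L a (z s \<omega>) k - c *\<^sub>R v s \<omega> k) $ i)"
    by (rule sum_integral_component) (auto intro!: continuous_intros Cconv C)
  also have "(\<lambda>s. \<Sum>k\<in>torus L. hartley L n k * (conv L a (z s \<omega>) k - c *\<^sub>R v s \<omega> k) $ i)
      = (\<lambda>s. - (- eigenvalue L a n) * modal L i n (z s \<omega>) - c * modal L i n (v s \<omega>))"
    using hartley_conv[where a = a, OF L sym_a]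
    by (simp add: modal_def right_diff_distrib sum_subtractf sum_distrib_left mult.left_commute fun_eq_iff)
  finally show "modal L i n (z t \<omega>) = modal L i n (z 0 \<omega>)
      + integral {0..t} (\<lambda>s. - (- eigenvalue L a n) * modal L i n (z s \<omega>) - c * modal L i n (v s \<omega>))
      - \<kappa> * (\<Sum>k\<in>torus L. hartley L n k * \<eta> (k, i) t \<omega>)" .
  have "modal L i n (x t \<omega>) = (\<Sum>k\<in>torus L. hartley L n k * (x 0 \<omega> k + integral {0..t} (\<lambda>s. v s \<omega> k)) $ i)"
    unfolding modal_def by (rule sum.cong[OF refl]) (simp only: at_t)
  also have "\<dots> = modal L i n (x 0 \<omega>) + (\<Sum>k\<in>torus L. hartley L n k * integral {0..t} (\<lambda>s. v s \<omega> k) $ i)"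
    by (simp add: modal_def distrib_left sum.distrib)
  also have "(\<Sum>k\<in>torus L. hartley L n k * integral {0..t} (\<lambda>s. v s \<omega> k) $ i)
      = integral {0..t} (\<lambda>s. \<Sum>k\<in>torus L. hartley L n k * v s \<omega> k $ i)"
    by (rule sum_integral_component) (auto intro!: C)
  finally show "modal L i n (x t \<omega>) = modal L i n (x 0 \<omega>) + integral {0..t} (\<lambda>s. modal L i n (v s \<omega>))"
    by (simp add: modal_def)
  have "modal L i n (v t \<omega>) = (\<Sum>k\<in>torus L. hartley L n k * (v 0 \<omega> k
          + integral {0..t} (\<lambda>s. z s \<omega> k + conv L F (x s \<omega>) k + conv L G (v s \<omega>) k)
          + noise_at w t \<omega> k) $ i)"
    unfolding modal_def by (rule sum.cong[OF refl]) (simp only: at_t)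
  also have "\<dots> = modal L i n (v 0 \<omega>)
      + (\<Sum>k\<in>torus L. hartley L n k * integral {0..t} (\<lambda>s. z s \<omega> k + conv L F (x s \<omega>) k + conv L G (v s \<omega>) k) $ i)
      + (\<Sum>k\<in>torus L. hartley L n k * w (k, i) t \<omega>)"
    by (simp add: modal_def noise_at_def distrib_left sum.distrib)
  also have "(\<Sum>k\<in>torus L. hartley L n k * integral {0..t} (\<lambda>s. z s \<omega> k + conv L F (x s \<omega>) k + conv L G (v s \<omega>) k) $ i)
      = integral {0..t} (\<lambda>s. \<Sum>k\<in>torus L. hartley L n k * (z s \<omega> k + conv L F (x s \<omega>) k + conv L G (v s \<omega>) k) $ i)"
    by (rule sum_integral_component) (auto intro!: continuous_intros Cconv C)
  also have "(\<lambda>s. \<Sum>k\<in>torus L. hartley L n k * (z s \<omega> k + conv L F (x s \<omega>) k + conv L G (v s \<omega>) k) $ i)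
      = (\<lambda>s. modal L i n (z s \<omega>) - (- eigenvalue L F n) * modal L i n (x s \<omega>)
          - (- eigenvalue L G n) * modal L i n (v s \<omega>))"
    using hartley_conv[where a = F, OF L sym_F] hartley_conv[where a = G, OF L sym_G]
    by (simp add: modal_def distrib_left sum.distrib)
  finally show "modal L i n (v t \<omega>) = modal L i n (v 0 \<omega>)
      + integral {0..t} (\<lambda>s. modal L i n (z s \<omega>) - (- eigenvalue L F n) * modal L i n (x s \<omega>)
          - (- eigenvalue L G n) * modal L i n (v s \<omega>))
      + (\<Sum>k\<in>torus L. hartley L n k * w (k, i) t \<omega>)" .
qed

lemma modal_continuous:
  assumes "\<forall>k\<in>torus L. continuous_on {0..} (\<lambda>t. X t \<omega> k)"
  shows "continuous_on {0..} (\<lambda>t. modal L i n (X t \<omega>))"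
  unfolding modal_def using assms by (intro continuous_intros) auto

definition noise_index :: "(int ^ 'd + int ^ 'd) set" where
  "noise_index = modes <+> (if \<kappa> = 0 then {} else modes)"

lemma sum_noise_index:
  assumes "\<kappa> = 0 \<Longrightarrow> \<forall>n. f (Inr n) = 0"
  shows "(\<Sum>p\<in>noise_index. f p) = (\<Sum>n\<in>modes. f (Inl n) + f (Inr n))"
  unfolding noise_index_def by (cases "\<kappa> = 0") (simp_all add: sum.Plus sum.distrib assms)

definition modal_noise :: "'d \<Rightarrow> (int ^ 'd + int ^ 'd) \<Rightarrow> real \<Rightarrow> 'w \<Rightarrow> real" where
  "modal_noise i p t \<omega> = (case p of Inl n \<Rightarrow> \<Sum>k\<in>torus L. hartley L n k * w (k, i) t \<omega>
     | Inr n \<Rightarrow> \<Sum>k\<in>torus L. hartley L n k * \<eta> (k, i) t \<omega>)"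

text \<open>The coordinate \<open>i\<close> of the node noises, expanded in the orthonormal Hartley basis.\<close>

lemma modal_noise_white: "uncorrelated_white_noise M noise_index (modal_noise i)"
proof -
  let ?J = "(torus L \<times> (UNIV :: 'd set)) <+> (if \<kappa> = 0 then {} else torus L \<times> (UNIV :: 'd set))"
  define u where "u = (\<lambda>n (q :: (int ^ 'd) \<times> 'd). if snd q = i then hartley L n (fst q) else 0)"
  define U where "U = (\<lambda>p q. case p of Inl n \<Rightarrow> case_sum (u n) (\<lambda>_. 0) q | Inr n \<Rightarrow> case_sum (\<lambda>_. 0) (u n) q)"
  have fin: "finite ?J" by simp
  have ortho: "(\<Sum>q\<in>torus L \<times> UNIV. u n q * u m q) = (if n = m then 1 else 0)" if "n \<in> modes" "m \<in> modes" for n m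
  proof -
    have "u n q * u m q = (if snd q = i then hartley L n (fst q) * hartley L m (fst q) else 0)" for q
      by (simp add: u_def)
    then show ?thesis
      using that by (simp add: sum_one_coordinate[where h = "\<lambda>k. hartley L n k * hartley L m k"] hartley_orthonormal[OF L])
  qed
  have apply_u: "(\<Sum>q\<in>torus L \<times> UNIV. u n q * y q) = (\<Sum>k\<in>torus L. hartley L n k * y (k, i))" for n and y :: "(int ^ 'd) \<times> 'd \<Rightarrow> real"
  proof -
    have "u n q * y q = (if snd q = i then hartley L n (fst q) * y (fst q, i) else 0)" for q
      by (cases q) (simp add: u_def)
    then show ?thesis by (simp add: sum_one_coordinate[where h = "\<lambda>k. hartley L n k * y (k, i)"])
  qed
  have "(\<Sum>q\<in>?J. U p q * U p' q) = (if p = p' then 1 else 0)" if "p \<in> noise_index" "p' \<in> noise_index" for p p'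
    using that unfolding noise_index_def
    by (cases p; cases p') (auto simp: sum.Plus U_def ortho split: if_splits)
  from white_noise_orthogonal_transform[OF noise fin this]
  have white: "uncorrelated_white_noise M noise_index (\<lambda>p t \<omega>. \<Sum>q\<in>?J. U p q * case_sum w \<eta> q t \<omega>)" .
  have "(\<Sum>q\<in>?J. U p q * case_sum w \<eta> q t \<omega>) = modal_noise i p t \<omega>" if "p \<in> noise_index" for p t \<omega>
    using that unfolding noise_index_def modal_noise_def
    by (cases p) (auto simp: sum.Plus U_def apply_u[of _ "\<lambda>q. w q t \<omega>"] apply_u[of _ "\<lambda>q. \<eta> q t \<omega>"] split: if_splits)
  with white show ?thesis by (simp add: uncorrelated_white_noise_def)
qed

text \<open>A functional that annihilates constants does not see the mode \<open>n = 0\<close>, the only one that is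
  not stable. On the other modes it is the sum of a decaying function of the initial state and of a Wiener
  integral, whose kernels belong to different noises for different modes, so that their energies add up.\<close>

theorem second_moment_limit:
  assumes b: "(\<Sum>k\<in>torus L. b k) = 0"
  shows "\<And>t. t \<ge> 0 \<Longrightarrow> square_integrable M (\<lambda>\<omega>. \<Sum>k\<in>torus L. b k * x t \<omega> k $ i)"
    and "((\<lambda>t. \<integral>\<omega>. (\<Sum>k\<in>torus L. b k * x t \<omega> k $ i)\<^sup>2 \<partial>M) \<longlongrightarrow>
      (\<Sum>n\<in>modes. (\<Sum>k\<in>torus L. b k * hartley L n k)\<^sup>2 * V n)) at_top"
proof -
  define B where "B = (\<lambda>n. \<Sum>k\<in>torus L. b k * hartley L n k)"
  have B0: "B 0 = 0"
    using b by (simp add: B_def hartley_def sum_divide_distrib[symmetric])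
  have y_modal: "(\<Sum>k\<in>torus L. b k * X k $ i) = (\<Sum>n\<in>modes. B n * modal L i n X)" for X :: "int ^ 'd \<Rightarrow> real ^ 'd"
  proof -
    have "(\<Sum>k\<in>torus L. b k * X k $ i) = (\<Sum>n\<in>torus L. B n * modal L i n X)"
      unfolding B_def modal_def by (rule hartley_expansion[OF L])
    also have "\<dots> = (\<Sum>n\<in>modes. B n * modal L i n X)"
      by (rule sum.mono_neutral_right) (auto simp: B0)
    finally show ?thesis .
  qed
  have "\<forall>n\<in>modes. \<exists>\<xi>z \<xi>x \<xi>v Q. mode_kernel (- eigenvalue L a n) c \<kappa> (- eigenvalue L F n) (- eigenvalue L G n) (V n) \<xi>z \<xi>x \<xi>v Q"
    unfolding V_def using stable c by (intro ballI mode_kernel_exists) auto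
  then obtain \<xi>z \<xi>x \<xi>v Q where K: "\<And>n. n \<in> modes \<Longrightarrow>
      mode_kernel (- eigenvalue L a n) c \<kappa> (- eigenvalue L F n) (- eigenvalue L G n) (V n) (\<xi>z n) (\<xi>x n) (\<xi>v n) (Q n)"
    by metis
  define Y where "Y = (\<lambda>t \<omega>. \<Sum>k\<in>torus L. b k * x t \<omega> k $ i)"
  define Init where "Init = (\<lambda>t \<omega>. \<Sum>n\<in>modes. \<xi>z n t * (B n * modal L i n (z 0 \<omega>))
      + \<xi>x n t * (B n * modal L i n (x 0 \<omega>)) + \<xi>v n t * (B n * modal L i n (v 0 \<omega>)))"
  note init_sq = modal_initial_square_integrable[OF states(1)]
    modal_initial_square_integrable[OF states(2)] modal_initial_square_integrable[OF states(3)]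
  have term_sq: "square_integrable M (\<lambda>\<omega>. \<xi>z n t * (B n * modal L i n (z 0 \<omega>))
      + \<xi>x n t * (B n * modal L i n (x 0 \<omega>)) + \<xi>v n t * (B n * modal L i n (v 0 \<omega>)))" for n t
    by (intro square_integrable_add square_integrable_cmult init_sq)
  have Init_sq: "square_integrable M (Init t)" for t
    unfolding Init_def by (intro square_integrable_sum term_sq)
  have Init_null: "((\<lambda>t. \<integral>\<omega>. (Init t \<omega>)\<^sup>2 \<partial>M) \<longlongrightarrow> 0) at_top"
    unfolding Init_def
  proof (rule second_moment_null_sum)
    fix n assume n: "n \<in> modes"
    have \<xi>0: "(\<xi>z n \<longlongrightarrow> 0) at_top" "(\<xi>x n \<longlongrightarrow> 0) at_top" "(\<xi>v n \<longlongrightarrow> 0) at_top"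
      using K[OF n] unfolding mode_kernel_def by blast+
    show "((\<lambda>t. \<integral>\<omega>. (\<xi>z n t * (B n * modal L i n (z 0 \<omega>)) + \<xi>x n t * (B n * modal L i n (x 0 \<omega>))
        + \<xi>v n t * (B n * modal L i n (v 0 \<omega>)))\<^sup>2 \<partial>M) \<longlongrightarrow> 0) at_top"
      by (intro second_moment_null_add second_moment_null_scale square_integrable_add
          square_integrable_cmult init_sq \<xi>0)
  qed (auto intro: term_sq)
  have response: "square_integrable M (\<lambda>\<omega>. Y T \<omega> - Init T \<omega>)"
    "(\<integral>\<omega>. (Y T \<omega> - Init T \<omega>)\<^sup>2 \<partial>M) = (\<Sum>n\<in>modes. (B n)\<^sup>2 * Q n T)" if T: "T \<ge> 0" for T
  proof -
    \<comment> \<open>the kernels with which the noise of each mode acts on the functional at time \<open>T\<close>\<close>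
    define k where "k = (\<lambda>p t. case p of Inl n \<Rightarrow> B n * \<xi>v n (T - t) | Inr n \<Rightarrow> B n * (- \<kappa> * \<xi>z n (T - t)))"
    have DK: "(\<xi>z n has_real_derivative - (- eigenvalue L a n) * \<xi>z n t + \<xi>v n t) (at t)"
      "(\<xi>v n has_real_derivative - c * \<xi>z n t + \<xi>x n t - (- eigenvalue L G n) * \<xi>v n t) (at t)"
      "(Q n has_real_derivative (\<xi>v n t)\<^sup>2 + (\<kappa> * \<xi>z n t)\<^sup>2) (at t)" if "n \<in> modes" for n t
      using K[OF that] unfolding mode_kernel_def by blast+
    have cont_\<xi>: "continuous_on UNIV (\<xi>z n)" "continuous_on UNIV (\<xi>v n)" if "n \<in> modes" for n
      by (rule DERIV_continuous_on[OF has_field_derivative_at_within[OF DK(1)[OF that]]],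
          rule DERIV_continuous_on[OF has_field_derivative_at_within[OF DK(2)[OF that]]])
    have k_cont: "continuous_on {0..T} (k p)" if p: "p \<in> noise_index" for p
    proof -
      obtain n where n: "n \<in> modes" and p_cases: "p = Inl n \<or> p = Inr n"
        using p unfolding noise_index_def by (auto split: if_splits)
      have "continuous_on {0..T} (\<lambda>t. B n * \<xi>v n (T - t))" "continuous_on {0..T} (\<lambda>t. B n * (- \<kappa> * \<xi>z n (T - t)))"
        by (intro continuous_on_mult continuous_on_const continuous_on_compose2[OF cont_\<xi>(1)[OF n]]
            continuous_on_compose2[OF cont_\<xi>(2)[OF n]] continuous_on_diff continuous_on_id subset_UNIV)+
      with p_cases show ?thesis by (auto simp: k_def)
    qed
    define E where "E = (\<lambda>t. - (\<Sum>n\<in>modes. (B n)\<^sup>2 * Q n (T - t)))"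
    have E: "(E has_real_derivative (\<Sum>p\<in>noise_index. (k p t)\<^sup>2)) (at t within {0..T})" for t
    proof -
      have "((\<lambda>t. Q n (T - t)) has_real_derivative - ((\<xi>v n (T - t))\<^sup>2 + (\<kappa> * \<xi>z n (T - t))\<^sup>2)) (at t within {0..T})"
        if "n \<in> modes" for n
      proof -
        have "((\<lambda>t. T - t) has_real_derivative - 1) (at t within {0..T})"
          by (auto intro!: derivative_eq_intros)
        from DERIV_chain2[where f = "Q n" and g = "\<lambda>t. T - t", OF DK(3)[OF that] this] show ?thesis by simp
      qed
      then have "(E has_real_derivative - (\<Sum>n\<in>modes. (B n)\<^sup>2 * - ((\<xi>v n (T - t))\<^sup>2 + (\<kappa> * \<xi>z n (T - t))\<^sup>2))) (at t within {0..T})"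
        unfolding E_def by (intro DERIV_minus DERIV_sum DERIV_cmult)
      moreover have "- (\<Sum>n\<in>modes. (B n)\<^sup>2 * - ((\<xi>v n (T - t))\<^sup>2 + (\<kappa> * \<xi>z n (T - t))\<^sup>2)) = (\<Sum>p\<in>noise_index. (k p t)\<^sup>2)"
        unfolding sum_negf[symmetric]
        by (subst sum_noise_index) (simp_all add: k_def power_mult_distrib distrib_left right_diff_distrib add.commute)
      ultimately show ?thesis by simp
    qed
    have "AE \<omega> in M. (\<lambda>m. \<Sum>p\<in>noise_index. \<Sum>j<m. k p (real j * T / real m)
        * increment (\<lambda>t. modal_noise i p t \<omega>) T m j) \<longlonglongrightarrow> Y T \<omega> - Init T \<omega>"
      using regular_paths
    proof eventually_elim
      case (elim \<omega>)
      define wh \<eta>h where "wh = (\<lambda>n t. \<Sum>k\<in>torus L. hartley L n k * w (k, i) t \<omega>)"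
        and "\<eta>h = (\<lambda>n t. \<Sum>k\<in>torus L. hartley L n k * \<eta> (k, i) t \<omega>)"
      note dyn = modal_dynamics[OF elim]
      have rep: "(\<lambda>m. \<Sum>j<m. \<xi>v n (T - real j * T / real m) * increment (wh n) T m j
          - \<kappa> * \<xi>z n (T - real j * T / real m) * increment (\<eta>h n) T m j)
        \<longlonglongrightarrow> modal L i n (x T \<omega>) - (\<xi>z n T * modal L i n (z 0 \<omega>) + \<xi>x n T * modal L i n (x 0 \<omega>) + \<xi>v n T * modal L i n (v 0 \<omega>))"
        if "n \<in> modes" for n
        by (rule mode_path_representation[OF K[OF that] T])
           (unfold wh_def \<eta>h_def, (rule modal_continuous dyn | (use elim in \<open>unfold regular_path_def, blast\<close>) | assumption)+)
      have "(\<lambda>m. \<Sum>n\<in>modes. B n * (\<Sum>j<m. \<xi>v n (T - real j * T / real m) * increment (wh n) T m j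
          - \<kappa> * \<xi>z n (T - real j * T / real m) * increment (\<eta>h n) T m j))
        \<longlonglongrightarrow> (\<Sum>n\<in>modes. B n * (modal L i n (x T \<omega>) - (\<xi>z n T * modal L i n (z 0 \<omega>) + \<xi>x n T * modal L i n (x 0 \<omega>) + \<xi>v n T * modal L i n (v 0 \<omega>))))"
        by (intro tendsto_sum tendsto_mult tendsto_const rep)
      also have "(\<Sum>n\<in>modes. B n * (modal L i n (x T \<omega>) - (\<xi>z n T * modal L i n (z 0 \<omega>) + \<xi>x n T * modal L i n (x 0 \<omega>) + \<xi>v n T * modal L i n (v 0 \<omega>))))
          = Y T \<omega> - Init T \<omega>"
        unfolding Y_def y_modal Init_def sum_subtractf[symmetric]
        by (intro sum.cong refl) (simp add: algebra_simps)
      also have "(\<lambda>m. \<Sum>n\<in>modes. B n * (\<Sum>j<m. \<xi>v n (T - real j * T / real m) * increment (wh n) T m j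
          - \<kappa> * \<xi>z n (T - real j * T / real m) * increment (\<eta>h n) T m j))
        = (\<lambda>m. \<Sum>p\<in>noise_index. \<Sum>j<m. k p (real j * T / real m) * increment (\<lambda>t. modal_noise i p t \<omega>) T m j)"
        unfolding wh_def \<eta>h_def
        by (rule ext, subst sum_noise_index) (simp_all add: k_def modal_noise_def
            sum_subtractf sum_distrib_left right_diff_distrib sum_negf mult.assoc)
      finally show ?case .
    qed
    moreover have "(\<lambda>\<omega>. Y T \<omega> - Init T \<omega>) \<in> borel_measurable M"
    proof -
      have "(\<lambda>\<omega>. x T \<omega> k $ i) \<in> borel_measurable M" if "k \<in> torus L" for k
        using states(2) that T by (intro borel_measurable_continuous_on[where f = "\<lambda>y. y $ i"] continuous_intros)
          (auto simp: state_process_def)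
      then have "Y T \<in> borel_measurable M" unfolding Y_def by simp
      then show ?thesis using Init_sq[of T] by (auto simp: square_integrable_def intro!: borel_measurable_diff)
    qed
    moreover have "finite noise_index" by (simp add: noise_index_def)
    ultimately show "square_integrable M (\<lambda>\<omega>. Y T \<omega> - Init T \<omega>)"
      and "(\<integral>\<omega>. (Y T \<omega> - Init T \<omega>)\<^sup>2 \<partial>M) = (\<Sum>n\<in>modes. (B n)\<^sup>2 * Q n T)"
    proof -
      assume *: "AE \<omega> in M. (\<lambda>m. \<Sum>p\<in>noise_index. \<Sum>j<m. k p (real j * T / real m)
        * increment (\<lambda>t. modal_noise i p t \<omega>) T m j) \<longlonglongrightarrow> Y T \<omega> - Init T \<omega>"
        "(\<lambda>\<omega>. Y T \<omega> - Init T \<omega>) \<in> borel_measurable M" "finite noise_index"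
      note iso = wiener_isometry[OF modal_noise_white *(3) T k_cont E *(2) *(1)]
      show "square_integrable M (\<lambda>\<omega>. Y T \<omega> - Init T \<omega>)" by (rule iso(1))
      have "Q n 0 = 0" if "n \<in> modes" for n using K[OF that] by (simp add: mode_kernel_def)
      then show "(\<integral>\<omega>. (Y T \<omega> - Init T \<omega>)\<^sup>2 \<partial>M) = (\<Sum>n\<in>modes. (B n)\<^sup>2 * Q n T)"
        using iso(2) by (simp add: E_def)
    qed
  qed
  show sq: "square_integrable M (\<lambda>\<omega>. \<Sum>k\<in>torus L. b k * x t \<omega> k $ i)" if "t \<ge> 0" for t
    using square_integrable_add[OF response(1)[OF that] Init_sq[of t]] by (simp add: Y_def)
  \<comment> \<open>nothing is known at negative times, hence the truncation by \<open>max t 0\<close>\<close>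
  have "((\<lambda>t. \<integral>\<omega>. (Y (max t 0) \<omega>)\<^sup>2 \<partial>M) \<longlongrightarrow> (\<Sum>n\<in>modes. (B n)\<^sup>2 * V n)) at_top"
  proof (rule second_moment_tendsto[where Y = "\<lambda>t \<omega>. Y (max t 0) \<omega> - Init (max t 0) \<omega>"])
    show "square_integrable M (Y (max t 0))" for t
      using sq[of "max t 0"] by (simp add: Y_def)
    show "square_integrable M (\<lambda>\<omega>. Y (max t 0) \<omega> - Init (max t 0) \<omega>)" for t
      by (rule response(1)) simp
    have max_lim: "filterlim (\<lambda>t::real. max t 0) at_top at_top"
      by (rule filterlim_at_top_mono[OF filterlim_ident]) auto
    show "((\<lambda>t. \<integral>\<omega>. (Y (max t 0) \<omega> - (Y (max t 0) \<omega> - Init (max t 0) \<omega>))\<^sup>2 \<partial>M) \<longlongrightarrow> 0) at_top"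
      using filterlim_compose[OF Init_null max_lim] by simp
    have "((\<lambda>t. \<Sum>n\<in>modes. (B n)\<^sup>2 * Q n t) \<longlongrightarrow> (\<Sum>n\<in>modes. (B n)\<^sup>2 * V n)) at_top"
      using K by (intro tendsto_sum tendsto_mult tendsto_const) (auto simp: mode_kernel_def)
    from filterlim_compose[OF this max_lim]
    show "((\<lambda>t. \<integral>\<omega>. (Y (max t 0) \<omega> - Init (max t 0) \<omega>)\<^sup>2 \<partial>M) \<longlongrightarrow> (\<Sum>n\<in>modes. (B n)\<^sup>2 * V n)) at_top"
      by (simp add: response(2))
  qed
  then show "((\<lambda>t. \<integral>\<omega>. (\<Sum>k\<in>torus L. b k * x t \<omega> k $ i)\<^sup>2 \<partial>M) \<longlongrightarrow>
      (\<Sum>n\<in>modes. (\<Sum>k\<in>torus L. b k * hartley L n k)\<^sup>2 * V n)) at_top"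
    unfolding B_def Y_def
    by (rule Lim_transform_eventually) (auto intro: eventually_mono[OF eventually_ge_at_top[of 0]])
qed

end

section \<open>The per-site variance as a sum over modes\<close>

lemma tmod_uminus_nonzero:
  assumes "n \<in> torus L" "n \<noteq> 0"
  shows "tmod L (- n) \<noteq> 0"
proof
  assume "tmod L (- n) = 0"
  then have "tmod L (- tmod L (- n)) = 0" by (simp add: tmod_def vec_eq_iff)
  then show False using assms tmod_simps(5)[of L "- n"] by (simp add: tmod_torus)
qed

lemma sum_modes_reflect:
  assumes L: "L > 0"
  shows "(\<Sum>n\<in>torus L - {0}. h (tmod L (- n))) = (\<Sum>n\<in>torus L - {0}. h n)"
  by (rule sum.reindex_bij_witness[of _ "\<lambda>n. tmod L (- n)" "\<lambda>n. tmod L (- n)"])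
     (use L in \<open>auto simp: tmod_simps tmod_in_torus tmod_torus tmod_uminus_nonzero\<close>)

lemma cos_sin_phase_reflect:
  assumes L: "L > 0"
  shows "cos (phase L (tmod L (- n)) k) = cos (phase L n k)" "sin (phase L (tmod L (- n)) k) = - sin (phase L n k)"
  by (simp_all add: phase_commute[of L _ k] cos_sin_phase_tmod[OF L] phase_minus)

lemma eigenvalue_reflect: "L > 0 \<Longrightarrow> eigenvalue L a (tmod L (- n)) = eigenvalue L a n"
  by (simp add: eigenvalue_def cos_sin_phase_reflect)

text \<open>A single Hartley coefficient depends on the site, but the squares at \<open>n\<close> and \<open>- n\<close> add up to
  twice the squared modulus of the Fourier coefficient. This is why the variance is the same at all sites.\<close>

lemma hartley_energy:
  fixes U :: "int ^ 'd \<Rightarrow> real"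
  assumes L: "L > 0" and U: "\<And>n. n \<in> torus L \<Longrightarrow> U (tmod L (- n)) = U n"
  shows "(\<Sum>n\<in>torus L - {0}. (\<Sum>k\<in>torus L. b k * hartley L n k)\<^sup>2 * U n)
    = (\<Sum>n\<in>torus L - {0}. ((\<Sum>k\<in>torus L. b k * cos (phase L n k))\<^sup>2 + (\<Sum>k\<in>torus L. b k * sin (phase L n k))\<^sup>2) * U n)
      / real (L ^ CARD('d))"
proof -
  define N where "N = real (L ^ CARD('d))"
  have N: "N > 0" using L by (simp add: N_def)
  define C S where "C = (\<lambda>n. \<Sum>k\<in>torus L. b k * cos (phase L n k))" and "S = (\<lambda>n. \<Sum>k\<in>torus L. b k * sin (phase L n k))"
  have B: "(\<Sum>k\<in>torus L. b k * hartley L n k) = (C n + S n) / sqrt N" for n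
    by (simp add: C_def S_def N_def hartley_def sum_divide_distrib[symmetric] distrib_left sum.distrib)
  have CS: "C (tmod L (- n)) = C n" "S (tmod L (- n)) = - S n" for n
    by (simp_all add: C_def S_def cos_sin_phase_reflect[OF L] sum_negf)
  have "2 * (\<Sum>n\<in>torus L - {0}. ((C n + S n) / sqrt N)\<^sup>2 * U n)
      = (\<Sum>n\<in>torus L - {0}. ((C n + S n) / sqrt N)\<^sup>2 * U n)
        + (\<Sum>n\<in>torus L - {0}. ((C (tmod L (- n)) + S (tmod L (- n))) / sqrt N)\<^sup>2 * U (tmod L (- n)))"
    by (subst sum_modes_reflect[OF L, of "\<lambda>n. ((C n + S n) / sqrt N)\<^sup>2 * U n"]) simp
  also have "\<dots> = (\<Sum>n\<in>torus L - {0}. ((C n + S n) / sqrt N)\<^sup>2 * U n + ((C n - S n) / sqrt N)\<^sup>2 * U n)"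
    by (simp add: sum.distrib CS U)
  also have "\<dots> = (\<Sum>n\<in>torus L - {0}. 2 * ((((C n)\<^sup>2 + (S n)\<^sup>2) * U n) / N))"
  proof (rule sum.cong[OF refl])
    fix n
    have "((C n + S n) / sqrt N)\<^sup>2 = (C n + S n)\<^sup>2 / N" "((C n - S n) / sqrt N)\<^sup>2 = (C n - S n)\<^sup>2 / N"
      using N by (simp_all add: power_divide)
    then show "((C n + S n) / sqrt N)\<^sup>2 * U n + ((C n - S n) / sqrt N)\<^sup>2 * U n = 2 * ((((C n)\<^sup>2 + (S n)\<^sup>2) * U n) / N)"
      using N by (simp add: power2_sum power2_diff field_simps)
  qed
  also have "\<dots> = 2 * ((\<Sum>n\<in>torus L - {0}. ((C n)\<^sup>2 + (S n)\<^sup>2) * U n) / N)"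
    by (simp add: sum_distrib_left sum_divide_distrib)
  finally show ?thesis by (simp add: B C_def S_def N_def)
qed

definition global_variance :: "nat \<Rightarrow> (int ^ 'd \<Rightarrow> real) \<Rightarrow> real" where
  "global_variance L U = real CARD('d) * ((\<Sum>n\<in>torus L - {0}. U n) / real (L ^ CARD('d)))"

definition local_symbol :: "nat \<Rightarrow> int ^ 'd \<Rightarrow> real" where
  "local_symbol L n = (\<Sum>j\<in>UNIV. 2 * (1 - cos (phase L n (axis j 1))))"

definition local_variance :: "nat \<Rightarrow> (int ^ 'd \<Rightarrow> real) \<Rightarrow> real" where
  "local_variance L U = real CARD('d) *
     ((\<Sum>n\<in>torus L - {0}. local_symbol L n * U n) / real (L ^ CARD('d)))"

context driven_network
begin

lemma V_reflect: "V (tmod L (- n)) = V n"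
  by (simp add: V_def eigenvalue_reflect[OF L])

lemma functional_variance:
  assumes b: "(\<Sum>k\<in>torus L. b k) = 0"
  shows "((\<lambda>t. \<integral>\<omega>. (\<Sum>k\<in>torus L. b k * x t \<omega> k $ i)\<^sup>2 \<partial>M) \<longlongrightarrow>
    (\<Sum>n\<in>modes. ((\<Sum>k\<in>torus L. b k * cos (phase L n k))\<^sup>2 + (\<Sum>k\<in>torus L. b k * sin (phase L n k))\<^sup>2) * V n)
      / real (L ^ CARD('d))) at_top"
  using second_moment_limit(2)[OF b, of i] unfolding hartley_energy[where U = V, OF L V_reflect] .

lemma global_per_site_variance: "per_site_variance M L (global_error L) x (global_variance L V)"
  unfolding per_site_variance_def
proof (intro ballI conjI allI impI)
  fix k :: "int ^ 'd" assume k: "k \<in> torus L"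
  define N where "N = real (L ^ CARD('d))"
  have N: "N > 0" using L by (simp add: N_def)
  define b where "b = (\<lambda>l. (if l = k then 1 else 0) - 1 / N)"
  have b_sum: "(\<Sum>l\<in>torus L. b l * y l) = y k - (\<Sum>l\<in>torus L. y l) / N" for y
  proof -
    have "(\<Sum>l\<in>torus L. b l * y l) = (\<Sum>l\<in>torus L. (if l = k then y k else 0) - y l / N)"
      by (rule sum.cong) (auto simp: b_def left_diff_distrib)
    then show ?thesis using k by (simp add: sum_subtractf sum_divide_distrib)
  qed
  have b0: "(\<Sum>l\<in>torus L. b l) = 0"
    using b_sum[of "\<lambda>_. 1"] N card_torus[where 'd = 'd, of L] by (simp add: N_def)
  have comp: "global_error L X k $ i = (\<Sum>l\<in>torus L. b l * X l $ i)" for X :: "int ^ 'd \<Rightarrow> real ^ 'd" and i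
    by (simp add: b_sum global_error_def N_def)
  have inner: "global_error L X k \<bullet> global_error L X k = (\<Sum>i\<in>UNIV. (\<Sum>l\<in>torus L. b l * X l $ i)\<^sup>2)" for X :: "int ^ 'd \<Rightarrow> real ^ 'd"
    by (simp add: inner_vec_def comp power2_eq_square)
  have int: "integrable M (\<lambda>\<omega>. (\<Sum>l\<in>torus L. b l * x t \<omega> l $ i)\<^sup>2)" if "t \<ge> 0" for t i
    using second_moment_limit(1)[OF b0 that] by (simp add: square_integrable_def)
  then show "integrable M (\<lambda>\<omega>. global_error L (x t \<omega>) k \<bullet> global_error L (x t \<omega>) k)" if "t \<ge> 0" for t
    unfolding inner using that by (intro Bochner_Integration.integrable_sum)
  have "((\<lambda>t. \<Sum>i\<in>UNIV. \<integral>\<omega>. (\<Sum>l\<in>torus L. b l * x t \<omega> l $ i)\<^sup>2 \<partial>M) \<longlongrightarrow>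
    (\<Sum>i\<in>(UNIV :: 'd set). (\<Sum>n\<in>modes. ((\<Sum>l\<in>torus L. b l * cos (phase L n l))\<^sup>2 + (\<Sum>l\<in>torus L. b l * sin (phase L n l))\<^sup>2) * V n)
      / real (L ^ CARD('d)))) at_top"
    by (intro tendsto_sum functional_variance b0)
  also have "(\<Sum>i\<in>(UNIV :: 'd set). (\<Sum>n\<in>modes. ((\<Sum>l\<in>torus L. b l * cos (phase L n l))\<^sup>2 + (\<Sum>l\<in>torus L. b l * sin (phase L n l))\<^sup>2) * V n)
      / real (L ^ CARD('d))) = global_variance L V"
  proof -
    have "(\<Sum>l\<in>torus L. b l * cos (phase L n l))\<^sup>2 + (\<Sum>l\<in>torus L. b l * sin (phase L n l))\<^sup>2 = 1"
      if n: "n \<in> modes" for n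
    proof -
      obtain i where "\<not> int L dvd n $ i" using n by (rule not_dvd_mode)
      from trig_sums_vanish[OF L this] show ?thesis by (simp add: b_sum)
    qed
    then show ?thesis by (simp add: global_variance_def)
  qed
  finally show "((\<lambda>t. \<integral>\<omega>. global_error L (x t \<omega>) k \<bullet> global_error L (x t \<omega>) k \<partial>M) \<longlongrightarrow> global_variance L V) at_top"
    unfolding inner
    by (rule Lim_transform_eventually)
       (use int in \<open>auto intro!: eventually_mono[OF eventually_ge_at_top[of 0]] simp: Bochner_Integration.integral_sum\<close>)
qed

lemma local_per_site_variance: "per_site_variance M L (local_error L) x (local_variance L V)"
  unfolding per_site_variance_def
proof (intro ballI conjI allI impI)
  fix k :: "int ^ 'd" assume k: "k \<in> torus L"
  define k' where "k' = (\<lambda>j. tmod L (k - axis j 1))"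
  have k': "k' j \<in> torus L" for j by (simp add: k'_def tmod_in_torus[OF L])
  define b where "b = (\<lambda>j l. (if l = k then 1 else 0) - (if l = k' j then 1 else 0 :: real))"
  have b_sum: "(\<Sum>l\<in>torus L. b j l * y l) = y k - y (k' j)" for j y
  proof -
    have "(\<Sum>l\<in>torus L. b j l * y l) = (\<Sum>l\<in>torus L. (if l = k then y k else 0) - (if l = k' j then y (k' j) else 0))"
      by (rule sum.cong) (auto simp: b_def)
    then show ?thesis using k k' by (simp add: sum_subtractf)
  qed
  have b0: "(\<Sum>l\<in>torus L. b j l) = 0" for j
    using b_sum[of j "\<lambda>_. 1"] by simp
  have inner: "local_error L X k \<bullet> local_error L X k = (\<Sum>j\<in>UNIV. \<Sum>i\<in>UNIV. (\<Sum>l\<in>torus L. b j l * X l $ i)\<^sup>2)" for X :: "int ^ 'd \<Rightarrow> real ^ 'd"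
    by (simp add: inner_vec_def b_sum local_error_def k'_def power2_eq_square)
  have int: "integrable M (\<lambda>\<omega>. (\<Sum>l\<in>torus L. b j l * x t \<omega> l $ i)\<^sup>2)" if "t \<ge> 0" for t i j
    using second_moment_limit(1)[OF b0 that] by (simp add: square_integrable_def)
  then show "integrable M (\<lambda>\<omega>. local_error L (x t \<omega>) k \<bullet> local_error L (x t \<omega>) k)" if "t \<ge> 0" for t
    unfolding inner using that by (intro Bochner_Integration.integrable_sum)
  have "((\<lambda>t. \<Sum>j\<in>UNIV. \<Sum>i\<in>UNIV. \<integral>\<omega>. (\<Sum>l\<in>torus L. b j l * x t \<omega> l $ i)\<^sup>2 \<partial>M) \<longlongrightarrow>
    (\<Sum>j\<in>UNIV. \<Sum>i\<in>(UNIV :: 'd set). (\<Sum>n\<in>modes. ((\<Sum>l\<in>torus L. b j l * cos (phase L n l))\<^sup>2 + (\<Sum>l\<in>torus L. b j l * sin (phase L n l))\<^sup>2) * V n)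
      / real (L ^ CARD('d)))) at_top"
    by (intro tendsto_sum functional_variance b0)
  also have "(\<Sum>j\<in>UNIV. \<Sum>i\<in>(UNIV :: 'd set). (\<Sum>n\<in>modes. ((\<Sum>l\<in>torus L. b j l * cos (phase L n l))\<^sup>2 + (\<Sum>l\<in>torus L. b j l * sin (phase L n l))\<^sup>2) * V n)
      / real (L ^ CARD('d))) = local_variance L V"
  proof -
    have "(\<Sum>l\<in>torus L. b j l * cos (phase L n l))\<^sup>2 + (\<Sum>l\<in>torus L. b j l * sin (phase L n l))\<^sup>2
        = 2 * (1 - cos (phase L n (axis j 1)))" for n j
    proof -
      define \<alpha> \<beta> where "\<alpha> = phase L n k" and "\<beta> = phase L n k - phase L n (axis j 1)"
      have "(cos \<alpha> - cos \<beta>)\<^sup>2 + (sin \<alpha> - sin \<beta>)\<^sup>2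
          = ((sin \<alpha>)\<^sup>2 + (cos \<alpha>)\<^sup>2) + ((sin \<beta>)\<^sup>2 + (cos \<beta>)\<^sup>2) - 2 * cos (\<alpha> - \<beta>)"
        unfolding cos_diff power2_diff by (simp only: distrib_left)
      also have "\<dots> = 2 * (1 - cos (phase L n (axis j 1)))"
        by (simp add: \<alpha>_def \<beta>_def)
      finally show ?thesis
        by (simp add: b_sum k'_def cos_sin_phase_tmod[OF L] phase_diff \<alpha>_def \<beta>_def)
    qed
    then show ?thesis
      by (simp add: local_variance_def local_symbol_def sum_distrib_left[symmetric] sum_divide_distrib[symmetric])
         (subst sum.swap, simp add: sum_distrib_right)
  qed
  finally show "((\<lambda>t. \<integral>\<omega>. local_error L (x t \<omega>) k \<bullet> local_error L (x t \<omega>) k \<partial>M) \<longlongrightarrow> local_variance L V) at_top"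
    unfolding inner
    by (rule Lim_transform_eventually)
       (use int in \<open>auto intro!: eventually_mono[OF eventually_ge_at_top[of 0]] simp: Bochner_Integration.integral_sum\<close>)
qed

end

section \<open>Inverse-square lattice sums\<close>

text \<open>The representative of \<open>n\<close> modulo \<open>L\<close> whose frequency lies in \<open>[-\<pi>, \<pi>]\<^sup>d\<close>, the domain on which
  the symbols of the feedback are compared with powers of \<open>|\<theta>|\<close>.\<close>

definition centre :: "nat \<Rightarrow> int ^ 'd \<Rightarrow> int ^ 'd" where
  "centre L n = (\<chi> i. if 2 * n $ i \<le> int L then n $ i else n $ i - int L)"

lemma tmod_centre:
  assumes "n \<in> torus L"
  shows "tmod L (centre L n) = n"
  using assms by (auto simp: tmod_def centre_def torus_def vec_eq_iff)

lemma centre_bound: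
  assumes "n \<in> torus L"
  shows "2 * \<bar>centre L n $ i\<bar> \<le> int L"
proof -
  have "0 \<le> n $ i" "n $ i < int L" using assms by (auto simp: torus_def)
  then show ?thesis by (auto simp: centre_def)
qed

lemma centre_nonzero:
  assumes "n \<in> torus L" "n \<noteq> 0"
  shows "centre L n \<noteq> 0"
proof
  assume "centre L n = 0"
  with tmod_centre[OF assms(1)] have "n = tmod L 0" by simp
  also have "\<dots> = 0" by (simp add: tmod_def vec_eq_iff)
  finally show False using assms(2) by contradiction
qed

definition radius2 :: "nat \<Rightarrow> int ^ 'd \<Rightarrow> real" where
  "radius2 L n = (\<Sum>i\<in>UNIV. (real_of_int (centre L n $ i))\<^sup>2)"

lemma radius2_ge_component: "(real_of_int (centre L n $ i))\<^sup>2 \<le> radius2 L n"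
  unfolding radius2_def by (rule member_le_sum) auto

lemma radius2_ge_1:
  assumes "n \<in> torus L - {0}"
  shows "radius2 L n \<ge> 1"
proof -
  obtain i where "centre L n $ i \<noteq> 0" using centre_nonzero[of n L] assms by (auto simp: vec_eq_iff)
  then have "1 \<le> \<bar>centre L n $ i\<bar>" by linarith
  then have "1 \<le> \<bar>real_of_int (centre L n $ i)\<bar>" by (simp add: of_int_abs[symmetric] del: of_int_abs)
  then have "1\<^sup>2 \<le> (real_of_int (centre L n $ i))\<^sup>2" by (subst abs_le_square_iff[symmetric]) simp
  with radius2_ge_component[of L n i] show ?thesis by simp
qed

lemma radius2_le:
  fixes n :: "int ^ 'd"
  assumes "n \<in> torus L"
  shows "radius2 L n \<le> real CARD('d) * (real L)\<^sup>2 / 4"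
proof -
  have "(real_of_int (centre L n $ i))\<^sup>2 \<le> (real L / 2)\<^sup>2" for i
  proof -
    have "real_of_int (2 * \<bar>centre L n $ i\<bar>) \<le> real_of_int (int L)"
      using centre_bound[OF assms] by (simp only: of_int_le_iff)
    then show ?thesis by (intro abs_le_square_iff[THEN iffD1]) simp
  qed
  then have "radius2 L n \<le> (\<Sum>i\<in>(UNIV :: 'd set). (real L / 2)\<^sup>2)"
    unfolding radius2_def by (intro sum_mono)
  then show ?thesis by (simp add: power_divide)
qed

definition shell :: "nat \<Rightarrow> int ^ 'd \<Rightarrow> nat" where
  "shell L n = Max (range (\<lambda>i. nat \<bar>centre L n $ i\<bar>))"

lemma shell_attained: "\<exists>i. shell L n = nat \<bar>centre L n $ i\<bar>"
proof -
  have "shell L n \<in> range (\<lambda>i. nat \<bar>centre L n $ i\<bar>)" unfolding shell_def by (rule Max_in) auto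
  then show ?thesis by auto
qed

lemma shell_ge: "\<bar>centre L n $ i\<bar> \<le> int (shell L n)"
proof -
  have "nat \<bar>centre L n $ i\<bar> \<le> shell L n" unfolding shell_def by (rule Max_ge) auto
  then show ?thesis by linarith
qed

lemma shell_le_radius: "(real (shell L n))\<^sup>2 \<le> radius2 L n"
proof -
  obtain i where "shell L n = nat \<bar>centre L n $ i\<bar>" using shell_attained by blast
  then have "real (shell L n) = \<bar>real_of_int (centre L n $ i)\<bar>" by simp
  then show ?thesis using radius2_ge_component[of L n i] by simp
qed

lemma shell_range:
  assumes "n \<in> torus L - {0}"
  shows "shell L n \<in> {1..L}"
proof -
  obtain i where i: "shell L n = nat \<bar>centre L n $ i\<bar>" using shell_attained by blast
  obtain j where "centre L n $ j \<noteq> 0" using centre_nonzero[of n L] assms by (auto simp: vec_eq_iff)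
  with shell_ge[of L n j] centre_bound[of n L i] i assms show ?thesis by auto
qed

text \<open>A point of the shell lies, for some direction \<open>i\<close>, in a face of the cube of half-width \<open>m\<close>
  orthogonal to \<open>i\<close>.\<close>

lemma shell_card:
  assumes m: "m \<ge> 1"
  shows "real (card {n \<in> torus L - {0 :: int ^ 'd}. shell L n = m})
     \<le> 2 * real CARD('d) * 3 ^ (CARD('d) - 1) * real m ^ (CARD('d) - 1)"
proof -
  define Box where "Box = (\<lambda>i::'d. {k :: int ^ 'd. \<forall>j. k $ j \<in> (if j = i then {- int m, int m} else {- int m..int m})})"
  have fin: "finite (Box i)" for i
    unfolding Box_def by (rule card_lattice_box) simp
  have card: "card (Box i) = 2 * (2 * m + 1) ^ (CARD('d) - 1)" for i
  proof -
    have "card (Box i) = (\<Prod>j\<in>UNIV. card (if j = i then {- int m, int m} else {- int m..int m}))"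
      unfolding Box_def by (rule card_lattice_box) simp
    also have "\<dots> = card {- int m, int m} * (\<Prod>j\<in>UNIV - {i}. card {- int m..int m})"
      by (subst prod.remove[of UNIV i]) auto
    also have "\<dots> = 2 * (2 * m + 1) ^ (CARD('d) - 1)"
    proof -
      have "card {- int m, int m} = 2" using m by (simp add: card_insert_if)
      moreover have "card {- int m..int m} = 2 * m + 1"
        unfolding card_atLeastAtMost_int by linarith
      ultimately show ?thesis by (simp add: card_Diff_singleton)
    qed
    finally show ?thesis .
  qed
  have inj: "inj_on (centre L) (torus L :: (int ^ 'd) set)"
    by (rule inj_on_inverseI[of _ "tmod L"]) (rule tmod_centre)
  have sub: "centre L ` {n \<in> torus L - {0 :: int ^ 'd}. shell L n = m} \<subseteq> (\<Union>i. Box i)"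
  proof (rule image_subsetI)
    fix n :: "int ^ 'd" assume "n \<in> {n \<in> torus L - {0}. shell L n = m}"
    then have m: "shell L n = m" by simp
    obtain i where i: "shell L n = nat \<bar>centre L n $ i\<bar>" using shell_attained by blast
    have "centre L n $ j \<in> {- int m..int m}" for j
      using shell_ge[of L n j] unfolding m by (simp add: abs_le_iff minus_le_iff)
    moreover have "centre L n $ i \<in> {- int m, int m}"
      using i unfolding m by (auto simp: abs_if split: if_splits)
    ultimately have "centre L n \<in> Box i" unfolding Box_def by simp
    then show "centre L n \<in> (\<Union>i. Box i)" by blast
  qed
  have "card {n \<in> torus L - {0 :: int ^ 'd}. shell L n = m} = card (centre L ` {n \<in> torus L - {0 :: int ^ 'd}. shell L n = m})"
    by (rule card_image[symmetric], rule inj_on_subset[OF inj]) auto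
  also have "\<dots> \<le> card (\<Union>i. Box i)" using sub fin by (intro card_mono) auto
  also have "\<dots> \<le> (\<Sum>i\<in>UNIV. card (Box i))" by (rule card_UN_le) simp
  also have "\<dots> = CARD('d) * (2 * (2 * m + 1) ^ (CARD('d) - 1))" by (simp add: card)
  also have "\<dots> \<le> CARD('d) * (2 * (3 * m) ^ (CARD('d) - 1))"
    using m by (intro mult_left_mono power_mono) auto
  finally have "real (card {n \<in> torus L - {0 :: int ^ 'd}. shell L n = m}) \<le> real (CARD('d) * (2 * (3 * m) ^ (CARD('d) - 1)))"
    by (simp only: of_nat_le_iff)
  then show ?thesis by (simp add: power_mult_distrib mult_ac)
qed

definition lattice_sum :: "'d::finite itself \<Rightarrow> nat \<Rightarrow> real" where
  "lattice_sum _ L = (\<Sum>n\<in>torus L - {0 :: int ^ 'd}. 1 / radius2 L n)"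

lemma sum_inverse_squares_le: "(\<Sum>m=1..L. 1 / (real m)\<^sup>2) \<le> 2"
proof (cases L)
  case (Suc n)
  have "(\<Sum>m=1..Suc n. 1 / (real m)\<^sup>2) \<le> 2 - 1 / real (Suc n)"
  proof (induction n)
    case (Suc n)
    define y where "y = real (Suc n)"
    have y: "y > 0" "real (Suc (Suc n)) = y + 1" by (simp_all add: y_def)
    have "1 / (y + 1)\<^sup>2 \<le> 1 / (y * (y + 1))"
      using y(1) by (intro divide_left_mono) (auto simp: power2_eq_square)
    also have "\<dots> = 1 / y - 1 / (y + 1)" using y(1) by (simp add: field_simps)
    finally have "1 / (real (Suc (Suc n)))\<^sup>2 \<le> 1 / real (Suc n) - 1 / real (Suc (Suc n))"
      by (simp only: y(2) y_def[symmetric])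
    with Suc show ?case by simp
  qed simp
  moreover have "1 / real (Suc n) \<ge> 0" by simp
  ultimately show ?thesis unfolding Suc by linarith
qed simp

lemma sum_reciprocals_le:
  assumes "L \<ge> 1"
  shows "(\<Sum>m=1..L. 1 / real m) \<le> 1 + ln (real L)"
proof -
  have "(harm L :: real) - ln (of_nat L) \<le> harm 1 - ln (of_nat 1)"
    by (rule euler_mascheroni_sequence_decreasing) (use assms in auto)
  then show ?thesis by (simp add: harm_def inverse_eq_divide)
qed

text \<open>Summing over shells in the maximum norm leaves \<open>\<Sum> m ^ (d - 3)\<close>, which is bounded,
  logarithmic or of order \<open>L ^ (d - 2)\<close> for \<open>d = 1\<close>, \<open>d = 2\<close> and \<open>d \<ge> 3\<close>.\<close>

lemma lattice_sum_upper:
  shows "\<exists>K>0. \<forall>L\<ge>3. lattice_sum TYPE('d::finite) L * (real L)\<^sup>2 / real (L ^ CARD('d)) \<le> K * global_rate 1 CARD('d) (L ^ CARD('d))"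
proof -
  define C where "C = 2 * real CARD('d) * 3 ^ (CARD('d) - 1)"
  have C: "C > 0" by (simp add: C_def)
  have shells: "lattice_sum TYPE('d) L \<le> C * (\<Sum>m=1..L. real m ^ (CARD('d) - 1) / (real m)\<^sup>2)" for L
  proof -
    have "lattice_sum TYPE('d) L \<le> (\<Sum>n\<in>torus L - {0 :: int ^ 'd}. 1 / (real (shell L n))\<^sup>2)"
      unfolding lattice_sum_def
    proof (rule sum_mono)
      fix n :: "int ^ 'd" assume n: "n \<in> torus L - {0}"
      have "0 < (real (shell L n))\<^sup>2" using shell_range[OF n] by simp
      then show "1 / radius2 L n \<le> 1 / (real (shell L n))\<^sup>2"
        using shell_le_radius[of L n] radius2_ge_1[OF n] by (intro divide_left_mono mult_pos_pos) auto
    qed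
    also have "\<dots> = (\<Sum>m=1..L. \<Sum>n | n \<in> torus L - {0 :: int ^ 'd} \<and> shell L n = m. 1 / (real (shell L n))\<^sup>2)"
      by (rule sum.group[symmetric]) (simp, simp, rule image_subsetI, rule shell_range)
    also have "\<dots> = (\<Sum>m=1..L. real (card {n \<in> torus L - {0 :: int ^ 'd}. shell L n = m}) / (real m)\<^sup>2)"
      by (intro sum.cong refl) (simp add: sum_constant[symmetric])
    also have "\<dots> \<le> (\<Sum>m=1..L. C * (real m ^ (CARD('d) - 1) / (real m)\<^sup>2))"
    proof (rule sum_mono)
      fix m assume "m \<in> {1..L}"
      then have "real (card {n \<in> torus L - {0 :: int ^ 'd}. shell L n = m}) / (real m)\<^sup>2
          \<le> (C * real m ^ (CARD('d) - 1)) / (real m)\<^sup>2"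
        using shell_card[of m L, where 'd = 'd] unfolding C_def by (intro divide_right_mono) auto
      then show "real (card {n \<in> torus L - {0 :: int ^ 'd}. shell L n = m}) / (real m)\<^sup>2
          \<le> C * (real m ^ (CARD('d) - 1) / (real m)\<^sup>2)" by simp
    qed
    finally show ?thesis by (simp add: sum_distrib_left)
  qed
  have "lattice_sum TYPE('d) L * (real L)\<^sup>2 / real (L ^ CARD('d)) \<le> 2 * C * global_rate 1 CARD('d) (L ^ CARD('d))"
    if L: "L \<ge> 3" for L
  proof -
    have Lpos: "real L > 0" using L by simp
    have le: "lattice_sum TYPE('d) L * (real L)\<^sup>2 / real (L ^ CARD('d))
        \<le> C * S * (real L)\<^sup>2 / real (L ^ CARD('d))"
      if "(\<Sum>m=1..L. real m ^ (CARD('d) - 1) / (real m)\<^sup>2) \<le> S" for S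
      using order_trans[OF shells mult_left_mono[OF that, of C]] C
      by (intro divide_right_mono mult_right_mono) auto
    consider "CARD('d) = 1" | "CARD('d) = 2" | "CARD('d) \<ge> 3"
      using zero_less_card_finite[where 'a = 'd] by linarith
    then show ?thesis
    proof cases
      case 1
      have "(\<Sum>m=1..L. real m ^ (CARD('d) - 1) / (real m)\<^sup>2) \<le> 2"
        using sum_inverse_squares_le 1 by simp
      from le[OF this] show ?thesis
        using Lpos 1 by (simp add: global_rate_def power2_eq_square)
    next
      case 2
      have "(\<Sum>m=1..L. real m ^ (CARD('d) - 1) / (real m)\<^sup>2) = (\<Sum>m=1..L. 1 / real m)"
        using 2 by (intro sum.cong refl) (simp add: power2_eq_square)
      also have "\<dots> \<le> 1 + ln (real L)" using L by (intro sum_reciprocals_le) simp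
      also have "\<dots> \<le> 2 * ln (real L)"
      proof -
        have "exp 1 \<le> real L" using exp_le L by linarith
        then have "1 \<le> ln (real L)" using Lpos by (simp add: ln_ge_iff)
        then show ?thesis by simp
      qed
      finally have "lattice_sum TYPE('d) L * (real L)\<^sup>2 / real (L ^ CARD('d))
          \<le> C * (2 * ln (real L)) * (real L)\<^sup>2 / real (L ^ CARD('d))"
        by (rule le)
      also have "\<dots> = C * ln (real (L ^ CARD('d)))"
        using Lpos 2 by (simp add: ln_realpow)
      also have "\<dots> \<le> 2 * C * ln (real (L ^ CARD('d)))"
        using C L by (intro mult_right_mono) auto
      finally show ?thesis using 2 by (simp add: global_rate_def)
    next
      case 3
      have "(\<Sum>m=1..L. real m ^ (CARD('d) - 1) / (real m)\<^sup>2) \<le> (\<Sum>m=1..L. real L ^ (CARD('d) - 3))"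
      proof (rule sum_mono)
        fix m assume m: "m \<in> {1..L}"
        have "CARD('d) - 1 = (CARD('d) - 3) + 2" using 3 by simp
        then have "real m ^ (CARD('d) - 1) / (real m)\<^sup>2 = real m ^ (CARD('d) - 3)"
          using m by (simp only: power_add) simp
        also have "\<dots> \<le> real L ^ (CARD('d) - 3)" using m by (intro power_mono) auto
        finally show "real m ^ (CARD('d) - 1) / (real m)\<^sup>2 \<le> real L ^ (CARD('d) - 3)" .
      qed
      also have "\<dots> = real L * real L ^ (CARD('d) - 3)" by simp
      finally have "lattice_sum TYPE('d) L * (real L)\<^sup>2 / real (L ^ CARD('d))
          \<le> C * (real L * real L ^ (CARD('d) - 3)) * (real L)\<^sup>2 / real (L ^ CARD('d))"
        by (rule le)
      also have "\<dots> = C"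
      proof -
        have "CARD('d) = Suc (CARD('d) - 3) + 2" using 3 by simp
        then have "real (L ^ CARD('d)) = real L * real L ^ (CARD('d) - 3) * (real L)\<^sup>2"
          by (metis of_nat_power power_Suc power_add)
        then show ?thesis using Lpos by simp
      qed
      finally show ?thesis using 3 C by (simp add: global_rate_def)
    qed
  qed
  with C show ?thesis by (intro exI[of _ "2 * C"]) auto
qed

lemma radius2_small:
  assumes "\<And>i. 0 \<le> n $ i" "\<And>i. 2 * n $ i \<le> int L"
  shows "radius2 L n = (\<Sum>i\<in>UNIV. (real_of_int (n $ i))\<^sup>2)"
  using assms by (simp add: radius2_def centre_def)

text \<open>The points with coordinates \<open>1 \<le> b \<le> a \<le> L / 2\<close> suffice: those with a given \<open>a\<close>
  contribute at least \<open>1 / (2 a)\<close>.\<close>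

lemma planar_lattice_sum_lower:
  assumes d: "CARD('d::finite) = 2" and L: "L \<ge> 1"
  shows "harm (L div 2) / 2 \<le> lattice_sum TYPE('d) L"
proof -
  obtain i j :: 'd where ij: "UNIV = {i, j}" "i \<noteq> j"
    using d by (auto simp: card_2_iff)
  define pt where "pt = (\<lambda>(a, b). (\<chi> l. if l = i then int a else int b) :: int ^ 'd)"
  define T where "T = (SIGMA a:{1..L div 2}. {1..a})"
  have pt: "pt (a, b) $ i = int a" "pt (a, b) $ j = int b" for a b
    using ij by (auto simp: pt_def)
  have inj: "inj_on pt T"
  proof (rule inj_onI, clarify)
    fix a b a' b' assume "pt (a, b) = pt (a', b')"
    then have "pt (a, b) $ i = pt (a', b') $ i" "pt (a, b) $ j = pt (a', b') $ j" by simp_all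
    then show "a = a' \<and> b = b'" by (simp add: pt)
  qed
  have all: "P i \<Longrightarrow> P j \<Longrightarrow> P l" for P and l :: 'd
    using ij(1) by (metis UNIV_I insertE singletonD)
  have half: "2 * int a \<le> int L" if "a \<le> L div 2" for a using that by linarith
  have in_modes: "pt (a, b) \<in> torus L - {0}" and rad: "1 / (2 * (real a)\<^sup>2) \<le> 1 / radius2 L (pt (a, b))"
    if "(a, b) \<in> T" for a b
  proof -
    have ab: "1 \<le> a" "a \<le> L div 2" "1 \<le> b" "b \<le> a" using that by (auto simp: T_def)
    have nn: "0 \<le> pt (a, b) $ l" for l by (rule all) (simp_all add: pt)
    have le: "2 * pt (a, b) $ l \<le> int L" for l
      by (rule all) (use ab half[of a] half[of b] in \<open>simp_all add: pt\<close>)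
    have "pt (a, b) $ l < int L" for l using le[of l] nn[of l] L by linarith
    moreover have "pt (a, b) \<noteq> 0" using pt(1)[of a b] ab by auto
    ultimately show "pt (a, b) \<in> torus L - {0}" using nn by (auto simp: torus_def)
    have "radius2 L (pt (a, b)) = (real a)\<^sup>2 + (real b)\<^sup>2"
      unfolding radius2_small[OF nn le] by (subst ij(1)) (use ij(2) in \<open>simp add: pt\<close>)
    moreover have "(real b)\<^sup>2 \<le> (real a)\<^sup>2" using ab by (intro power_mono) auto
    moreover have "(real a)\<^sup>2 > 0" using ab by simp
    ultimately show "1 / (2 * (real a)\<^sup>2) \<le> 1 / radius2 L (pt (a, b))"
      by (intro divide_left_mono mult_pos_pos) (auto intro: add_pos_nonneg)
  qed
  have "harm (L div 2) / 2 = (\<Sum>a=1..L div 2. \<Sum>b=1..a. 1 / (2 * (real a)\<^sup>2))"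
    unfolding harm_def sum_divide_distrib
    by (intro sum.cong refl) (simp add: power2_eq_square field_simps)
  also have "\<dots> = (\<Sum>p\<in>T. 1 / (2 * (real (fst p))\<^sup>2))"
    unfolding T_def by (subst sum.Sigma) (auto simp: case_prod_unfold)
  also have "\<dots> \<le> (\<Sum>p\<in>T. 1 / radius2 L (pt p))"
    using rad by (intro sum_mono) auto
  also have "\<dots> = (\<Sum>n\<in>pt ` T. 1 / radius2 L n)"
    by (simp add: sum.reindex[OF inj])
  also have "\<dots> \<le> lattice_sum TYPE('d) L"
    unfolding lattice_sum_def using in_modes
    by (intro sum_mono2) (auto simp: radius2_def intro!: sum_nonneg)
  finally show ?thesis .
qed

text \<open>In one dimension the single lowest frequency has the full order, in two dimensions the harmonic
  numbers appear, and for \<open>d \<ge> 3\<close> it is enough that no summand is below the order of \<open>1 / L\<^sup>2\<close>.\<close>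

lemma lattice_sum_lower:
  shows "\<exists>K>0. \<forall>L\<ge>4. K * global_rate 1 CARD('d::finite) (L ^ CARD('d)) \<le> lattice_sum TYPE('d) L * (real L)\<^sup>2 / real (L ^ CARD('d))"
proof -
  consider "CARD('d) = 1" | "CARD('d) = 2" | "CARD('d) \<ge> 3"
    using zero_less_card_finite[where 'a = 'd] by linarith
  then show ?thesis
  proof cases
    case 1
    have "1 * global_rate 1 CARD('d) (L ^ CARD('d)) \<le> lattice_sum TYPE('d) L * (real L)\<^sup>2 / real (L ^ CARD('d))"
      if L: "L \<ge> 4" for L
    proof -
      define e :: "int ^ 'd" where "e = (\<chi> i. 1)"
      have e: "e \<in> torus L - {0}" using L by (auto simp: torus_def e_def vec_eq_iff)
      have "radius2 L e = 1" using L 1 by (subst radius2_small) (auto simp: e_def)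
      then have "1 = (\<Sum>n\<in>{e}. 1 / radius2 L n)" by simp
      also have "\<dots> \<le> lattice_sum TYPE('d) L"
        unfolding lattice_sum_def using e by (intro sum_mono2) (auto simp: radius2_def intro!: sum_nonneg)
      finally have "1 * (real L)\<^sup>2 / real L \<le> lattice_sum TYPE('d) L * (real L)\<^sup>2 / real L"
        by (intro divide_right_mono mult_right_mono) auto
      then show ?thesis using 1 L by (simp add: global_rate_def power2_eq_square)
    qed
    then show ?thesis by (intro exI[of _ 1]) auto
  next
    case 2
    have "1 / 8 * global_rate 1 CARD('d) (L ^ CARD('d)) \<le> lattice_sum TYPE('d) L * (real L)\<^sup>2 / real (L ^ CARD('d))"
      if L: "L \<ge> 4" for L
    proof -
      have "ln (real L) \<le> 2 * ln (real (L div 2) + 1)"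
      proof -
        define y where "y = real (L div 2) + 1"
        have y: "real L \<le> 2 * y" "y \<ge> 2" using L by (auto simp: y_def)
        have "2 * y \<le> y * y" using y by (intro mult_right_mono) auto
        from order_trans[OF y(1) this] have "real L \<le> y\<^sup>2" unfolding power2_eq_square .
        then have "ln (real L) \<le> ln (y\<^sup>2)" using L y by (subst ln_le_cancel_iff) auto
        also have "\<dots> = 2 * ln y" using y by (simp add: ln_realpow)
        finally show ?thesis by (simp add: y_def)
      qed
      also have "\<dots> \<le> 2 * harm (L div 2)" using ln_le_harm by simp
      also have "\<dots> \<le> 4 * lattice_sum TYPE('d) L"
        using planar_lattice_sum_lower[OF 2, of L] L by simp
      finally have "ln (real L) / 4 \<le> lattice_sum TYPE('d) L" by simp
      moreover have "ln ((real L)\<^sup>2) = 2 * ln (real L)" using L by (simp add: ln_realpow)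
      ultimately show ?thesis using L 2 by (simp add: global_rate_def)
    qed
    then show ?thesis by (intro exI[of _ "1 / 8"]) auto
  next
    case 3
    have "2 / real CARD('d) * global_rate 1 CARD('d) (L ^ CARD('d)) \<le> lattice_sum TYPE('d) L * (real L)\<^sup>2 / real (L ^ CARD('d))"
      if L: "L \<ge> 4" for L
    proof -
      define N where "N = L ^ CARD('d)"
      have N: "real N \<ge> 2"
      proof -
        have "L ^ 1 \<le> N" unfolding N_def using L 3 by (intro power_increasing) auto
        then show ?thesis using L by simp
      qed
      have cardm: "real (card (torus L - {0 :: int ^ 'd})) = real N - 1"
        using zero_in_torus[where 'a = 'd, of L] L N by (simp add: card_torus N_def[symmetric] of_nat_diff)
      have "(\<Sum>n\<in>torus L - {0 :: int ^ 'd}. 4 / (real CARD('d) * (real L)\<^sup>2)) \<le> lattice_sum TYPE('d) L"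
        unfolding lattice_sum_def
      proof (rule sum_mono)
        fix n :: "int ^ 'd" assume n: "n \<in> torus L - {0}"
        have "1 / (real CARD('d) * (real L)\<^sup>2 / 4) \<le> 1 / radius2 L n"
          using radius2_le[of n L] radius2_ge_1[OF n] n by (intro divide_left_mono) auto
        then show "4 / (real CARD('d) * (real L)\<^sup>2) \<le> 1 / radius2 L n" by simp
      qed
      then have "(real N - 1) * (4 / (real CARD('d) * (real L)\<^sup>2)) \<le> lattice_sum TYPE('d) L"
        by (simp only: sum_constant cardm)
      then have "(real N - 1) * (4 / (real CARD('d) * (real L)\<^sup>2)) * (real L)\<^sup>2 / real N
          \<le> lattice_sum TYPE('d) L * (real L)\<^sup>2 / real N"
        by (intro divide_right_mono mult_right_mono) auto
      also have "(real N - 1) * (4 / (real CARD('d) * (real L)\<^sup>2)) * (real L)\<^sup>2 / real N = (real N - 1) * 4 / (real CARD('d) * real N)"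
        using L by simp
      finally have "(real N - 1) * 4 / (real CARD('d) * real N) \<le> lattice_sum TYPE('d) L * (real L)\<^sup>2 / real N" .
      moreover have "2 / real CARD('d) \<le> (real N - 1) * 4 / (real CARD('d) * real N)"
        using N by (simp add: field_simps)
      ultimately show ?thesis using 3 by (simp add: global_rate_def N_def)
    qed
    then show ?thesis by (intro exI[of _ "2 / real CARD('d)"]) auto
  qed
qed

section \<open>Scaling of the variances\<close>

text \<open>On \<open>[0, \<pi>/3]\<close> the difference increases, as \<open>cos \<ge> 1/2\<close> there; beyond, \<open>sin u \<ge> sin (\<pi>/3)\<close>
  exceeds \<open>\<pi>/4\<close>, the largest value of \<open>u / 2\<close>.\<close>

lemma half_le_sin:
  assumes "0 \<le> u" "u \<le> pi / 2"
  shows "u / 2 \<le> sin u"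
proof (cases "u \<le> pi / 3")
  case True
  have "(\<lambda>u. sin u - u / 2) 0 \<le> (\<lambda>u. sin u - u / 2) u"
  proof (rule DERIV_nonneg_imp_nondecreasing[OF assms(1)])
    fix x assume x: "0 \<le> x" "x \<le> u"
    have "cos (pi / 3) \<le> cos x" using x True pi_gt_zero by (intro cos_monotone_0_pi_le) auto
    then have "cos x - 1 / 2 \<ge> 0" by (simp add: cos_60)
    moreover have "((\<lambda>u. sin u - u / 2) has_real_derivative cos x - 1 / 2) (at x)"
      by (auto intro!: derivative_eq_intros)
    ultimately show "\<exists>y. ((\<lambda>u. sin u - u / 2) has_real_derivative y) (at x) \<and> 0 \<le> y" by blast
  qed
  then show ?thesis by simp
next
  case False
  have "sin (pi / 3) \<le> sin u" using False assms pi_gt_zero by (intro sin_monotone_2pi_le) auto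
  moreover have "u / 2 \<le> 4 / 5" using assms(2) pi_less_4 pi_approx by simp
  moreover have "8 / 5 \<le> sqrt 3" by (rule real_le_rsqrt) (simp add: power2_eq_square)
  ultimately show ?thesis by (simp add: sin_60)
qed

lemma one_minus_cos_bounds:
  fixes t :: real
  assumes "\<bar>t\<bar> \<le> pi"
  shows "t\<^sup>2 / 8 \<le> 1 - cos t" "1 - cos t \<le> t\<^sup>2 / 2"
proof -
  have c: "1 - cos t = 2 * (sin (\<bar>t\<bar> / 2))\<^sup>2"
    using cos_double_sin[of "\<bar>t\<bar> / 2"] by simp
  have "\<bar>t\<bar> / 4 \<le> sin (\<bar>t\<bar> / 2)" using half_le_sin[of "\<bar>t\<bar> / 2"] assms by simp
  then have "(\<bar>t\<bar> / 4)\<^sup>2 \<le> (sin (\<bar>t\<bar> / 2))\<^sup>2" by (intro power_mono) auto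
  then show "t\<^sup>2 / 8 \<le> 1 - cos t" unfolding c by (simp add: power_divide)
  have "\<bar>sin (\<bar>t\<bar> / 2)\<bar> \<le> \<bar>\<bar>t\<bar> / 2\<bar>" by (rule abs_sin_x_le_abs_x)
  then have "(sin (\<bar>t\<bar> / 2))\<^sup>2 \<le> (\<bar>t\<bar> / 2)\<^sup>2" by (subst abs_le_square_iff[symmetric])
  then show "1 - cos t \<le> t\<^sup>2 / 2" unfolding c by (simp add: power_divide)
qed

text \<open>No choice of \<open>\<alpha>\<close> and \<open>c\<close> beats the order \<open>1 / \<phi>\<close>. Making \<open>c\<close> large adds
  \<open>\<alpha> * c\<close> to the denominator, but the measurement noise adds \<open>(c * \<epsilon>)\<^sup>2\<close> to the numerator, and
  \<open>\<alpha>\<^sup>2 + (c * \<epsilon>)\<^sup>2\<close> dominates the product.\<close>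

lemma mode_variance_lower:
  assumes "\<alpha> > 0" "c \<ge> 0" "\<phi> > 0" "0 < \<gamma>" "\<gamma> \<le> \<Gamma>" "\<epsilon> > 0"
  shows "min (1 / (4 * \<Gamma>)) (\<epsilon> / 2) / \<phi> \<le> mode_variance \<alpha> c (c * \<epsilon>) \<phi> \<gamma>"
proof -
  define m where "m = min (1 / (4 * \<Gamma>)) (\<epsilon> / 2)"
  define D where "D = (\<alpha> + \<gamma>) * (\<alpha> * \<gamma> + c) + \<gamma> * \<phi>"
  have D: "D > 0" using assms by (simp add: D_def add_nonneg_pos)
  have m0: "m > 0" using assms by (simp add: m_def)
  have m1: "4 * m * \<gamma> \<le> 1"
  proof -
    have "m * (4 * \<gamma>) \<le> 1 / (4 * \<Gamma>) * (4 * \<Gamma>)"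
      using assms m0 by (intro mult_mono) (auto simp: m_def)
    then show ?thesis using assms by (simp add: mult_ac)
  qed
  have m2: "2 * m \<le> \<epsilon>" by (simp add: m_def)
  have "m * (2 * \<alpha> * D) = (2 * m * \<gamma>) * (\<alpha> * \<phi>) + (2 * m * \<gamma>) * (\<alpha>\<^sup>2 * (\<alpha> + \<gamma>)) + (2 * m) * (\<alpha> * c) * (\<alpha> + \<gamma>)"
    by (simp add: D_def power2_eq_square algebra_simps)
  also have "\<dots> \<le> 1 * (\<alpha> * \<phi>) + (1 / 2) * (\<alpha>\<^sup>2 * (\<alpha> + \<gamma>)) + \<epsilon> * (\<alpha> * c) * (\<alpha> + \<gamma>)"
    using assms m0 m1 m2 by (intro add_mono mult_right_mono) auto
  also have "\<epsilon> * (\<alpha> * c) * (\<alpha> + \<gamma>) \<le> (\<alpha>\<^sup>2 / 2 + (c * \<epsilon>)\<^sup>2 / 2) * (\<alpha> + \<gamma>)"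
  proof (rule mult_right_mono)
    show "\<epsilon> * (\<alpha> * c) \<le> \<alpha>\<^sup>2 / 2 + (c * \<epsilon>)\<^sup>2 / 2"
      using sum_squares_bound[of \<alpha> "c * \<epsilon>"] by (simp add: mult_ac)
  qed (use assms in simp)
  also have "1 * (\<alpha> * \<phi>) + (1 / 2) * (\<alpha>\<^sup>2 * (\<alpha> + \<gamma>)) + (\<alpha>\<^sup>2 / 2 + (c * \<epsilon>)\<^sup>2 / 2) * (\<alpha> + \<gamma>)
      = \<alpha> * \<phi> + (\<alpha>\<^sup>2 + (c * \<epsilon>)\<^sup>2) * (\<alpha> + \<gamma>) - (c * \<epsilon>)\<^sup>2 / 2 * (\<alpha> + \<gamma>)"
    by (simp add: field_simps)
  also have "\<dots> \<le> \<alpha> * \<phi> + (\<alpha>\<^sup>2 + (c * \<epsilon>)\<^sup>2) * (\<alpha> + \<gamma>)"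
    using assms by simp
  finally have "m * (2 * \<alpha> * D) / (2 * \<alpha> * \<phi> * D) \<le> (\<alpha> * \<phi> + (\<alpha>\<^sup>2 + (c * \<epsilon>)\<^sup>2) * (\<alpha> + \<gamma>)) / (2 * \<alpha> * \<phi> * D)"
    using assms D by (intro divide_right_mono) auto
  moreover have "m * (2 * \<alpha> * D) / (2 * \<alpha> * \<phi> * D) = m / \<phi>" using assms D by simp
  ultimately show ?thesis by (simp add: mode_variance_def m_def D_def)
qed

text \<open>For \<open>\<alpha> = 1\<close> all quantities stay bounded except for the factor \<open>1 / \<phi>\<close>. Letting \<open>c\<close>
  range over \<open>[0, 1]\<close> includes static feedback.\<close>

lemma mode_variance_upper:
  assumes "0 \<le> c" "c \<le> 1" "\<phi> > 0" "0 < g" "g \<le> \<gamma>"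
  shows "mode_variance 1 c (c * \<epsilon>) \<phi> \<gamma> \<le> (1 + \<epsilon>\<^sup>2) / (2 * g) / \<phi>"
proof -
  define K where "K = (1 + \<epsilon>\<^sup>2) / (2 * g)"
  define D where "D = (1 + \<gamma>) * (1 * \<gamma> + c) + \<gamma> * \<phi>"
  have D: "D > 0" using assms by (simp add: D_def add_nonneg_pos)
  have K0: "K > 0" using assms by (simp add: K_def add_pos_nonneg)
  have Kg: "1 + \<epsilon>\<^sup>2 \<le> 2 * K * \<gamma>"
  proof -
    have "1 + \<epsilon>\<^sup>2 = 2 * K * g" using assms by (simp add: K_def)
    also have "\<dots> \<le> 2 * K * \<gamma>" using K0 assms by (intro mult_left_mono) auto
    finally show ?thesis .
  qed
  have "c\<^sup>2 \<le> 1" using assms by (simp add: power_le_one)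
  then have \<kappa>: "(c * \<epsilon>)\<^sup>2 \<le> \<epsilon>\<^sup>2"
    using mult_right_mono[of "c\<^sup>2" 1 "\<epsilon>\<^sup>2"] by (simp add: power_mult_distrib)
  have "1 * \<phi> + (1\<^sup>2 + (c * \<epsilon>)\<^sup>2) * (1 + \<gamma>) \<le> (1 + \<epsilon>\<^sup>2) * \<phi> + (1 + \<epsilon>\<^sup>2) * (1 + \<gamma>)"
    using assms \<kappa> by (intro add_mono mult_right_mono) auto
  also have "\<dots> \<le> (2 * K * \<gamma>) * \<phi> + (2 * K * \<gamma>) * (1 + \<gamma>)"
    using assms Kg by (intro add_mono mult_right_mono) auto
  also have "\<dots> \<le> K * (2 * 1 * D)"
  proof -
    have "K * (2 * 1 * D) = (2 * K * \<gamma>) * \<phi> + (2 * K * \<gamma>) * (1 + \<gamma>) + 2 * K * c * (1 + \<gamma>)"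
      by (simp add: D_def algebra_simps)
    moreover have "2 * K * c * (1 + \<gamma>) \<ge> 0" using K0 assms by simp
    ultimately show ?thesis by linarith
  qed
  finally have "(1 * \<phi> + (1\<^sup>2 + (c * \<epsilon>)\<^sup>2) * (1 + \<gamma>)) / (2 * 1 * \<phi> * D) \<le> K * (2 * 1 * D) / (2 * 1 * \<phi> * D)"
    using assms D by (intro divide_right_mono) auto
  also have "\<dots> = K / \<phi>" using assms D by simp
  finally show ?thesis by (simp only: mode_variance_def K_def D_def)
qed

lemma sup_norm_pos:
  assumes "finite {k. f k \<noteq> 0}" "f k \<noteq> 0"
  shows "sup_norm f > 0"
proof -
  have "range (\<lambda>k. \<bar>f k\<bar>) \<subseteq> insert 0 ((\<lambda>k. \<bar>f k\<bar>) ` {k. f k \<noteq> 0})" by auto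
  then have "finite (range (\<lambda>k. \<bar>f k\<bar>))" using assms(1) finite_subset by blast
  then have "\<bar>f k\<bar> \<le> sup_norm f"
    unfolding sup_norm_def by (intro cSUP_upper bdd_above_finite) auto
  then show ?thesis using assms(2) by linarith
qed

lemma frequency_centre:
  fixes n :: "int ^ 'd"
  assumes L: "L > 0" and n: "n \<in> torus L"
  shows "\<bar>frequency L (centre L n) $ i\<bar> \<le> pi"
    and "(norm (frequency L (centre L n)))\<^sup>2 = (2 * pi)\<^sup>2 * (radius2 L n / (real L)\<^sup>2)"
    and "cos (phase L (centre L n) k) = cos (phase L n k)"
proof -
  have "real_of_int (2 * \<bar>centre L n $ i\<bar>) \<le> real_of_int (int L)"
    using centre_bound[OF n] by (simp only: of_int_le_iff)
  then have "2 * \<bar>real_of_int (centre L n $ i)\<bar> \<le> real L" by simp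
  then have "pi * (2 * \<bar>real_of_int (centre L n $ i)\<bar>) \<le> pi * real L" by (intro mult_left_mono) auto
  then show "\<bar>frequency L (centre L n) $ i\<bar> \<le> pi"
    using L by (simp add: frequency_def abs_mult field_simps)
  show "(norm (frequency L (centre L n)))\<^sup>2 = (2 * pi)\<^sup>2 * (radius2 L n / (real L)\<^sup>2)"
    unfolding power2_norm_eq_inner inner_vec_def frequency_def radius2_def
    by (simp add: power2_eq_square sum_distrib_left sum_divide_distrib mult_ac)
  have "cos (phase L n k) = cos (phase L k (tmod L (centre L n)))"
    by (simp add: tmod_centre[OF n] phase_commute)
  then show "cos (phase L (centre L n) k) = cos (phase L n k)"
    by (simp add: cos_sin_phase_tmod[OF L] phase_commute)
qed

lemma local_symbol_bounds:
  fixes n :: "int ^ 'd"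
  assumes L: "L > 0" and n: "n \<in> torus L"
  shows "pi\<^sup>2 * (radius2 L n / (real L)\<^sup>2) \<le> local_symbol L n"
    and "local_symbol L n \<le> (2 * pi)\<^sup>2 * (radius2 L n / (real L)\<^sup>2)"
proof -
  define \<theta> where "\<theta> = frequency L (centre L n)"
  have cos: "cos (phase L n (axis j 1)) = cos (\<theta> $ j)" for j
    unfolding frequency_centre(3)[OF L n, symmetric]
    unfolding phase_axis \<theta>_def frequency_def by simp
  have norm: "(norm \<theta>)\<^sup>2 = (\<Sum>j\<in>UNIV. (\<theta> $ j)\<^sup>2)"
    unfolding power2_norm_eq_inner inner_vec_def by (simp add: power2_eq_square)
  note b = one_minus_cos_bounds[OF frequency_centre(1)[OF L n], folded \<theta>_def]
  have "(norm \<theta>)\<^sup>2 / 4 \<le> (\<Sum>j\<in>UNIV. 2 * (1 - cos (\<theta> $ j)))"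
    unfolding norm sum_divide_distrib
  proof (rule sum_mono)
    fix j show "(\<theta> $ j)\<^sup>2 / 4 \<le> 2 * (1 - cos (\<theta> $ j))" using b(1)[of j] by simp
  qed
  then show "pi\<^sup>2 * (radius2 L n / (real L)\<^sup>2) \<le> local_symbol L n"
    unfolding local_symbol_def cos using frequency_centre(2)[OF L n] by (simp add: \<theta>_def power_mult_distrib)
  have "(\<Sum>j\<in>UNIV. 2 * (1 - cos (\<theta> $ j))) \<le> (norm \<theta>)\<^sup>2"
    unfolding norm
  proof (rule sum_mono)
    fix j show "2 * (1 - cos (\<theta> $ j)) \<le> (\<theta> $ j)\<^sup>2" using b(2)[of j] by simp
  qed
  then show "local_symbol L n \<le> (2 * pi)\<^sup>2 * (radius2 L n / (real L)\<^sup>2)"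
    unfolding local_symbol_def cos using frequency_centre(2)[OF L n] by (simp add: \<theta>_def)
qed

lemma feedback_spectrum:
  fixes f g :: "int ^ 'd \<Rightarrow> real"
  assumes "admissible_feedback f g g\<^sub>o"
  shows "\<exists>pl>0. \<exists>ph>0. \<exists>gl>0. \<exists>gh>0. \<forall>L>0. \<forall>n\<in>torus L - {0}.
    pl * (radius2 L n / (real L)\<^sup>2) \<le> - eigenvalue L (wrap L f) n \<and>
    - eigenvalue L (wrap L f) n \<le> ph * (radius2 L n / (real L)\<^sup>2) \<and>
    gl \<le> - eigenvalue L (wrap L g) n \<and> - eigenvalue L (wrap L g) n \<le> gh"
proof -
  have loc: "local_array f" "local_array g" and go: "g\<^sub>o > 0" and ne: "\<exists>k. f k \<noteq> 0"
    using assms by (auto simp: admissible_feedback_def)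
  obtain flo fhi where f: "flo > 0" "fhi > 0"
    "\<And>\<theta>. \<forall>i. - pi \<le> \<theta> $ i \<and> \<theta> $ i \<le> pi \<Longrightarrow>
      flo * (sup_norm f * (norm \<theta>)\<^sup>2) \<le> - Re (symbol {k. f k \<noteq> 0} f \<theta>) \<and>
      - Re (symbol {k. f k \<noteq> 0} f \<theta>) \<le> fhi * (sup_norm f * (norm \<theta>)\<^sup>2)"
    using assms unfolding admissible_feedback_def by blast
  obtain glo ghi where g: "glo > 0" "ghi > 0"
    "\<And>\<theta>. \<forall>i. - pi \<le> \<theta> $ i \<and> \<theta> $ i \<le> pi \<Longrightarrow>
      glo * g\<^sub>o \<le> - Re (symbol {k. g k \<noteq> 0} g \<theta>) \<and> - Re (symbol {k. g k \<noteq> 0} g \<theta>) \<le> ghi * g\<^sub>o"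
    using assms unfolding admissible_feedback_def by blast
  have s: "sup_norm f > 0" using ne sup_norm_pos[OF finite_support[OF loc(1)]] by blast
  have eig: "eigenvalue L (wrap L h) n = Re (symbol {k. h k \<noteq> 0} h (frequency L (centre L n)))"
    if "L > 0" "n \<in> torus L" "local_array h" for L n and h :: "int ^ 'd \<Rightarrow> real"
    unfolding eigenvalue_wrap[OF that(1) finite_support[OF that(3)]] Re_symbol
    by (simp add: frequency_centre(3)[OF that(1,2)])
  have range: "\<forall>i. - pi \<le> frequency L (centre L n) $ i \<and> frequency L (centre L n) $ i \<le> pi"
    if "L > 0" "n \<in> torus L" for L and n :: "int ^ 'd"
    using frequency_centre(1)[OF that] by (auto simp: abs_le_iff minus_le_iff)
  show ?thesis
  proof (rule exI[of _ "flo * sup_norm f * (2 * pi)\<^sup>2"], rule conjI, use f s in simp,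
      rule exI[of _ "fhi * sup_norm f * (2 * pi)\<^sup>2"], rule conjI, use f s in simp,
      rule exI[of _ "glo * g\<^sub>o"], rule conjI, use g go in simp,
      rule exI[of _ "ghi * g\<^sub>o"], rule conjI, use g go in simp, intro allI impI ballI)
    fix L :: nat and n :: "int ^ 'd" assume L: "L > 0" and "n \<in> torus L - {0}"
    then have n: "n \<in> torus L" by simp
    note F = f(3)[OF range[OF L n], folded eig[OF L n loc(1)], unfolded frequency_centre(2)[OF L n]]
    note G = g(3)[OF range[OF L n], folded eig[OF L n loc(2)]]
    show "flo * sup_norm f * (2 * pi)\<^sup>2 * (radius2 L n / (real L)\<^sup>2) \<le> - eigenvalue L (wrap L f) n \<and>
      - eigenvalue L (wrap L f) n \<le> fhi * sup_norm f * (2 * pi)\<^sup>2 * (radius2 L n / (real L)\<^sup>2) \<and>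
      glo * g\<^sub>o \<le> - eigenvalue L (wrap L g) n \<and> - eigenvalue L (wrap L g) n \<le> ghi * g\<^sub>o"
      using F G by (simp only: mult.assoc simp_thms)
  qed
qed

lemma gain_bound_pos:
  assumes "admissible_feedback f g g\<^sub>o"
  shows "gain_bound f g > 0"
proof -
  have "local_array f" "\<exists>k. f k \<noteq> 0" using assms by (auto simp: admissible_feedback_def)
  then have "sup_norm f > 0" using sup_norm_pos[OF finite_support] by blast
  then show ?thesis by (simp add: gain_bound_def)
qed

lemma ge_4_of_power:
  assumes "4 ^ CARD('d::finite) \<le> L ^ CARD('d)"
  shows "(4::nat) \<le> L"
  using assms by simp

lemma torus_modes_card:
  assumes "L \<ge> 4"
  shows "real (card (torus L - {0 :: int ^ 'd})) / real (L ^ CARD('d)) \<in> {1 / 2..1}"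
proof -
  have "L ^ 1 \<le> L ^ CARD('d)"
    using assms zero_less_card_finite[where 'a = 'd] by (intro power_increasing) auto
  then have N: "L ^ CARD('d) \<ge> 4" using assms by simp
  have "card (torus L - {0 :: int ^ 'd}) = L ^ CARD('d) - 1"
    using zero_in_torus[where 'a = 'd, of L] assms by (simp add: card_torus)
  then have "real (card (torus L - {0 :: int ^ 'd})) = real (L ^ CARD('d)) - 1"
    using N by (simp add: of_nat_diff del: of_nat_power)
  moreover have "(r - 1) / r \<in> {1 / 2..1}" if "r \<ge> 4" for r :: real
    using that by (simp add: field_simps)
  moreover have "real (L ^ CARD('d)) \<ge> 4" using N by (simp del: of_nat_power)
  ultimately show ?thesis by metis
qed

text \<open>This is \<open>(2 \<pi>)\<^sup>2 / |\<theta>|\<^sup>2\<close>, the order of the variance of a mode under static feedback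
  and the reference with which all designs are compared.\<close>

definition inverse_square :: "nat \<Rightarrow> int ^ 'd \<Rightarrow> real" where
  "inverse_square L n = (real L)\<^sup>2 / radius2 L n"

lemma local_variance_inverse_square:
  assumes L4: "L \<ge> 4"
  shows "real CARD('d) * (pi\<^sup>2 / 2) \<le> local_variance L (inverse_square L :: int ^ 'd \<Rightarrow> real)"
    and "local_variance L (inverse_square L :: int ^ 'd \<Rightarrow> real) \<le> real CARD('d) * (2 * pi)\<^sup>2"
proof -
  have L: "L > 0" using L4 by simp
  define r where "r = real (card (torus L - {0 :: int ^ 'd})) / real (L ^ CARD('d))"
  have r: "1 / 2 \<le> r" "r \<le> 1" using torus_modes_card[OF L4, where 'd = 'd] by (simp_all add: r_def)
  define S where "S = (\<Sum>n\<in>torus L - {0 :: int ^ 'd}. local_symbol L n * inverse_square L n)"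
  have each: "pi\<^sup>2 \<le> local_symbol L n * inverse_square L n" "local_symbol L n * inverse_square L n \<le> (2 * pi)\<^sup>2"
    if n: "n \<in> torus L - {0}" for n :: "int ^ 'd"
  proof -
    have pos: "radius2 L n > 0" "inverse_square L n > 0"
      using radius2_ge_1[OF n] L by (simp_all add: inverse_square_def)
    have cancel: "C * (radius2 L n / (real L)\<^sup>2) * inverse_square L n = C" for C
      using pos L by (simp add: inverse_square_def)
    have n': "n \<in> torus L" using n by simp
    show "pi\<^sup>2 \<le> local_symbol L n * inverse_square L n" "local_symbol L n * inverse_square L n \<le> (2 * pi)\<^sup>2"
      using mult_right_mono[OF local_symbol_bounds(1)[OF L n'], of "inverse_square L n"]
        mult_right_mono[OF local_symbol_bounds(2)[OF L n'], of "inverse_square L n"] pos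
      unfolding cancel by simp_all
  qed
  have "(\<Sum>n\<in>torus L - {0 :: int ^ 'd}. pi\<^sup>2) \<le> S" "S \<le> (\<Sum>n\<in>torus L - {0 :: int ^ 'd}. (2 * pi)\<^sup>2)"
    unfolding S_def by (intro sum_mono each; assumption)+
  then have "(\<Sum>n\<in>torus L - {0 :: int ^ 'd}. pi\<^sup>2) / real (L ^ CARD('d)) \<le> S / real (L ^ CARD('d))"
    "S / real (L ^ CARD('d)) \<le> (\<Sum>n\<in>torus L - {0 :: int ^ 'd}. (2 * pi)\<^sup>2) / real (L ^ CARD('d))"
    by (auto intro: divide_right_mono)
  then have "r * pi\<^sup>2 \<le> S / real (L ^ CARD('d))" "S / real (L ^ CARD('d)) \<le> r * (2 * pi)\<^sup>2"
    by (simp_all add: r_def)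
  moreover have "1 / 2 * pi\<^sup>2 \<le> r * pi\<^sup>2" "r * (2 * pi)\<^sup>2 \<le> 1 * (2 * pi)\<^sup>2"
    using r by (intro mult_right_mono; simp)+
  ultimately have "pi\<^sup>2 / 2 \<le> S / real (L ^ CARD('d))" "S / real (L ^ CARD('d)) \<le> (2 * pi)\<^sup>2"
    by linarith+
  then show "real CARD('d) * (pi\<^sup>2 / 2) \<le> local_variance L (inverse_square L :: int ^ 'd \<Rightarrow> real)"
    "local_variance L (inverse_square L :: int ^ 'd \<Rightarrow> real) \<le> real CARD('d) * (2 * pi)\<^sup>2"
    unfolding local_variance_def S_def by (intro mult_left_mono; simp)+
qed

lemma global_variance_inverse_square:
  "global_variance L (inverse_square L :: int ^ 'd \<Rightarrow> real)
     = real CARD('d) * (lattice_sum TYPE('d) L * (real L)\<^sup>2 / real (L ^ CARD('d)))"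
  by (simp add: global_variance_def inverse_square_def lattice_sum_def sum_distrib_right)

text \<open>The symbol of the local error cancels \<open>inverse_square\<close> up to constants, and the global error
  leaves the lattice sum. From \<open>L = 4\<close> on, the nonzero modes are at least half of all modes and the
  logarithm is bounded away from zero.\<close>

lemma inverse_square_scaling:
  assumes \<beta>: "\<beta> > 0"
  shows "scales_as CARD('d) (\<lambda>L. local_variance L (inverse_square L :: int ^ 'd \<Rightarrow> real)) (local_rate \<beta> CARD('d))"
    and "scales_as CARD('d) (\<lambda>L. global_variance L (inverse_square L :: int ^ 'd \<Rightarrow> real)) (global_rate \<beta> CARD('d))"
proof -
  let ?d = "real CARD('d)"
  have d: "?d > 0" using zero_less_card_finite[where 'a = 'd] by simp
  show "scales_as CARD('d) (\<lambda>L. local_variance L (inverse_square L :: int ^ 'd \<Rightarrow> real)) (local_rate \<beta> CARD('d))"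
    unfolding scales_as_def
  proof (intro exI conjI allI impI)
    show "?d * (pi\<^sup>2 / 2) * \<beta> > 0" "?d * (2 * pi)\<^sup>2 * \<beta> > 0" using d \<beta> by simp_all
    fix L :: nat assume "4 ^ CARD('d) \<le> L ^ CARD('d)"
    from local_variance_inverse_square[OF ge_4_of_power[OF this], where 'd = 'd]
    show "?d * (pi\<^sup>2 / 2) * \<beta> * local_rate \<beta> CARD('d) (L ^ CARD('d)) \<le> local_variance L (inverse_square L :: int ^ 'd \<Rightarrow> real)"
      "local_variance L (inverse_square L :: int ^ 'd \<Rightarrow> real) \<le> ?d * (2 * pi)\<^sup>2 * \<beta> * local_rate \<beta> CARD('d) (L ^ CARD('d))"
      using \<beta> by (simp_all add: local_rate_def)
  qed
  obtain lo where lo: "lo > 0" "\<And>L. L \<ge> 4 \<Longrightarrow> lo * global_rate 1 CARD('d) (L ^ CARD('d))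
      \<le> lattice_sum TYPE('d) L * (real L)\<^sup>2 / real (L ^ CARD('d))"
    using lattice_sum_lower[where 'd = 'd] by blast
  obtain hi where hi: "hi > 0" "\<And>L. L \<ge> 3 \<Longrightarrow> lattice_sum TYPE('d) L * (real L)\<^sup>2 / real (L ^ CARD('d))
      \<le> hi * global_rate 1 CARD('d) (L ^ CARD('d))"
    using lattice_sum_upper[where 'd = 'd] by blast
  have rate: "\<beta> * global_rate \<beta> CARD('d) N = global_rate 1 CARD('d) N" for N
    using \<beta> by (simp add: global_rate_def)
  show "scales_as CARD('d) (\<lambda>L. global_variance L (inverse_square L :: int ^ 'd \<Rightarrow> real)) (global_rate \<beta> CARD('d))"
    unfolding scales_as_def global_variance_inverse_square
  proof (intro exI conjI allI impI)
    show "?d * lo * \<beta> > 0" "?d * hi * \<beta> > 0" using d \<beta> lo(1) hi(1) by simp_all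
    fix L :: nat assume "4 ^ CARD('d) \<le> L ^ CARD('d)"
    then have L4: "L \<ge> 4" by (rule ge_4_of_power)
    show "?d * lo * \<beta> * global_rate \<beta> CARD('d) (L ^ CARD('d)) \<le> ?d * (lattice_sum TYPE('d) L * (real L)\<^sup>2 / real (L ^ CARD('d)))"
      unfolding mult.assoc rate by (intro mult_left_mono lo(2)[OF L4, unfolded mult.assoc]) simp
    show "?d * (lattice_sum TYPE('d) L * (real L)\<^sup>2 / real (L ^ CARD('d))) \<le> ?d * hi * \<beta> * global_rate \<beta> CARD('d) (L ^ CARD('d))"
      unfolding mult.assoc rate using hi(2)[of L] L4 by (intro mult_left_mono) (simp_all add: mult.assoc)
  qed
qed

lemma variance_mono:
  assumes "\<And>n. n \<in> torus L - {0} \<Longrightarrow> A * U n \<le> B * U' n"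
  shows "A * local_variance L U \<le> B * local_variance L U'" "A * global_variance L U \<le> B * global_variance L U'"
proof -
  let ?d = "real CARD('a)" and ?N = "real (L ^ CARD('a))"
  have pull: "C * (?d * (s / ?N)) = ?d * (C * s / ?N)" for C s by simp
  have "local_symbol L n \<ge> 0" for n :: "int ^ 'a"
    unfolding local_symbol_def by (intro sum_nonneg) simp
  then have le: "(\<Sum>n\<in>torus L - {0}. local_symbol L n * (A * U n)) \<le> (\<Sum>n\<in>torus L - {0}. local_symbol L n * (B * U' n))"
    using assms by (intro sum_mono mult_left_mono)
  have out: "(\<Sum>n\<in>torus L - {0}. local_symbol L n * (C * W n)) = C * (\<Sum>n\<in>torus L - {0}. local_symbol L n * W n)" for C W
    unfolding sum_distrib_left by (rule sum.cong[OF refl]) simp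
  show "A * local_variance L U \<le> B * local_variance L U'"
    using le unfolding local_variance_def pull out by (intro mult_left_mono divide_right_mono) simp_all
  have "A * (\<Sum>n\<in>torus L - {0}. U n) \<le> B * (\<Sum>n\<in>torus L - {0}. U' n)"
    unfolding sum_distrib_left using assms by (rule sum_mono)
  then show "A * global_variance L U \<le> B * global_variance L U'"
    unfolding global_variance_def pull by (intro mult_left_mono divide_right_mono) simp_all
qed

lemma scales_at_least_mono:
  assumes "scales_as d u r" "A > 0" "\<And>L. L > 0 \<Longrightarrow> A * u L \<le> u' L"
  shows "scales_at_least d u' r"
proof -
  obtain lo N where "lo > 0" and lo: "\<forall>L>0. N \<le> L ^ d \<longrightarrow> lo * r (L ^ d) \<le> u L"
    using assms(1) unfolding scales_as_def by blast
  have "A * lo * r (L ^ d) \<le> u' L" if "L > 0" "N \<le> L ^ d" for L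
    using order_trans[OF mult_left_mono[of "lo * r (L ^ d)" "u L" A] assms(3)] lo that assms(2)
    by (simp add: mult.assoc)
  then show ?thesis
    unfolding scales_at_least_def using \<open>lo > 0\<close> assms(2) by (intro exI[of _ "A * lo"]) auto
qed

lemma scales_as_mono:
  assumes "scales_as d u r" "scales_at_least d u' r" "B > 0" "\<And>L. L > 0 \<Longrightarrow> u' L \<le> B * u L"
  shows "scales_as d u' r"
proof -
  obtain hi N where hi0: "hi > 0" and hi: "\<forall>L>0. N \<le> L ^ d \<longrightarrow> u L \<le> hi * r (L ^ d)"
    using assms(1) unfolding scales_as_def by blast
  obtain lo N' where lo: "lo > 0" "\<forall>L>0. N' \<le> L ^ d \<longrightarrow> lo * r (L ^ d) \<le> u' L"
    using assms(2) unfolding scales_at_least_def by blast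
  have "u' L \<le> B * hi * r (L ^ d)" if "L > 0" "N \<le> L ^ d" for L
    using order_trans[OF assms(4) mult_left_mono[of "u L" "hi * r (L ^ d)" B]] hi that assms(3)
    by (simp add: mult.assoc)
  then show ?thesis
    unfolding scales_as_def using hi0 lo assms(3)
    by (intro exI[of _ lo] conjI exI[of _ "B * hi"] exI[of _ "max N N'"]) auto
qed

text \<open>The convolution maps a configuration to its mean minus itself, so that all nonzero modes have the
  eigenvalue \<open>- 1\<close>. This is the redesign that attains the optimal scaling.\<close>

definition consensus_array :: "nat \<Rightarrow> int ^ 'd \<Rightarrow> real" where
  "consensus_array L k = 1 / real (L ^ CARD('d)) - (if k = 0 then 1 else 0)"

lemma sum_consensus_array:
  fixes y :: "int ^ 'd \<Rightarrow> real"
  assumes "L > 0"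
  shows "(\<Sum>k\<in>torus L. consensus_array L k * y k) = (\<Sum>k\<in>torus L. y k) / real (L ^ CARD('d)) - y 0"
proof -
  have "(\<Sum>k\<in>torus L. consensus_array L k * y k) = (\<Sum>k\<in>torus L. y k / real (L ^ CARD('d)) - (if k = 0 then y 0 else 0))"
    by (rule sum.cong) (auto simp: consensus_array_def left_diff_distrib)
  then show ?thesis
    using zero_in_torus[where 'a = 'd, OF assms] by (simp add: sum_subtractf sum_divide_distrib)
qed

lemma eigenvalue_consensus_array:
  assumes "L > 0" "n \<in> torus L - {0}"
  shows "eigenvalue L (consensus_array L) n = - 1"
proof -
  obtain i where "\<not> int L dvd n $ i" using assms(2) by (rule not_dvd_mode)
  then show ?thesis
    by (simp add: eigenvalue_def sum_consensus_array[OF assms(1)] trig_sums_vanish[OF assms(1)])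
qed

lemma consensus_array_reflect:
  assumes "k \<in> torus L"
  shows "consensus_array L (tmod L (- k)) = consensus_array L k"
  using tmod_uminus_nonzero[OF assms] by (cases "k = 0") (auto simp: consensus_array_def tmod_def vec_eq_iff)

lemma consensus_design: "integral_design (consensus_array :: nat \<Rightarrow> int ^ 'd \<Rightarrow> real) (\<lambda>_. 1)"
  unfolding integral_design_def
proof (intro allI impI conjI ballI)
  fix L :: nat assume L: "L > 0"
  show "(\<Sum>k\<in>torus L. consensus_array L (k :: int ^ 'd)) = 0"
    using sum_consensus_array[OF L, of "\<lambda>_ :: int ^ 'd. 1"] L card_torus[where 'd = 'd, of L] by simp
  show "consensus_array L (tmod L (- k)) = consensus_array L k" if "k \<in> torus L" for k :: "int ^ 'd"
    by (rule consensus_array_reflect[OF that])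
  show "Re (symbol (torus L) (consensus_array L) (frequency L n)) < 0" if "n \<in> torus L - {0}" for n :: "int ^ 'd"
    using eigenvalue_consensus_array[OF L that] by (simp add: Re_symbol eigenvalue_def)
qed simp

definition modal_variances :: "nat \<Rightarrow> (int ^ 'd \<Rightarrow> real) \<Rightarrow> (int ^ 'd \<Rightarrow> real) \<Rightarrow> (int ^ 'd \<Rightarrow> real) \<Rightarrow> real \<Rightarrow> real \<Rightarrow> int ^ 'd \<Rightarrow> real" where
  "modal_variances L f g a c \<epsilon> n = mode_variance (- eigenvalue L a n) c (c * \<epsilon>) (- eigenvalue L (wrap L f) n) (- eigenvalue L (wrap L g) n)"

lemma feedback_stable:
  assumes "admissible_feedback f g g\<^sub>o" "L > 0" "n \<in> torus L - {0}"
  shows "eigenvalue L (wrap L f) n < 0" "eigenvalue L (wrap L g) n < 0"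
proof -
  obtain pl ph gl gh where b: "pl > 0" "ph > 0" "gl > 0" "gh > 0"
    and bounds: "\<forall>L>0. \<forall>n\<in>torus L - {0}.
      pl * (radius2 L n / (real L)\<^sup>2) \<le> - eigenvalue L (wrap L f) n \<and>
      - eigenvalue L (wrap L f) n \<le> ph * (radius2 L n / (real L)\<^sup>2) \<and>
      gl \<le> - eigenvalue L (wrap L g) n \<and> - eigenvalue L (wrap L g) n \<le> gh"
    using feedback_spectrum[OF assms(1)] by blast
  have f: "pl * (radius2 L n / (real L)\<^sup>2) \<le> - eigenvalue L (wrap L f) n"
    "- eigenvalue L (wrap L f) n \<le> ph * (radius2 L n / (real L)\<^sup>2)"
    and g: "gl \<le> - eigenvalue L (wrap L g) n" "- eigenvalue L (wrap L g) n \<le> gh"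
    if "L > 0" "n \<in> torus L - {0}" for L n
    using bounds that by blast+
  have "0 < pl * (radius2 L n / (real L)\<^sup>2)" using b(1) radius2_ge_1[OF assms(3)] assms(2) by simp
  with f(1)[OF assms(2,3)] show "eigenvalue L (wrap L f) n < 0" by linarith
  show "eigenvalue L (wrap L g) n < 0" using b(3) g(1)[OF assms(2,3)] by linarith
qed

lemma integral_network_variance:
  fixes f g a :: "int ^ 'd \<Rightarrow> real"
  assumes adm: "admissible_feedback f g g\<^sub>o" and \<epsilon>: "\<epsilon> > 0" and L: "L > 0" and c: "c > 0"
    and sym: "\<And>k. k \<in> torus L \<Longrightarrow> a (tmod L (- k)) = a k"
    and stable: "\<And>n. n \<in> torus L - {0} \<Longrightarrow> eigenvalue L a n < 0"
  shows "integral_variance TYPE('w) (global_error L) L f g a c \<epsilon> (global_variance L (modal_variances L f g a c \<epsilon>))"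
    and "integral_variance TYPE('w) (local_error L) L f g a c \<epsilon> (local_variance L (modal_variances L f g a c \<epsilon>))"
proof -
  have "per_site_variance M L (global_error L) x (global_variance L (modal_variances L f g a c \<epsilon>)) \<and>
      per_site_variance M L (local_error L) x (local_variance L (modal_variances L f g a c \<epsilon>))"
    if net: "integral_network M L f g a c \<epsilon> w \<eta> z x v" for M :: "'w measure" and w \<eta> z x v
  proof -
    have refl: "\<And>k. f (- k) = f k" "\<And>k. g (- k) = g k"
      using adm by (auto simp: admissible_feedback_def)
    interpret N: driven_network M L "wrap L f" "wrap L g" a c "c * \<epsilon>" w \<eta> z x v
    proof
      show "uncorrelated_white_noise M ((torus L \<times> UNIV) <+> (if c * \<epsilon> = 0 then {} else torus L \<times> UNIV)) (case_sum w \<eta>)"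
        using net c \<epsilon> by (simp add: integral_network_def)
      show "c \<ge> 0" using c by simp
      show "AE \<omega> in M. \<forall>k\<in>torus L. \<forall>t\<ge>0.
        z t \<omega> k = z 0 \<omega> k
          + integral {0..t} (\<lambda>s. conv L a (z s \<omega>) k - c *\<^sub>R v s \<omega> k)
          - (c * \<epsilon>) *\<^sub>R noise_at \<eta> t \<omega> k \<and>
        x t \<omega> k = x 0 \<omega> k + integral {0..t} (\<lambda>s. v s \<omega> k) \<and>
        v t \<omega> k = v 0 \<omega> k
          + integral {0..t} (\<lambda>s. z s \<omega> k + conv L (wrap L f) (x s \<omega>) k
                                  + conv L (wrap L g) (v s \<omega>) k)
          + noise_at w t \<omega> k"
        using net unfolding integral_network_def by blast
      show "state_process M L z" "state_process M L x" "state_process M L v"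
        using net unfolding integral_network_def by blast+
    qed (fact L | rule wrap_reflect[where f = f, OF L refl(1)] wrap_reflect[where f = g, OF L refl(2)] sym stable
        feedback_stable[OF adm L]; assumption)+
    have "N.V = modal_variances L f g a c \<epsilon>"
      by (rule ext) (simp add: N.V_def modal_variances_def)
    then show ?thesis using N.global_per_site_variance N.local_per_site_variance by simp
  qed
  then show "integral_variance TYPE('w) (global_error L) L f g a c \<epsilon> (global_variance L (modal_variances L f g a c \<epsilon>))"
    and "integral_variance TYPE('w) (local_error L) L f g a c \<epsilon> (local_variance L (modal_variances L f g a c \<epsilon>))"
    unfolding integral_variance_def by blast+
qed

text \<open>With \<open>c = 0\<close> the integral state decouples and may be taken to be zero; the array that
  would govern it only has to be stable.\<close>

lemma static_network_variance:
  fixes f g :: "int ^ 'd \<Rightarrow> real"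
  assumes adm: "admissible_feedback f g g\<^sub>o" and L: "L > 0"
  shows "static_variance TYPE('w) (global_error L) L f g (global_variance L (modal_variances L f g (consensus_array L) 0 \<epsilon>))"
    and "static_variance TYPE('w) (local_error L) L f g (local_variance L (modal_variances L f g (consensus_array L) 0 \<epsilon>))"
proof -
  have "per_site_variance M L (global_error L) x (global_variance L (modal_variances L f g (consensus_array L) 0 \<epsilon>)) \<and>
      per_site_variance M L (local_error L) x (local_variance L (modal_variances L f g (consensus_array L) 0 \<epsilon>))"
    if net: "static_network M L f g w x v" for M :: "'w measure" and w x v
  proof -
    have refl: "\<And>k. f (- k) = f k" "\<And>k. g (- k) = g k"
      using adm by (auto simp: admissible_feedback_def)
    interpret N: driven_network M L "wrap L f" "wrap L g" "consensus_array L" 0 0 w "\<lambda>_ _ _. 0" "\<lambda>_ _ _. 0" x v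
    proof
      show "uncorrelated_white_noise M ((torus L \<times> UNIV) <+> (if (0::real) = 0 then {} else torus L \<times> UNIV)) (case_sum w (\<lambda>_ _ _. 0))"
        using net by (simp add: static_network_def uncorrelated_white_noise_def Plus_def)
      have "AE \<omega> in M. \<forall>k\<in>torus L. \<forall>t\<ge>0.
        x t \<omega> k = x 0 \<omega> k + integral {0..t} (\<lambda>s. v s \<omega> k) \<and>
        v t \<omega> k = v 0 \<omega> k
          + integral {0..t} (\<lambda>s. conv L (wrap L f) (x s \<omega>) k + conv L (wrap L g) (v s \<omega>) k)
          + noise_at w t \<omega> k"
        using net unfolding static_network_def by blast
      then show "AE \<omega> in M. \<forall>k\<in>torus L. \<forall>t\<ge>0.
        0 = 0 + integral {0..t} (\<lambda>s. conv L (consensus_array L) (\<lambda>_. 0) k - 0 *\<^sub>R v s \<omega> k)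
          - 0 *\<^sub>R noise_at (\<lambda>_ _ _. 0) t \<omega> k \<and>
        x t \<omega> k = x 0 \<omega> k + integral {0..t} (\<lambda>s. v s \<omega> k) \<and>
        v t \<omega> k = v 0 \<omega> k
          + integral {0..t} (\<lambda>s. 0 + conv L (wrap L f) (x s \<omega>) k + conv L (wrap L g) (v s \<omega>) k)
          + noise_at w t \<omega> k"
        by (simp only: add_0 scaleR_zero_left diff_0_right conv_def scaleR_zero_right sum.neutral_const integral_0 simp_thms)
      show "state_process M L (\<lambda>_ _ _. 0 :: real ^ 'd)" by (simp add: state_process_def)
      show "state_process M L x" "state_process M L v" using net by (simp_all add: static_network_def)
      show "eigenvalue L (consensus_array L) n < 0" if "n \<in> torus L - {0}" for n :: "int ^ 'd"
        using eigenvalue_consensus_array[OF L that] by simp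
    qed (fact L | rule order_refl | rule wrap_reflect[where f = f, OF L refl(1)] wrap_reflect[where f = g, OF L refl(2)]
        consensus_array_reflect feedback_stable[OF adm L]; assumption)+
    have "N.V = modal_variances L f g (consensus_array L) 0 \<epsilon>"
      by (rule ext) (simp add: N.V_def modal_variances_def)
    then show ?thesis using N.global_per_site_variance N.local_per_site_variance by simp
  qed
  then show "static_variance TYPE('w) (global_error L) L f g (global_variance L (modal_variances L f g (consensus_array L) 0 \<epsilon>))"
    and "static_variance TYPE('w) (local_error L) L f g (local_variance L (modal_variances L f g (consensus_array L) 0 \<epsilon>))"
    unfolding static_variance_def by blast+
qed

lemma modal_variances_lower:
  fixes f g :: "int ^ 'd \<Rightarrow> real"
  assumes adm: "admissible_feedback f g g\<^sub>o" and \<epsilon>: "\<epsilon> > 0"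
  obtains A where "A > 0" "\<And>L a c n. L > 0 \<Longrightarrow> c \<ge> 0 \<Longrightarrow> n \<in> torus L - {0} \<Longrightarrow> eigenvalue L a n < 0 \<Longrightarrow>
    A * inverse_square L n \<le> modal_variances L f g a c \<epsilon> n"
proof -
  obtain pl ph gl gh where b: "pl > 0" "ph > 0" "gl > 0" "gh > 0"
    and bounds: "\<forall>L>0. \<forall>n\<in>torus L - {0}.
      pl * (radius2 L n / (real L)\<^sup>2) \<le> - eigenvalue L (wrap L f) n \<and>
      - eigenvalue L (wrap L f) n \<le> ph * (radius2 L n / (real L)\<^sup>2) \<and>
      gl \<le> - eigenvalue L (wrap L g) n \<and> - eigenvalue L (wrap L g) n \<le> gh"
    using feedback_spectrum[OF adm] by blast
  have f: "pl * (radius2 L n / (real L)\<^sup>2) \<le> - eigenvalue L (wrap L f) n"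
    "- eigenvalue L (wrap L f) n \<le> ph * (radius2 L n / (real L)\<^sup>2)"
    and g: "gl \<le> - eigenvalue L (wrap L g) n" "- eigenvalue L (wrap L g) n \<le> gh"
    if "L > 0" "n \<in> torus L - {0}" for L n
    using bounds that by blast+
  define m where "m = min (1 / (4 * gh)) (\<epsilon> / 2)"
  have m: "m > 0" using b \<epsilon> by (simp add: m_def)
  show ?thesis
  proof (rule that[of "m / ph"])
    show "m / ph > 0" using m b by simp
    fix L a c and n :: "int ^ 'd"
    assume L: "L > 0" and c: "(c::real) \<ge> 0" and n: "n \<in> torus L - {0}" and a: "eigenvalue L a n < 0"
    note st = feedback_stable[OF adm L n]
    have r: "radius2 L n > 0" using radius2_ge_1[OF n] by simp
    have "m / ph * ((real L)\<^sup>2 / radius2 L n) = m / (ph * (radius2 L n / (real L)\<^sup>2))"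
      using b L r by simp
    also have "\<dots> \<le> m / (- eigenvalue L (wrap L f) n)"
      using f(2)[OF L n] b(2) st m r L by (intro divide_left_mono mult_pos_pos) auto
    also have "\<dots> \<le> modal_variances L f g a c \<epsilon> n"
      unfolding modal_variances_def m_def
      by (rule mode_variance_lower) (use a c st g(2)[OF L n] \<epsilon> in auto)
    finally show "m / ph * inverse_square L n \<le> modal_variances L f g a c \<epsilon> n" unfolding inverse_square_def .
  qed
qed

lemma modal_variances_upper:
  fixes f g :: "int ^ 'd \<Rightarrow> real"
  assumes adm: "admissible_feedback f g g\<^sub>o"
  obtains B where "B > 0" "\<And>L c n. L > 0 \<Longrightarrow> 0 \<le> c \<Longrightarrow> c \<le> 1 \<Longrightarrow> n \<in> torus L - {0} \<Longrightarrow>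
    modal_variances L f g (consensus_array L) c \<epsilon> n \<le> B * inverse_square L n"
proof -
  obtain pl ph gl gh where b: "pl > 0" "ph > 0" "gl > 0" "gh > 0"
    and bounds: "\<forall>L>0. \<forall>n\<in>torus L - {0}.
      pl * (radius2 L n / (real L)\<^sup>2) \<le> - eigenvalue L (wrap L f) n \<and>
      - eigenvalue L (wrap L f) n \<le> ph * (radius2 L n / (real L)\<^sup>2) \<and>
      gl \<le> - eigenvalue L (wrap L g) n \<and> - eigenvalue L (wrap L g) n \<le> gh"
    using feedback_spectrum[OF adm] by blast
  have f: "pl * (radius2 L n / (real L)\<^sup>2) \<le> - eigenvalue L (wrap L f) n"
    "- eigenvalue L (wrap L f) n \<le> ph * (radius2 L n / (real L)\<^sup>2)"
    and g: "gl \<le> - eigenvalue L (wrap L g) n" "- eigenvalue L (wrap L g) n \<le> gh"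
    if "L > 0" "n \<in> torus L - {0}" for L n
    using bounds that by blast+
  define K where "K = (1 + \<epsilon>\<^sup>2) / (2 * gl)"
  have K: "K > 0" using b by (simp add: K_def add_pos_nonneg)
  show ?thesis
  proof (rule that[of "K / pl"])
    show "K / pl > 0" using K b by simp
    fix L c and n :: "int ^ 'd"
    assume L: "L > 0" and c: "0 \<le> (c::real)" "c \<le> 1" and n: "n \<in> torus L - {0}"
    note st = feedback_stable[OF adm L n]
    have r: "radius2 L n > 0" using radius2_ge_1[OF n] by simp
    have "modal_variances L f g (consensus_array L) c \<epsilon> n \<le> K / (- eigenvalue L (wrap L f) n)"
      unfolding modal_variances_def K_def eigenvalue_consensus_array[OF L n] minus_minus
      by (rule mode_variance_upper) (use c st b(3) g(1)[OF L n] in auto)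
    also have "\<dots> \<le> K / (pl * (radius2 L n / (real L)\<^sup>2))"
      using f(1)[OF L n] b(1) st K r L by (intro divide_left_mono mult_pos_pos) auto
    also have "\<dots> = K / pl * ((real L)\<^sup>2 / radius2 L n)"
      using b L r by simp
    finally show "modal_variances L f g (consensus_array L) c \<epsilon> n \<le> K / pl * inverse_square L n"
      unfolding inverse_square_def .
  qed
qed

theorem proposition8:
  fixes f g :: "int ^ 'd \<Rightarrow> real" and g\<^sub>o \<epsilon> :: real
  assumes "admissible_feedback f g g\<^sub>o" and "\<epsilon> > 0"
  shows
    "((\<exists>V. (\<forall>L>0. static_variance TYPE('w) (local_error L) L f g (V L)) \<and>
           scales_as CARD('d) V (local_rate (gain_bound f g) CARD('d))) \<and>
      (\<exists>V. (\<forall>L>0. static_variance TYPE('w) (global_error L) L f g (V L)) \<and>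
           scales_as CARD('d) V (global_rate (gain_bound f g) CARD('d)))) \<and>
     (\<exists>a c. integral_design a c \<and>
      (\<exists>V. (\<forall>L>0. integral_variance TYPE('w) (local_error L) L f g (a L) (c L) \<epsilon> (V L)) \<and>
           scales_as CARD('d) V (local_rate (gain_bound f g) CARD('d))) \<and>
      (\<exists>V. (\<forall>L>0. integral_variance TYPE('w) (global_error L) L f g (a L) (c L) \<epsilon> (V L)) \<and>
           scales_as CARD('d) V (global_rate (gain_bound f g) CARD('d)))) \<and>
     (\<forall>a c. integral_design a c \<longrightarrow>
      (\<exists>V. (\<forall>L>0. integral_variance TYPE('w) (local_error L) L f g (a L) (c L) \<epsilon> (V L)) \<and>
           scales_at_least CARD('d) V (local_rate (gain_bound f g) CARD('d))) \<and>
      (\<exists>V. (\<forall>L>0. integral_variance TYPE('w) (global_error L) L f g (a L) (c L) \<epsilon> (V L)) \<and>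
           scales_at_least CARD('d) V (global_rate (gain_bound f g) CARD('d))))"
proof -
  note adm = assms(1) and \<epsilon> = assms(2)
  note \<beta> = gain_bound_pos[OF adm]
  obtain A where A: "A > 0" "\<And>L a c n. L > 0 \<Longrightarrow> c \<ge> 0 \<Longrightarrow> n \<in> torus L - {0} \<Longrightarrow> eigenvalue L a n < 0 \<Longrightarrow>
      A * inverse_square L n \<le> modal_variances L f g a c \<epsilon> n"
    using modal_variances_lower[OF adm \<epsilon>] by blast
  obtain B where B: "B > 0" "\<And>L c n. L > 0 \<Longrightarrow> 0 \<le> c \<Longrightarrow> c \<le> 1 \<Longrightarrow> n \<in> torus L - {0} \<Longrightarrow>
      modal_variances L f g (consensus_array L) c \<epsilon> n \<le> B * inverse_square L n"
    using modal_variances_upper[OF adm] by blast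
  have design: "c L > 0" "\<And>k. k \<in> torus L \<Longrightarrow> a L (tmod L (- k)) = a L k"
    "\<And>n. n \<in> torus L - {0} \<Longrightarrow> eigenvalue L (a L) n < 0"
    if "integral_design a c" "L > 0" for a :: "nat \<Rightarrow> int ^ 'd \<Rightarrow> real" and c L
    using that by (auto simp: integral_design_def Re_symbol eigenvalue_def)
  note reference = inverse_square_scaling[where 'd = 'd, OF \<beta>]
  have lower: "scales_at_least CARD('d) (\<lambda>L. local_variance L (modal_variances L f g (a L) (c L) \<epsilon>)) (local_rate (gain_bound f g) CARD('d))"
    "scales_at_least CARD('d) (\<lambda>L. global_variance L (modal_variances L f g (a L) (c L) \<epsilon>)) (global_rate (gain_bound f g) CARD('d))"
    if c: "\<And>L. L > 0 \<Longrightarrow> c L \<ge> 0" and neg: "\<And>L n. L > 0 \<Longrightarrow> n \<in> torus L - {0} \<Longrightarrow> eigenvalue L (a L) n < 0"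
    for a :: "nat \<Rightarrow> int ^ 'd \<Rightarrow> real" and c
  proof -
    have "A * inverse_square L n \<le> 1 * modal_variances L f g (a L) (c L) \<epsilon> n" if L: "L > 0" and n: "n \<in> torus L - {0}" for L n
      unfolding mult_1 by (rule A(2)[OF L c[OF L] n neg[OF L n]])
    note mono = variance_mono[OF this, unfolded mult_1]
    show "scales_at_least CARD('d) (\<lambda>L. local_variance L (modal_variances L f g (a L) (c L) \<epsilon>)) (local_rate (gain_bound f g) CARD('d))"
      by (rule scales_at_least_mono[OF reference(1) A(1) mono(1)])
    show "scales_at_least CARD('d) (\<lambda>L. global_variance L (modal_variances L f g (a L) (c L) \<epsilon>)) (global_rate (gain_bound f g) CARD('d))"
      by (rule scales_at_least_mono[OF reference(2) A(1) mono(2)])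
  qed
  \<comment> \<open>static feedback is \<open>c = 0\<close>, the redesigned integral controller \<open>c = 1\<close>\<close>
  have sharp: "scales_as CARD('d) (\<lambda>L. local_variance L (modal_variances L f g (consensus_array L) c \<epsilon>)) (local_rate (gain_bound f g) CARD('d))"
    "scales_as CARD('d) (\<lambda>L. global_variance L (modal_variances L f g (consensus_array L) c \<epsilon>)) (global_rate (gain_bound f g) CARD('d))"
    if c: "0 \<le> c" "c \<le> 1" for c
  proof -
    have neg: "eigenvalue L (consensus_array L) n < 0" if "L > 0" "n \<in> torus L - {0}" for L and n :: "int ^ 'd"
      by (simp add: eigenvalue_consensus_array[OF that])
    have "1 * modal_variances L f g (consensus_array L) c \<epsilon> n \<le> B * inverse_square L n"
      if "L > 0" "n \<in> torus L - {0}" for L n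
      unfolding mult_1 by (rule B(2)[OF that(1) c that(2)])
    note mono = variance_mono[OF this, unfolded mult_1]
    note low = lower[where c = "\<lambda>_. c" and a = consensus_array, OF c(1) neg]
    show "scales_as CARD('d) (\<lambda>L. local_variance L (modal_variances L f g (consensus_array L) c \<epsilon>)) (local_rate (gain_bound f g) CARD('d))"
      by (rule scales_as_mono[OF reference(1) low(1) B(1) mono(1)])
    show "scales_as CARD('d) (\<lambda>L. global_variance L (modal_variances L f g (consensus_array L) c \<epsilon>)) (global_rate (gain_bound f g) CARD('d))"
      by (rule scales_as_mono[OF reference(2) low(2) B(1) mono(2)])
  qed
  have integral: "integral_variance TYPE('w) (global_error L) L f g (a L) (c L) \<epsilon> (global_variance L (modal_variances L f g (a L) (c L) \<epsilon>))"
    "integral_variance TYPE('w) (local_error L) L f g (a L) (c L) \<epsilon> (local_variance L (modal_variances L f g (a L) (c L) \<epsilon>))"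
    if "integral_design a c" "L > 0" for a :: "nat \<Rightarrow> int ^ 'd \<Rightarrow> real" and c L
    using integral_network_variance[OF adm \<epsilon> that(2) design(1)[OF that] design(2)[OF that] design(3)[OF that]] by blast+
  show ?thesis
  proof (intro conjI, goal_cases)
    case 1
    show ?case
      by (rule exI, rule conjI[OF _ sharp(1)[of 0]], intro allI impI, rule static_network_variance(2)[OF adm])
        simp_all
  next
    case 2
    show ?case
      by (rule exI, rule conjI[OF _ sharp(2)[of 0]], intro allI impI, rule static_network_variance(1)[OF adm])
        simp_all
  next
    case 3
    show ?case
    proof (rule exI[of _ consensus_array], rule exI[of _ "\<lambda>_. 1"], intro conjI, goal_cases)
      case 1
      show ?case by (rule consensus_design)
    next
      case 2
      show ?case
        by (rule exI, rule conjI[OF _ sharp(1)[of 1]], intro allI impI, rule integral(2)[OF consensus_design])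
          simp_all
    next
      case 3
      show ?case
        by (rule exI, rule conjI[OF _ sharp(2)[of 1]], intro allI impI, rule integral(1)[OF consensus_design])
          simp_all
    qed
  next
    case 4
    show ?case
    proof (intro allI impI)
      fix a :: "nat \<Rightarrow> int ^ 'd \<Rightarrow> real" and c
      assume d: "integral_design a c"
      note low = lower[of c a, OF less_imp_le[OF design(1)[OF d]] design(3)[OF d]]
      show "(\<exists>V. (\<forall>L>0. integral_variance TYPE('w) (local_error L) L f g (a L) (c L) \<epsilon> (V L)) \<and>
           scales_at_least CARD('d) V (local_rate (gain_bound f g) CARD('d))) \<and>
      (\<exists>V. (\<forall>L>0. integral_variance TYPE('w) (global_error L) L f g (a L) (c L) \<epsilon> (V L)) \<and>
           scales_at_least CARD('d) V (global_rate (gain_bound f g) CARD('d)))"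
        by (intro conjI; rule exI, rule conjI[OF _ low(1)] conjI[OF _ low(2)], intro allI impI, rule integral[OF d])
    qed
  qed
qed

end
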